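(* Suppose that $\mu\in\widetilde\Omega$. There are unique functions $\mathsf s_{\mathrm L},\mathsf s_{\mathrm R}:\mathbb R\times\mathbb R\to\mathbb T$ (the left and right global shocks) such that the following two properties hold: (1) For each $\theta,t\in\mathbb R$, we have $\mathsf{GS}_{\theta,t}=\{\mathsf s_{\mathrm L}(\theta,t),\mathsf s_{\mathrm R}(\theta,t)\}$. (2) For each fixed $t\in\mathbb R$ and $\square\in\{\mathrm L,\mathrm R\}$, the function $\theta\mapsto\mathsf s_\square(\theta,t)$ is piecewise continuous. In particular, for each fixed $t\in\mathbb R$, the set $\{\theta\in\mathbb R:\mathsf s_{\mathrm L}(\theta,t)\ne\mathsf s_{\mathrm R}(\theta,t)\}$ is discrete, and $$\mathsf s_{\mathrm L}(\theta,t)=\lim_{\theta'\uparrow\theta}\mathsf s_\diamond(\theta',t)\quad\text{and}\quad\mathsf s_{\mathrm R}(\theta,t)=\lim_{\theta'\downarrow\theta}\mathsf s_\diamond(\theta',t)$$ for each $\theta\in\mathbb R$ and $\diamond\in\{\mathrm L,\mathrm R\}$. Moreover, these functions have the following additional properties (not necessary for the uniqueness statement): (3) For each fixed $\theta\in\mathbb R$ and $\square\in\{\mathrm L,\mathrm R\}$, the map $t\mapsto\mathsf s_\square(\theta,t)$ is continuous. (4) If $\theta\in\mathbb R\setminus\Theta_\otimes$, then $\mathsf s_{\mathrm L}(\theta,t)=\mathsf s_{\mathrm R}(\theta,t)$ for all $t\in\mathbb R$. If $\theta\in\Theta_\otimes$, then there exists $s_\wedge(\theta)\in(s_\otimes(\theta),\infty)$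 such that $\{t\in\mathbb R:\mathsf s_{\mathrm L}(\theta,t)\ne\mathsf s_{\mathrm R}(\theta,t)\}=(s_\otimes(\theta),s_\wedge(\theta))$.
   Context: $\mathbb T=\mathbb R/\mathbb Z$; derivatives of $\mathbb T$-valued functions are real-valued (via local lifts). A set is discrete if it has no accumulation points in the ambient space. $\Omega$ is the set of purely atomic (nonnegative) measures $\mu$ on $\mathbb R\times\mathbb T$, with atoms of finite mass, such that $\mathsf N:=\operatorname{supp}\mu$ is discrete. For $\theta\in\mathbb R$, $s<t$ and $X\in H^1([s,t];\mathbb T)$ the action is $\mathcal A_{\theta,s,t}[X]=\frac12\int_s^t(X'(r)-\theta)^2\,dr-\mu(\{(r,X(r)): r\in[s,t)\})$. $\mathscr M^\theta_{s,y\mid t,x}$ is the set of $X\in H^1([s,t];\mathbb T)$ with $X(s)=y$, $X(t)=x$ that minimize $\mathcal A_{\theta,s,t}$ among all such paths. $\mathscr M^\theta_t$ is the set of $X\in H^1_{\mathrm{loc}}((-\infty,t];\mathbb T)$ with $X|_{[s,t]}\in\mathscr M^\theta_{s,X(s)\mid t,X(t)}$ for all $s<t$, and $\mathscr M^\theta_{t,x}=\{X\in\mathscr M^\theta_t: X(t)=x\}$. On $\mathscr M^\theta_{t,x}$ the order is: $X_1\preccurlyeq X_2$ if $\int_r^tX_1'(s)\,ds\ge\int_r^tX_2'(s)\,ds$ for all $r\le t$. $\widetilde\Omega_1$ is the set of $\mu\in\Omega$ for which there is $M=M(\mu)>0$ such that for all $t\in\mathbb R$ there are $s=s(t)\le t-M$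 and $y\in\mathbb T$ with $\mathsf N\cap([s-M,s+M]\times\mathbb T)=\{(s,y)\}$ and $\mu(\{(s,y)\})>\frac1{4M}$, and moreover $s(t)$ can be chosen so that $\lim_{t\to+\infty}s(t)=+\infty$. For $\mu\in\widetilde\Omega_1$, each $\mathscr M^\theta_{t,x}$ is nonempty, consists of piecewise-linear paths, and has unique minimal and maximal elements $X_{\theta,t,x,\mathrm L}$ and $X_{\theta,t,x,\mathrm R}$ under $\preccurlyeq$. Put $u_{\theta,\square}(t,x)=X_{\theta,t,x,\square}'(t-)$ (derivative from below at $t$) for $\square\in\{\mathrm L,\mathrm R\}$. The shock set is $\mathsf S=\{(\theta,t,x)\in\mathbb R\times\mathbb R\times\mathbb T: u_{\theta,\mathrm L}(t,x)>u_{\theta,\mathrm R}(t,x)\}$, and $\mathsf S_\theta=\{(t,x):(\theta,t,x)\in\mathsf S\}$. For $(\theta,t,x)\in\mathsf S$, $T_\vee(\theta,t,x)=\sup\{s<t: X_{\theta,t,x,\mathrm L}(s)=X_{\theta,t,x,\mathrm R}(s)\}$. The set of global shocks is $\mathsf{GS}=\{(\theta,t,x)\in\mathsf S:\int_{T_\vee(\theta,t,x)}^tX_{\theta,t,x,\mathrm L}'(s)\,ds>\int_{T_\vee(\theta,t,x)}^tX_{\theta,t,x,\mathrm R}'(s)\,ds\}$; $\mathsf{GS}_\theta=\{(t,x):(\theta,t,x)\in\mathsf{GS}\}$ and $\mathsf{GS}_{\theta,t}=\{x:(\theta,t,x)\in\mathsf{GS}\}$. $\widetilde\Omega$ is the set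 of $\mu\in\widetilde\Omega_1$ such that for every $\theta\in\mathbb R$ we have $\#(\mathsf{GS}_\theta\cap\mathsf N)\le1$ and $(\mathsf S_\theta\cap\mathsf N)\setminus\mathsf{GS}_\theta=\varnothing$. For $\mu\in\widetilde\Omega$, $\Theta_\otimes=\{\theta\in\mathbb R:\#(\mathsf{GS}_\theta\cap\mathsf N)=1\}$, and for $\theta\in\Theta_\otimes$, $(s_\otimes(\theta),y_\otimes(\theta))$ denotes the unique element of $\mathsf{GS}_\theta\cap\mathsf N$. *)

theory Defs
  imports "HOL-Analysis.Analysis"
begin

section \<open>The torus \<open>\<real>/\<int>\<close>\<close>

quotient_type torus = real / "\<lambda>x y :: real. x - y \<in> \<int>"
proof (rule equivpI)
  show "reflp (\<lambda>x y :: real. x - y \<in> \<int>)"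
    by (simp add: reflp_def)
  show "symp (\<lambda>x y :: real. x - y \<in> \<int>)"
    by (metis (no_types, lifting) Ints_minus minus_diff_eq sympI)
  show "transp (\<lambda>x y :: real. x - y \<in> \<int>)"
    by (metis (no_types, lifting) Ints_add add_diff_eq diff_add_cancel transpI)
qed

lift_definition proj :: "real \<Rightarrow> torus" is "\<lambda>x. x" .

lemma proj_eq_iff: "proj a = proj b \<longleftrightarrow> a - b \<in> \<int>"
  by transfer simp

lemma proj_surj: "\<exists>a. x = proj a"
  by transfer (metis Ints_0 diff_self)

lemma round_dist_shift:
  fixes c d :: real
  assumes "c - d \<in> \<int>"
  shows "\<bar>c - of_int (round c)\<bar> \<le> \<bar>d - of_int (round d)\<bar>"
proof -
  obtain k :: int where "c - d = of_int k"
    using assms Ints_cases by blast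
  then have "d - of_int (round d) = c - of_int (k + round d)"
    by simp
  then show ?thesis
    by (metis round_diff_minimal)
qed

instantiation torus :: metric_space
begin

lift_definition dist_torus :: "torus \<Rightarrow> torus \<Rightarrow> real"
  is "\<lambda>a b. \<bar>a - b - of_int (round (a - b))\<bar>"
proof (rule antisym)
  fix a b c d :: real
  assume *: "a - b \<in> \<int>" "c - d \<in> \<int>"
  have "(a - c) - (b - d) \<in> \<int>"
    using Ints_diff[OF *] by (simp add: algebra_simps)
  then show "\<bar>a - c - of_int (round (a - c))\<bar> \<le> \<bar>b - d - of_int (round (b - d))\<bar>"
    by (rule round_dist_shift)
  have "(b - d) - (a - c) \<in> \<int>"
    using Ints_diff[OF *(2) *(1)] by (simp add: algebra_simps)
  then show "\<bar>b - d - of_int (round (b - d))\<bar> \<le> \<bar>a - c - of_int (round (a - c))\<bar>"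
    by (rule round_dist_shift)
qed

definition uniformity_torus :: "(torus \<times> torus) filter"
  where "uniformity_torus = (INF e\<in>{0<..}. principal {(x, y). dist x y < e})"

definition open_torus :: "torus set \<Rightarrow> bool"
  where "open_torus U \<longleftrightarrow> (\<forall>x\<in>U. eventually (\<lambda>(x', y). x' = x \<longrightarrow> y \<in> U) uniformity)"

instance
proof
  show "uniformity = (INF e\<in>{0<..}. principal {(x :: torus, y). dist x y < e})"
    by (rule uniformity_torus_def)
  show "open U \<longleftrightarrow> (\<forall>x\<in>U. eventually (\<lambda>(x', y). x' = x \<longrightarrow> y \<in> U) uniformity)"
    for U :: "torus set"
    by (rule open_torus_def)
  show "dist x y = 0 \<longleftrightarrow> x = y" for x y :: torus
  proof transfer
    fix a b :: real
    show "\<bar>a - b - of_int (round (a - b))\<bar> = 0 \<longleftrightarrow> a - b \<in> \<int>"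
      by (auto elim!: Ints_cases) (metis Ints_of_int)
  qed
  show "dist x y \<le> dist x z + dist y z" for x y z :: torus
  proof transfer
    fix a b c :: real
    have "\<bar>a - b - of_int (round (a - b))\<bar>
        \<le> \<bar>a - b - of_int (round (a - c) - round (b - c))\<bar>"
      by (rule round_diff_minimal)
    then show "\<bar>a - b - of_int (round (a - b))\<bar>
        \<le> \<bar>a - c - of_int (round (a - c))\<bar> + \<bar>b - c - of_int (round (b - c))\<bar>"
      by simp
  qed
qed

end

lemma dist_proj: "dist (proj a) (proj b) = \<bar>a - b - of_int (round (a - b))\<bar>"
  by transfer simp

text \<open>The metric induces the quotient topology.\<close>

lemma open_torus_iff: "open (U :: torus set) \<longleftrightarrow> open (proj -` U)"
proof
  have le: "dist (proj a) (proj b) \<le> dist a b" for a b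
    using round_diff_minimal[of "a - b" 0] by (simp add: dist_proj dist_real_def)
  assume U: "open U"
  show "open (proj -` U)"
    unfolding open_dist
  proof
    fix a assume "a \<in> proj -` U"
    then obtain e where "e > 0" "\<And>y. dist y (proj a) < e \<Longrightarrow> y \<in> U"
      using U unfolding open_dist by auto
    then show "\<exists>e>0. \<forall>y. dist y a < e \<longrightarrow> y \<in> proj -` U"
      by (intro exI[of _ e]) (use le le_less_trans in \<open>auto, blast\<close>)
  qed
next
  assume U: "open (proj -` U)"
  show "open U"
    unfolding open_dist
  proof
    fix x assume "x \<in> U"
    moreover obtain a where a: "x = proj a" using proj_surj by blast
    ultimately obtain e where e: "e > 0" "\<And>y. dist y a < e \<Longrightarrow> proj y \<in> U"
      using U unfolding open_dist by auto
    have "y \<in> U" if "dist y x < e" for y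
    proof -
      obtain b where b: "y = proj b" using proj_surj by blast
      define c where "c = b - of_int (round (b - a))"
      have "proj c = y"
        by (simp add: b c_def proj_eq_iff)
      moreover have "dist c a < e"
        using that by (simp add: a b c_def dist_proj dist_real_def algebra_simps)
      ultimately show ?thesis using e by blast
    qed
    with e show "\<exists>e>0. \<forall>y. dist y x < e \<longrightarrow> y \<in> U" by blast
  qed
qed

text \<open>
  The lift \<open>f\<close> must represent \<open>X\<close> at \<open>t\<close> itself as well as along \<open>F\<close>, which
  makes \<open>D\<close> unique for a one-sided filter \<open>F\<close> at \<open>t\<close>.
\<close>

definition has_torus_derivative :: "(real \<Rightarrow> torus) \<Rightarrow> real \<Rightarrow> real filter \<Rightarrow> real \<Rightarrow> bool"
  where "has_torus_derivative X D F t \<longleftrightarrow>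
    (\<exists>f. (f has_real_derivative D) F \<and> X t = proj (f t) \<and> (\<forall>\<^sub>F r in F. X r = proj (f r)))"

definition left_deriv :: "(real \<Rightarrow> torus) \<Rightarrow> real \<Rightarrow> real"
  where "left_deriv X t = (THE D. has_torus_derivative X D (at_left t) t)"


section \<open>Sobolev paths\<close>

text \<open>
  \<open>g\<close> is a square-integrable weak derivative of \<open>X\<close> on \<open>[s, t]\<close>; the lift of \<open>X\<close>
  is \<open>r \<mapsto> a + \<integral>\<^sub>s\<^sup>r g\<close>. Such a \<open>g\<close> is unique up to null sets.
\<close>

definition weak_deriv_on :: "(real \<Rightarrow> torus) \<Rightarrow> (real \<Rightarrow> real) \<Rightarrow> real \<Rightarrow> real \<Rightarrow> bool"
  where "weak_deriv_on X g s t \<longleftrightarrow>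
    set_borel_measurable lborel {s..t} g \<and>
    set_integrable lborel {s..t} (\<lambda>r. (g r)\<^sup>2) \<and>
    (\<exists>a. \<forall>r\<in>{s..t}. X r = proj (a + (LBINT q:{s..r}. g q)))"

text \<open>
  Paths on \<open>[s, t]\<close> or \<open>(-\<infinity>, t]\<close> are total functions that are \<^term>\<open>undefined\<close> off their domain,
  so that equality of paths is equality of functions.
\<close>

definition H1 :: "real \<Rightarrow> real \<Rightarrow> (real \<Rightarrow> torus) set"
  where "H1 s t = {X \<in> extensional {s..t}. \<exists>g. weak_deriv_on X g s t}"

definition H1_loc :: "real \<Rightarrow> (real \<Rightarrow> torus) set"
  where "H1_loc t = {X \<in> extensional {..t}. \<forall>s<t. restrict X {s..t} \<in> H1 s t}"

definition wderiv :: "real \<Rightarrow> real \<Rightarrow> (real \<Rightarrow> torus) \<Rightarrow> real \<Rightarrow> real"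
  where "wderiv s t X = (SOME g. weak_deriv_on X g s t)"

definition displacement :: "(real \<Rightarrow> torus) \<Rightarrow> real \<Rightarrow> real \<Rightarrow> real"
  where "displacement X s t = (LBINT r:{s..t}. wderiv s t X r)"


section \<open>Environments\<close>

definition no_accumulation :: "'a::topological_space set \<Rightarrow> bool"
  where "no_accumulation A \<longleftrightarrow> (\<forall>p. \<not> p islimpt A)"

definition msupp :: "'a::topological_space measure \<Rightarrow> 'a set"
  where "msupp \<mu> = {p. \<forall>U. open U \<longrightarrow> p \<in> U \<longrightarrow> emeasure \<mu> U > 0}"

definition purely_atomic :: "'a measure \<Rightarrow> bool"
  where "purely_atomic \<mu> \<longleftrightarrow>
    (\<forall>A\<in>sets \<mu>. emeasure \<mu> A = (\<integral>\<^sup>+p. emeasure \<mu> {p} \<partial>count_space A))"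

definition Omega :: "(real \<times> torus) measure set"
  where "Omega = {\<mu>. sets \<mu> = sets borel \<and> purely_atomic \<mu> \<and>
    (\<forall>p. emeasure \<mu> {p} < \<infinity>) \<and> no_accumulation (msupp \<mu>)}"

definition Omega1 :: "(real \<times> torus) measure set"
  where "Omega1 = {\<mu> \<in> Omega. \<exists>M>0. \<exists>s :: real \<Rightarrow> real.
    (\<forall>t. s t \<le> t - M \<and>
      (\<exists>y. msupp \<mu> \<inter> ({s t - M..s t + M} \<times> UNIV) = {(s t, y)} \<and>
           measure \<mu> {(s t, y)} > 1 / (4 * M))) \<and>
    filterlim s at_top at_top}"


section \<open>Action and minimizers\<close>

definition action :: "(real \<times> torus) measure \<Rightarrow> real \<Rightarrow> real \<Rightarrow> real \<Rightarrow> (real \<Rightarrow> torus) \<Rightarrow> real"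
  where "action \<mu> \<theta> s t X =
    1 / 2 * (LBINT r:{s..t}. (wderiv s t X r - \<theta>)\<^sup>2) - measure \<mu> ((\<lambda>r. (r, X r)) ` {s..<t})"

definition minimizers ::
  "(real \<times> torus) measure \<Rightarrow> real \<Rightarrow> real \<Rightarrow> torus \<Rightarrow> real \<Rightarrow> torus \<Rightarrow> (real \<Rightarrow> torus) set"
  where "minimizers \<mu> \<theta> s y t x =
    {X \<in> H1 s t. X s = y \<and> X t = x \<and>
      (\<forall>Z \<in> H1 s t. Z s = y \<longrightarrow> Z t = x \<longrightarrow> action \<mu> \<theta> s t X \<le> action \<mu> \<theta> s t Z)}"

definition half_minimizers :: "(real \<times> torus) measure \<Rightarrow> real \<Rightarrow> real \<Rightarrow> (real \<Rightarrow> torus) set"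
  where "half_minimizers \<mu> \<theta> t =
    {X \<in> H1_loc t. \<forall>s<t. restrict X {s..t} \<in> minimizers \<mu> \<theta> s (X s) t (X t)}"

definition half_minimizers_at ::
  "(real \<times> torus) measure \<Rightarrow> real \<Rightarrow> real \<Rightarrow> torus \<Rightarrow> (real \<Rightarrow> torus) set"
  where "half_minimizers_at \<mu> \<theta> t x = {X \<in> half_minimizers \<mu> \<theta> t. X t = x}"

definition path_le :: "real \<Rightarrow> (real \<Rightarrow> torus) \<Rightarrow> (real \<Rightarrow> torus) \<Rightarrow> bool"
  where "path_le t X1 X2 \<longleftrightarrow> (\<forall>r\<le>t. displacement X1 r t \<ge> displacement X2 r t)"

text \<open>
  \<^term>\<open>path_le t X1 X2\<close> says that \<open>X1\<close>, lifted with both paths ending at the same point, lies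
  to the left of \<open>X2\<close>. The leftmost path is the unique minimal element of this partial order, the
  rightmost path the unique maximal one.
\<close>

definition XL :: "(real \<times> torus) measure \<Rightarrow> real \<Rightarrow> real \<Rightarrow> torus \<Rightarrow> real \<Rightarrow> torus"
  where "XL \<mu> \<theta> t x = (THE X. X \<in> half_minimizers_at \<mu> \<theta> t x \<and>
    (\<forall>Y \<in> half_minimizers_at \<mu> \<theta> t x. path_le t Y X \<longrightarrow> Y = X))"

definition XR :: "(real \<times> torus) measure \<Rightarrow> real \<Rightarrow> real \<Rightarrow> torus \<Rightarrow> real \<Rightarrow> torus"
  where "XR \<mu> \<theta> t x = (THE X. X \<in> half_minimizers_at \<mu> \<theta> t x \<and>
    (\<forall>Y \<in> half_minimizers_at \<mu> \<theta> t x. path_le t X Y \<longrightarrow> Y = X))"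


section \<open>Shocks\<close>

definition uL :: "(real \<times> torus) measure \<Rightarrow> real \<Rightarrow> real \<Rightarrow> torus \<Rightarrow> real"
  where "uL \<mu> \<theta> t x = left_deriv (XL \<mu> \<theta> t x) t"

definition uR :: "(real \<times> torus) measure \<Rightarrow> real \<Rightarrow> real \<Rightarrow> torus \<Rightarrow> real"
  where "uR \<mu> \<theta> t x = left_deriv (XR \<mu> \<theta> t x) t"

definition shocks :: "(real \<times> torus) measure \<Rightarrow> (real \<times> real \<times> torus) set"
  where "shocks \<mu> = {(\<theta>, t, x). uL \<mu> \<theta> t x > uR \<mu> \<theta> t x}"

definition T_vee :: "(real \<times> torus) measure \<Rightarrow> real \<Rightarrow> real \<Rightarrow> torus \<Rightarrow> real"
  where "T_vee \<mu> \<theta> t x = Sup {s. s < t \<and> XL \<mu> \<theta> t x s = XR \<mu> \<theta> t x s}"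

definition GS :: "(real \<times> torus) measure \<Rightarrow> (real \<times> real \<times> torus) set"
  where "GS \<mu> = {(\<theta>, t, x) \<in> shocks \<mu>.
    displacement (XL \<mu> \<theta> t x) (T_vee \<mu> \<theta> t x) t > displacement (XR \<mu> \<theta> t x) (T_vee \<mu> \<theta> t x) t}"

definition shocks_at :: "(real \<times> torus) measure \<Rightarrow> real \<Rightarrow> (real \<times> torus) set"
  where "shocks_at \<mu> \<theta> = {(t, x). (\<theta>, t, x) \<in> shocks \<mu>}"

definition GS_at :: "(real \<times> torus) measure \<Rightarrow> real \<Rightarrow> (real \<times> torus) set"
  where "GS_at \<mu> \<theta> = {(t, x). (\<theta>, t, x) \<in> GS \<mu>}"

definition GS_slice :: "(real \<times> torus) measure \<Rightarrow> real \<Rightarrow> real \<Rightarrow> torus set"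
  where "GS_slice \<mu> \<theta> t = {x. (\<theta>, t, x) \<in> GS \<mu>}"

definition Omega_tilde :: "(real \<times> torus) measure set"
  where "Omega_tilde = {\<mu> \<in> Omega1. \<forall>\<theta>.
    finite (GS_at \<mu> \<theta> \<inter> msupp \<mu>) \<and> card (GS_at \<mu> \<theta> \<inter> msupp \<mu>) \<le> 1 \<and>
    (shocks_at \<mu> \<theta> \<inter> msupp \<mu>) - GS_at \<mu> \<theta> = {}}"

definition Theta_otimes :: "(real \<times> torus) measure \<Rightarrow> real set"
  where "Theta_otimes \<mu> = {\<theta>. card (GS_at \<mu> \<theta> \<inter> msupp \<mu>) = 1}"

definition s_otimes :: "(real \<times> torus) measure \<Rightarrow> real \<Rightarrow> real"
  where "s_otimes \<mu> \<theta> = fst (THE p. p \<in> GS_at \<mu> \<theta> \<inter> msupp \<mu>)"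


section \<open>Piecewise continuity\<close>

text \<open>
  On an unbounded parameter range, piecewise continuity allows infinitely many breakpoints, but only
  finitely many in each bounded interval; one-sided limits are required at all points.
\<close>

definition piecewise_continuous :: "(real \<Rightarrow> 'a::topological_space) \<Rightarrow> bool"
  where "piecewise_continuous f \<longleftrightarrow>
    (\<exists>D. no_accumulation D \<and> (\<forall>\<theta>. \<theta> \<notin> D \<longrightarrow> isCont f \<theta>)) \<and>
    (\<forall>\<theta>. (\<exists>l. (f \<longlongrightarrow> l) (at_left \<theta>)) \<and> (\<exists>l. (f \<longlongrightarrow> l) (at_right \<theta>)))"

definition global_shock_functions ::
  "(real \<times> torus) measure \<Rightarrow> (real \<Rightarrow> real \<Rightarrow> torus) \<Rightarrow> (real \<Rightarrow> real \<Rightarrow> torus) \<Rightarrow> bool"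
  where "global_shock_functions \<mu> sL sR \<longleftrightarrow>
    (\<forall>\<theta> t. GS_slice \<mu> \<theta> t = {sL \<theta> t, sR \<theta> t}) \<and>
    (\<forall>t. (\<forall>s\<in>{sL, sR}. piecewise_continuous (\<lambda>\<theta>. s \<theta> t)) \<and>
         no_accumulation {\<theta>. sL \<theta> t \<noteq> sR \<theta> t} \<and>
         (\<forall>\<theta>. \<forall>s\<in>{sL, sR}.
            ((\<lambda>\<theta>'. s \<theta>' t) \<longlongrightarrow> sL \<theta> t) (at_left \<theta>) \<and>
            ((\<lambda>\<theta>'. s \<theta>' t) \<longlongrightarrow> sR \<theta> t) (at_right \<theta>)))"

end

theory Submission
  imports Defs "HOL-Analysis.Analysis"
begin

text \<open>Paths on the torus are lifted to the line. There, the drift \<open>\<theta>\<close> changes the action of a path by a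
  constant minus \<open>\<theta>\<close> times its displacement, so all drifts are governed by one function:
  \<open>least_cost s a t z\<close>, the least driftless action from \<open>(s, a)\<close> to \<open>(t, z)\<close>. The drift only decides which
  lift of the starting point is the best one. Minimizing paths are straight lines between finitely
  many atoms; they bend only at atoms, and where two of them cross they can exchange their ends at no
  cost. Around a heavy isolated atom
  a detour always pays, so every one-sided minimizer passes through infinitely many bottlenecks
  (\<open>geodesic_bottleneck\<close>). At a bottleneck minimizers can be cut and pasted (\<open>torus_min_paste\<close>), so
  minimization on a half-line reduces to minimization from the lifts of one bottleneck, and since
  minima and maxima of minimizers with the same endpoint are minimizers, leftmost and rightmost
  minimizers exist (\<open>extremal_exist\<close>).

  Fix a bottleneck \<open>(s, a)\<close> and a later time \<open>t\<close>, and let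
  \<open>turn_cost s a t z = least_cost s a t (z + 1) - least_cost s a t z\<close>. By such an exchange this is a
  nondecreasing function of \<open>z\<close> (\<open>least_cost_exchange\<close>); it is continuous and unbounded. Two winding numbers are
  optimal for a point of the torus exactly if \<open>turn_cost = \<theta>\<close> at one of its lifts. The solutions of this
  equation form an interval \<open>[lo, hi]\<close>, and the key fact (\<open>GS_slice_eq\<close>) is that the global shocks are the
  projections of its two ends. At an end, the extremal minimizers do not meet between the
  bottleneck and \<open>t\<close>: they could do so only in an atom through which all minimizers to nearby endpoints
  would have to pass as well, and then \<open>turn_cost\<close> would equal \<open>\<theta>\<close> on both sides of the end. Conversely, from a global
  shock that is not an end, other minimizers branch off both extremal ones at shocks on
  atoms. Under the hypothesis there is a single such atom, so the extremal ones would meet there, after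
  their last meeting.

  Hence the two shocks are \<open>proj lo\<close> and \<open>proj hi\<close>. As functions of \<open>\<theta>\<close> these are the generalized inverses of
  a continuous monotone function, which gives the one-sided limits. They can differ only if \<open>\<theta>\<close> is the
  cost of a turn at an atom (\<open>flat_crossing\<close>), which happens for finitely many \<open>\<theta>\<close> in a bounded
  interval; thus the limits determine the shocks, and the choice of the bottleneck does not
  matter (\<open>shock_pair_unique\<close>). Continuity in time follows from a maximum principle for \<open>turn_cost\<close> along
  geodesics and their equicontinuity (\<open>turn_cost_compare\<close>). Finally, the width \<open>hi - lo\<close> lies between 0
  and 1, and the shocks agree exactly if it is 0 or 1. It becomes positive when the global shock hits an
  atom, since afterwards a fan of minimizers emanates from that atom, and it stays at 0 or 1 once it has
  returned to one of these values, which happens at the latest behind the next bottleneck.\<close>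

section \<open>Lifts of torus-valued paths\<close>

lemma proj_shift [simp]: "proj (a + of_int k) = proj a" "proj (of_int k + a) = proj a"
  "proj (a - of_int k) = proj a"
  by (simp_all add: proj_eq_iff)

lemma proj_shift1 [simp]: "proj (a + 1) = proj a" "proj (a - 1) = proj a"
  by (simp_all add: proj_eq_iff)

lemma proj_eqE:
  assumes "proj a = proj b" obtains k :: int where "a = b + of_int k"
proof -
  obtain k :: int where "a - b = of_int k"
    using assms proj_eq_iff Ints_cases by blast
  then show ?thesis using that[of k] by simp
qed

lemma dist_proj_le: "dist (proj a) (proj b) \<le> dist a b"
  using round_diff_minimal[of "a - b" 0] by (simp add: dist_proj dist_real_def)

lemma continuous_on_proj: "continuous_on A proj"
  unfolding continuous_on_iff using dist_proj_le by (metis le_less_trans)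

lemma continuous_on_proj_comp: "continuous_on A f \<Longrightarrow> continuous_on A (\<lambda>r. proj (f r))"
  using continuous_on_compose[of A f proj] continuous_on_proj by (simp add: o_def)

lemma compact_torus: "compact (UNIV :: torus set)"
proof -
  have "x \<in> proj ` {0..1}" for x
  proof -
    obtain a where a: "x = proj a" using proj_surj by blast
    have "proj (frac a) = x" by (simp add: frac_def a)
    moreover have "frac a \<in> {0..1}" using frac_lt_1[of a] by (simp add: less_imp_le)
    ultimately show ?thesis by blast
  qed
  then have "UNIV = proj ` {0..1}" by blast
  then show ?thesis by (metis compact_Icc compact_continuous_image continuous_on_proj)
qed

lemma continuous_Ints_constant:
  fixes h :: "real \<Rightarrow> real"
  assumes h: "continuous_on S h" and S: "connected S" and "\<And>r. r \<in> S \<Longrightarrow> h r \<in> \<int>"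
    and "r \<in> S" "q \<in> S"
  shows "h r = h q"
proof -
  have "h constant_on S"
  proof (rule continuous_discrete_range_constant[OF S h])
    fix x assume x: "x \<in> S"
    have "1 \<le> norm (h y - h x)" if y: "y \<in> S" "h y \<noteq> h x" for y
    proof -
      have "h y - h x \<in> \<int>" using assms(3) x y by simp
      then show ?thesis using y Ints_nonzero_abs_ge1[of "h y - h x"] by simp
    qed
    then show "\<exists>e>0. \<forall>y. y \<in> S \<and> h y \<noteq> h x \<longrightarrow> e \<le> norm (h y - h x)"
      by (intro exI[of _ 1]) auto
  qed
  then show ?thesis using assms by (metis constant_on_def)
qed

lemma lift_unique:
  fixes f g :: "real \<Rightarrow> real"
  assumes "continuous_on S f" "continuous_on S g" "connected S"
    and "\<And>r. r \<in> S \<Longrightarrow> proj (f r) = proj (g r)" and "r \<in> S" "q \<in> S"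
  shows "f r - g r = f q - g q"
  using continuous_Ints_constant[of S "\<lambda>r. f r - g r"] assms
  by (auto intro!: continuous_intros simp: proj_eq_iff)

section \<open>Square-integrable derivatives\<close>

definition sq_int :: "(real \<Rightarrow> real) \<Rightarrow> real \<Rightarrow> real \<Rightarrow> bool"
  where "sq_int g s t \<longleftrightarrow> set_borel_measurable lborel {s..t} g \<and>
    set_integrable lborel {s..t} (\<lambda>r. (g r)\<^sup>2)"

lemma weak_deriv_on_iff: "weak_deriv_on X g s t \<longleftrightarrow>
    sq_int g s t \<and> (\<exists>a. \<forall>r\<in>{s..t}. X r = proj (a + (LBINT q:{s..r}. g q)))"
  by (auto simp: weak_deriv_on_def sq_int_def)

lemma set_integrable_const [simp]: "set_integrable lborel {s..t::real} (\<lambda>_. c::real)"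
  by (intro borel_integrable_atLeastAtMost') simp

lemma sq_int_integrable:
  assumes "sq_int g s t" shows "set_integrable lborel {s..t} g"
proof (rule set_integrable_bound)
  show "set_integrable lborel {s..t} (\<lambda>r. 1 + (g r)\<^sup>2)"
    using assms by (intro set_integral_add) (auto simp: sq_int_def)
  show "set_borel_measurable lborel {s..t} g" using assms by (simp add: sq_int_def)
  have "\<bar>y\<bar> \<le> 1 + y\<^sup>2" for y :: real
  proof -
    have "0 \<le> (\<bar>y\<bar> - 1)\<^sup>2 + \<bar>y\<bar>" by simp
    then show ?thesis by (simp add: power2_eq_square algebra_simps)
  qed
  then show "AE x in lborel. x \<in> {s..t} \<longrightarrow> norm (g x) \<le> norm (1 + (g x)\<^sup>2)"
    by (auto intro!: AE_I2 intro: order_trans)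
qed

lemma sq_int_subset: "sq_int g s t \<Longrightarrow> s \<le> u \<Longrightarrow> v \<le> t \<Longrightarrow> sq_int g u v"
  unfolding sq_int_def
  by (auto intro: set_borel_measurable_subset set_integrable_subset)

lemma LBINT_split:
  fixes h :: "real \<Rightarrow> real"
  assumes h: "set_integrable lborel {s..t} h" and "s \<le> r" "r \<le> t"
  shows "(LBINT q:{s..t}. h q) = (LBINT q:{s..r}. h q) + (LBINT q:{r..t}. h q)"
proof -
  have "set_integrable lborel {s..r} h" "set_integrable lborel {r..t} h"
    using assms by (auto intro: set_integrable_subset)
  then show ?thesis
    using Henstock_Kurzweil_Integration.integral_combine[of s r t h] assms
    by (simp add: set_borel_integral_eq_integral)
qed

lemma LBINT_singleton [simp]: "(LBINT q:{r::real}. h q) = (0::real)"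
proof -
  have "AE x in lborel. indicator {r} x *\<^sub>R h x = 0"
    using AE_lborel_singleton[of r] by eventually_elim auto
  then show ?thesis unfolding set_lebesgue_integral_def by (rule integral_eq_zero_AE)
qed

lemma continuous_on_prim:
  fixes h :: "real \<Rightarrow> real"
  assumes "set_integrable lborel {s..t} h"
  shows "continuous_on {s..t} (\<lambda>r. LBINT q:{s..r}. h q)"
proof -
  have "continuous_on {s..t} (\<lambda>r. integral {s..r} h)"
    by (rule indefinite_integral_continuous_1[OF set_borel_integral_eq_integral(1)[OF assms]])
  moreover have "integral {s..r} h = (LBINT q:{s..r}. h q)" if "r \<in> {s..t}" for r
    using that set_borel_integral_eq_integral(2)[of "{s..r}" h] set_integrable_subset[OF assms]
    by auto
  ultimately show ?thesis by (rule continuous_on_eq)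
qed

lemma LBINT_cong_interior:
  fixes g h :: "real \<Rightarrow> real"
  assumes "set_borel_measurable lborel {s..t} g" "set_borel_measurable lborel {s..t} h"
    and "\<And>r. r \<in> {s<..<t} \<Longrightarrow> g r = h r"
  shows "(LBINT q:{s..t}. g q) = (LBINT q:{s..t}. h q)"
  unfolding set_lebesgue_integral_def
proof (rule integral_cong_AE)
  show "(\<lambda>x. indicator {s..t} x *\<^sub>R g x) \<in> borel_measurable lborel"
    "(\<lambda>x. indicator {s..t} x *\<^sub>R h x) \<in> borel_measurable lborel"
    using assms by (auto simp: set_borel_measurable_def)
  show "AE x in lborel. indicator {s..t} x *\<^sub>R g x = indicator {s..t} x *\<^sub>R h x"
    using AE_lborel_singleton[of s] AE_lborel_singleton[of t]
    by eventually_elim (use assms(3) in \<open>auto simp: indicator_def\<close>)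
qed

text \<open>The pasted function is forced to take one of two values at \<open>r\<close>; this affects no integral.\<close>

lemma sq_int_paste:
  assumes "sq_int g s r" "sq_int h r t" "s \<le> r" "r \<le> t"
  defines "k \<equiv> \<lambda>x. if x \<le> r then g x else h x"
  shows "sq_int k s t"
    and "\<And>x. x \<in> {s..r} \<Longrightarrow> (LBINT q:{s..x}. k q) = (LBINT q:{s..x}. g q)"
    and "\<And>x. x \<in> {r..t} \<Longrightarrow> (LBINT q:{s..x}. k q) = (LBINT q:{s..r}. g q) + (LBINT q:{r..x}. h q)"
    and "(LBINT q:{s..t}. (k q)\<^sup>2) = (LBINT q:{s..r}. (g q)\<^sup>2) + (LBINT q:{r..t}. (h q)\<^sup>2)"
proof -
  have split: "indicator {s..t} x *\<^sub>R F (k x) = indicator {s..r} x *\<^sub>R F (g x)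
      + indicator {r<..t} x *\<^sub>R indicator {r..t} x *\<^sub>R F (h x)" for x and F :: "real \<Rightarrow> real"
    using \<open>s \<le> r\<close> \<open>r \<le> t\<close> by (auto simp: k_def indicator_def)
  have m: "(\<lambda>x. indicator {s..r} x *\<^sub>R g x) \<in> borel_measurable lborel"
     "(\<lambda>x. indicator {r..t} x *\<^sub>R h x) \<in> borel_measurable lborel"
    using assms by (auto simp: sq_int_def set_borel_measurable_def)
  have mk: "set_borel_measurable lborel {s..t} k"
    unfolding set_borel_measurable_def split[of _ "\<lambda>y. y"]
    by (intro borel_measurable_add m borel_measurable_scaleR) auto
  have i: "integrable lborel (\<lambda>x. indicator {s..r} x *\<^sub>R (g x)\<^sup>2)"
     "integrable lborel (\<lambda>x. indicator {r..t} x *\<^sub>R (h x)\<^sup>2)"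
    using assms by (auto simp: sq_int_def set_integrable_def)
  have ik: "set_integrable lborel {s..t} (\<lambda>x. (k x)\<^sup>2)"
    unfolding set_integrable_def split[of _ "\<lambda>y. y\<^sup>2"]
    by (intro Bochner_Integration.integrable_add i integrable_mult_indicator) auto
  show k: "sq_int k s t" using mk ik by (simp add: sq_int_def)
  note kk = sq_int_subset[OF k]
  show left: "(LBINT q:{s..x}. k q) = (LBINT q:{s..x}. g q)" if "x \<in> {s..r}" for x
    using that by (intro set_lebesgue_integral_cong) (auto simp: k_def)
  have right: "(LBINT q:{r..x}. F (k q)) = (LBINT q:{r..x}. F (h q))"
    if "x \<in> {r..t}" and F: "F \<in> {\<lambda>y. y, \<lambda>y. y\<^sup>2}" for x and F :: "real \<Rightarrow> real"
  proof (rule LBINT_cong_interior)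
    have "sq_int k r x" "sq_int h r x"
      using that \<open>s \<le> r\<close> kk[of r x] sq_int_subset[OF assms(2), of r x] by auto
    then show "set_borel_measurable lborel {r..x} (\<lambda>q. F (k q))"
      "set_borel_measurable lborel {r..x} (\<lambda>q. F (h q))"
      using F by (auto simp: sq_int_def set_integrable_def set_borel_measurable_def)
  qed (auto simp: k_def)
  show "(LBINT q:{s..x}. k q) = (LBINT q:{s..r}. g q) + (LBINT q:{r..x}. h q)"
    if "x \<in> {r..t}" for x
    using LBINT_split[OF sq_int_integrable[OF kk[of s x]], of r] left[of r] right[of x "\<lambda>y. y"] that assms
    by auto
  have "(LBINT q:{s..r}. (k q)\<^sup>2) = (LBINT q:{s..r}. (g q)\<^sup>2)"
    by (intro set_lebesgue_integral_cong) (auto simp: k_def)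
  then show "(LBINT q:{s..t}. (k q)\<^sup>2) = (LBINT q:{s..r}. (g q)\<^sup>2) + (LBINT q:{r..t}. (h q)\<^sup>2)"
    using LBINT_split[OF ik, of r] right[of t "\<lambda>y. y\<^sup>2"] assms by auto
qed

lemma sq_int_const [simp]: "sq_int (\<lambda>_. c) s t"
  unfolding sq_int_def
proof
  show "set_borel_measurable lborel {s..t} (\<lambda>_. c)"
    unfolding set_borel_measurable_def by measurable
qed simp

lemma LBINT_const: "s \<le> t \<Longrightarrow> (LBINT q:{s..t}. c) = (c::real) * (t - s)"
  by (simp add: set_lebesgue_integral_def)

lemma LBINT_sq_diff:
  assumes "sq_int g s t" "s \<le> t"
  shows "(LBINT r:{s..t}. (g r - c)\<^sup>2)
    = (LBINT r:{s..t}. (g r)\<^sup>2) - 2 * c * (LBINT r:{s..t}. g r) + c\<^sup>2 * (t - s)"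
proof -
  have i: "set_integrable lborel {s..t} (\<lambda>r. (g r)\<^sup>2)" using assms by (simp add: sq_int_def)
  have i2: "set_integrable lborel {s..t} (\<lambda>r. 2 * c * g r)"
    using sq_int_integrable[OF assms(1)] by simp
  have i3: "set_integrable lborel {s..t} (\<lambda>r. c\<^sup>2)" by simp
  have "(LBINT r:{s..t}. (g r - c)\<^sup>2) = (LBINT r:{s..t}. (g r)\<^sup>2 - 2 * c * g r + c\<^sup>2)"
    by (simp add: power2_diff algebra_simps)
  also have "\<dots> = (LBINT r:{s..t}. (g r)\<^sup>2 - 2 * c * g r) + (LBINT r:{s..t}. c\<^sup>2)"
    by (rule set_integral_add(2)[OF set_integral_diff(1)[OF i i2] i3])
  also have "\<dots> = (LBINT r:{s..t}. (g r)\<^sup>2) - (LBINT r:{s..t}. 2 * c * g r) + (LBINT r:{s..t}. c\<^sup>2)"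
    by (simp only: set_integral_diff(2)[OF i i2])
  finally show ?thesis using assms(2) by (simp add: LBINT_const)
qed

lemma LBINT_sq_lower:
  assumes "sq_int g s t" "s < t"
  shows "(LBINT r:{s..t}. g r)\<^sup>2 / (t - s) \<le> (LBINT r:{s..t}. (g r)\<^sup>2)"
proof -
  let ?I = "LBINT r:{s..t}. g r"
  have "0 \<le> (LBINT r:{s..t}. (g r - ?I / (t - s))\<^sup>2)"
    by (simp add: set_lebesgue_integral_def integral_nonneg_AE)
  also have "\<dots> = (LBINT r:{s..t}. (g r)\<^sup>2) - ?I\<^sup>2 / (t - s)"
    unfolding LBINT_sq_diff[OF assms(1) less_imp_le[OF assms(2)]]
    using assms(2) by (simp add: power2_eq_square)
  finally show ?thesis by simp
qed

text \<open>A square-integrable derivative is determined, up to null sets, by its primitive; hence the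
  kinetic energy is a function of the path alone.\<close>

lemma AE_zero_of_primitive_zero:
  fixes h :: "real \<Rightarrow> real"
  assumes h: "set_integrable lborel {s..t} h" and z: "\<And>r. r \<in> {s..t} \<Longrightarrow> (LBINT q:{s..r}. h q) = 0"
  shows "AE r in lborel. indicator {s..t} r * h r = 0"
proof -
  define H where "H = (\<lambda>r. indicator {s..t} r * h r)"
  have H: "integrable lborel H" using h by (simp add: H_def set_integrable_def)
  have SI: "set_integrable lborel B H" if "B \<in> sets lborel" for B
    using integrable_mult_indicator[OF that H] by (simp add: set_integrable_def)
  have gen: "(LBINT q:{..a}. H q) = 0" for a
  proof -
    have "(LBINT q:{..a}. H q) = (LBINT q:{s..min a t}. h q)"
      unfolding H_def set_lebesgue_integral_def
      by (intro Bochner_Integration.integral_cong) (auto simp: indicator_def)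
    also have "\<dots> = 0"
    proof (cases "s \<le> min a t")
      case True then show ?thesis by (intro z) auto
    next
      case False
      then have "{s..min a t} = {}" by (auto simp: atLeastatMost_empty_iff)
      then show ?thesis by (simp add: set_lebesgue_integral_def)
    qed
    finally show ?thesis .
  qed
  have tot: "(LBINT q. H q) = 0"
  proof -
    have "(LBINT q. H q) = (LBINT q:{s..t}. h q)"
      by (simp add: H_def set_lebesgue_integral_def)
    also have "\<dots> = 0"
    proof (cases "s \<le> t")
      case False then show ?thesis by (simp add: set_lebesgue_integral_def)
    qed (simp add: z)
    finally show ?thesis .
  qed
  have "A \<in> sets borel \<Longrightarrow> (LBINT q:A. H q) = 0" for A :: "real set"
  proof -
    assume A: "A \<in> sets borel"
    have "Int_stable (range (\<lambda>a::real. {..a}))"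
    proof (rule Int_stableI_image)
      fix a b :: real show "\<exists>c\<in>UNIV. {..a} \<inter> {..b} = {..c}" by (intro bexI[of _ "min a b"]) auto
    qed
    moreover have "range (\<lambda>a::real. {..a}) \<subseteq> Pow UNIV" by simp
    moreover have "A \<in> sigma_sets UNIV (range (\<lambda>a::real. {..a}))"
      using A by (simp add: borel_eq_atMost)
    ultimately show ?thesis
    proof (induct rule: sigma_sets_induct_disjoint)
      case (basic A) then show ?case using gen by auto
    next
      case empty show ?case by (simp add: set_lebesgue_integral_def)
    next
      case (compl A)
      then have A: "A \<in> sets lborel" by (simp add: borel_eq_atMost)
      have "(LBINT q. H q) = (LBINT q:A \<union> (UNIV - A). H q)"
        by (simp add: set_lebesgue_integral_def)
      also have "\<dots> = (LBINT q:A. H q) + (LBINT q:UNIV - A. H q)"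
        using A by (intro set_integral_Un SI) auto
      finally show ?case using tot compl by simp
    next
      case (union A)
      have A: "A i \<in> sets lborel" for i using union by (auto simp: borel_eq_atMost)
      have "(LBINT q:(\<Union>i. A i). H q) = (\<Sum>i. LBINT q:A i. H q)"
      proof (rule lebesgue_integral_countable_add)
        show "A i \<in> sets lborel" for i by (rule A)
        show "A i \<inter> A j = {}" if "i \<noteq> j" for i j
          using union that by (auto simp: disjoint_family_on_def)
        show "set_integrable lborel (\<Union>i. A i) H"
          using A by (intro SI) auto
      qed
      then show ?case using union by simp
    qed
  qed
  then have "AE r in lborel. H r = 0"
    using sigma_finite_measure.density_zero[OF sigma_finite_lborel H] by simp
  then show ?thesis by (simp add: H_def)
qed

lemma LBINT_sq_unique:
  assumes g: "sq_int g s t" and h: "sq_int h s t"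
    and eq: "\<And>r. r \<in> {s..t} \<Longrightarrow> (LBINT q:{s..r}. g q) = (LBINT q:{s..r}. h q)"
  shows "(LBINT q:{s..t}. (g q)\<^sup>2) = (LBINT q:{s..t}. (h q)\<^sup>2)"
proof -
  note ig = sq_int_integrable[OF g] and ih = sq_int_integrable[OF h]
  have "AE r in lborel. indicator {s..t} r * (g r - h r) = 0"
  proof (rule AE_zero_of_primitive_zero)
    show "set_integrable lborel {s..t} (\<lambda>r. g r - h r)" by (rule set_integral_diff(1)[OF ig ih])
    fix r assume r: "r \<in> {s..t}"
    have "(LBINT q:{s..r}. g q - h q) = (LBINT q:{s..r}. g q) - (LBINT q:{s..r}. h q)"
      using r by (intro set_integral_diff(2) set_integrable_subset[OF ig] set_integrable_subset[OF ih]) auto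
    then show "(LBINT q:{s..r}. g q - h q) = 0" using eq[OF r] by simp
  qed
  then have "AE r in lborel. indicator {s..t} r *\<^sub>R (g r)\<^sup>2 = indicator {s..t} r *\<^sub>R (h r)\<^sup>2"
    by eventually_elim (auto simp: indicator_def)
  then show ?thesis unfolding set_lebesgue_integral_def
    using g h by (intro integral_cong_AE) (auto simp: sq_int_def set_integrable_def)
qed

section \<open>Environments of isolated atoms\<close>

locale environment =
  fixes \<mu> :: "(real \<times> torus) measure"
  assumes mu: "\<mu> \<in> Omega"
begin

definition mass :: "real \<Rightarrow> real \<Rightarrow> real"
  where "mass r z = measure \<mu> {(r, proj z)}"

definition atom_times :: "real set"
  where "atom_times = fst ` msupp \<mu>"

lemma sets_mu [simp]: "sets \<mu> = sets borel"
  and purely_atomic_mu: "purely_atomic \<mu>"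
  and point_finite: "emeasure \<mu> {p} < \<infinity>"
  and not_islimpt_msupp: "\<not> p islimpt msupp \<mu>"
  using mu unfolding Omega_def no_accumulation_def by blast+

lemma emeasure_atoms: "A \<in> sets borel \<Longrightarrow> emeasure \<mu> A = (\<integral>\<^sup>+p. emeasure \<mu> {p} \<partial>count_space A)"
  using purely_atomic_mu unfolding purely_atomic_def sets_mu by blast

lemma not_msupp_null: assumes "p \<notin> msupp \<mu>" shows "emeasure \<mu> {p} = 0"
proof -
  obtain U where U: "open U" "p \<in> U" "\<not> emeasure \<mu> U > 0"
    using assms by (auto simp: msupp_def)
  have "emeasure \<mu> {p} \<le> emeasure \<mu> U" using U by (intro emeasure_mono) auto
  then show ?thesis using U(3) by (simp add: zero_less_iff_neq_zero)
qed

lemma emeasure_split: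
  assumes "A \<in> sets borel" "B \<in> sets borel" "B \<subseteq> A"
  shows "emeasure \<mu> A = emeasure \<mu> B + emeasure \<mu> (A - B)"
proof -
  have "emeasure \<mu> B + emeasure \<mu> (A - B) = emeasure \<mu> (B \<union> (A - B))"
    using assms by (intro plus_emeasure) auto
  moreover have "B \<union> (A - B) = A" using assms(3) by blast
  ultimately show ?thesis by simp
qed

lemma emeasure_null:
  assumes "A \<in> sets borel" "A \<inter> msupp \<mu> = {}" shows "emeasure \<mu> A = 0"
proof -
  have "(\<integral>\<^sup>+p. emeasure \<mu> {p} \<partial>count_space A) = (\<integral>\<^sup>+p. 0 \<partial>count_space A)"
    using assms(2) by (intro nn_integral_cong) (auto intro!: not_msupp_null)
  then show ?thesis using emeasure_atoms[OF assms(1)] by simp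
qed

text \<open>A point isolated in the support has a neighbourhood that carries no other mass.\<close>

lemma msupp_pos: assumes "p \<in> msupp \<mu>" shows "measure \<mu> {p} > 0"
proof -
  obtain U where U: "open U" "p \<in> U" "\<forall>q\<in>msupp \<mu>. q \<in> U \<longrightarrow> q = p"
    using not_islimpt_msupp[of p] unfolding islimpt_def by blast
  have pos: "emeasure \<mu> U > 0" using assms U(1,2) unfolding msupp_def by blast
  have "emeasure \<mu> U = emeasure \<mu> {p} + emeasure \<mu> (U - {p})"
    using U(1,2) by (intro emeasure_split) auto
  also have "emeasure \<mu> (U - {p}) = 0"
    using U by (intro emeasure_null) auto
  finally have "emeasure \<mu> {p} > 0" using pos by simp
  then show ?thesis using point_finite[of p] by (simp add: measure_def enn2real_positive_iff)
qed

lemma msupp_iff: "p \<in> msupp \<mu> \<longleftrightarrow> measure \<mu> {p} > 0"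
  using msupp_pos[of p] not_msupp_null[of p] by (cases "p \<in> msupp \<mu>") (simp_all add: measure_def)

lemma mass_pos_iff: "mass r z > 0 \<longleftrightarrow> (r, proj z) \<in> msupp \<mu>"
  by (simp add: mass_def msupp_iff)

lemma mass_nonneg [simp]: "mass r z \<ge> 0"
  by (simp add: mass_def)

lemma mass_eq_0_iff: "mass r z = 0 \<longleftrightarrow> (r, proj z) \<notin> msupp \<mu>"
  using mass_pos_iff[of r z] mass_nonneg[of r z] by linarith

lemma mass_shift [simp]: "mass r (z + of_int k) = mass r z" "mass r (of_int k + z) = mass r z"
  "mass r (z - of_int k) = mass r z" "mass r (z + 1) = mass r z"
  by (simp_all add: mass_def)

lemma mass_0: "r \<notin> atom_times \<Longrightarrow> mass r z = 0"
  unfolding mass_eq_0_iff atom_times_def by (metis fst_conv image_eqI)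

lemma finite_msupp_strip: "finite (msupp \<mu> \<inter> ({s..t} \<times> UNIV))"
proof (rule ccontr)
  assume inf: "infinite (msupp \<mu> \<inter> ({s..t} \<times> UNIV))"
  have "compact ({s..t} \<times> (UNIV :: torus set))"
    using compact_torus by (intro compact_Times) auto
  then obtain p where "p islimpt (msupp \<mu> \<inter> ({s..t} \<times> UNIV))"
    using inf by (meson compact_eq_Bolzano_Weierstrass inf_le2)
  then have "p islimpt msupp \<mu>" by (rule islimpt_subset) auto
  then show False using not_islimpt_msupp by blast
qed

lemma finite_atom_times: "finite (atom_times \<inter> {s..t})"
proof -
  have "atom_times \<inter> {s..t} \<subseteq> fst ` (msupp \<mu> \<inter> ({s..t} \<times> UNIV))"
    by (force simp: atom_times_def)
  then show ?thesis using finite_msupp_strip finite_surj by blast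
qed

lemma atom_gap: obtains d where "d > 0" "\<And>q. \<bar>q - r\<bar> \<le> d \<Longrightarrow> q \<noteq> r \<Longrightarrow> q \<notin> atom_times"
proof -
  have "finite (atom_times \<inter> {r - 1..r + 1} - {r})" using finite_atom_times by blast
  then obtain d where d: "d > 0" "\<forall>x\<in>atom_times \<inter> {r - 1..r + 1} - {r}. x \<noteq> r \<longrightarrow> d \<le> dist r x"
    using finite_set_avoid by meson
  show ?thesis
  proof (rule that[of "min (d/2) 1"])
    fix q assume "\<bar>q - r\<bar> \<le> min (d / 2) 1" "q \<noteq> r"
    moreover from this have "q \<in> {r - 1..r + 1}" by (auto simp: abs_le_iff)
    moreover have "dist r q = \<bar>q - r\<bar>" by (simp add: dist_real_def)
    ultimately have "\<not> d \<le> dist r q" "q \<in> {r - 1..r + 1} - {r}" using d(1) by auto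
    then show "q \<notin> atom_times" using d(2) \<open>q \<noteq> r\<close> by blast
  qed (use d in simp)
qed

lemma atom_gap_left:
  assumes "s < r" obtains q where "s < q" "q < r" "\<And>x. q \<le> x \<Longrightarrow> x < r \<Longrightarrow> x \<notin> atom_times"
proof -
  obtain d where d: "d > 0" "\<And>q. \<bar>q - r\<bar> \<le> d \<Longrightarrow> q \<noteq> r \<Longrightarrow> q \<notin> atom_times"
    using atom_gap[of r] by metis
  show ?thesis
  proof (rule that[of "max (r - d) ((s + r) / 2)"])
    fix x assume "max (r - d) ((s + r) / 2) \<le> x" "x < r"
    then show "x \<notin> atom_times" by (intro d(2)) auto
  qed (use assms d in \<open>auto simp: less_max_iff_disj\<close>)
qed

lemma atom_gap_right:
  assumes "r < t" obtains q where "r < q" "q < t" "\<And>x. r < x \<Longrightarrow> x \<le> q \<Longrightarrow> x \<notin> atom_times"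
proof -
  obtain d where d: "d > 0" "\<And>q. \<bar>q - r\<bar> \<le> d \<Longrightarrow> q \<noteq> r \<Longrightarrow> q \<notin> atom_times"
    using atom_gap[of r] by metis
  show ?thesis
  proof (rule that[of "min (r + d) ((t + r) / 2)"])
    fix x assume "x \<le> min (r + d) ((t + r) / 2)" "r < x"
    then show "x \<notin> atom_times" by (intro d(2)) auto
  qed (use assms d in \<open>auto simp: min_less_iff_disj\<close>)
qed

lemma finite_proj_vimage: "finite ({a..b} \<inter> proj -` {x})"
proof -
  obtain c where c: "x = proj c" using proj_surj by blast
  have "{a..b} \<inter> proj -` {x} \<subseteq> (\<lambda>k. c + of_int k) ` {\<lfloor>a - c\<rfloor>..\<lceil>b - c\<rceil>}"
  proof
    fix z assume z: "z \<in> {a..b} \<inter> proj -` {x}"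
    then obtain k :: int where k: "z = c + of_int k" using c proj_eqE by (metis IntD2 vimage_singleton_eq)
    then have "k \<in> {\<lfloor>a - c\<rfloor>..\<lceil>b - c\<rceil>}" using z by (auto simp: floor_le_iff le_ceiling_iff)
    then show "z \<in> (\<lambda>k. c + of_int k) ` {\<lfloor>a - c\<rfloor>..\<lceil>b - c\<rceil>}" using k by blast
  qed
  then show ?thesis using finite_surj by blast
qed

text \<open>Every atom has infinitely many lifts, but only finitely many of them lie in a bounded set.\<close>

lemma finite_mass_pos: "finite {z \<in> {a..b}. mass r z > 0}"
proof -
  have "{z \<in> {a..b}. mass r z > 0}
      \<subseteq> (\<Union>p\<in>msupp \<mu> \<inter> ({r..r} \<times> UNIV). {a..b} \<inter> proj -` {snd p})"
    by (force simp: mass_pos_iff)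
  moreover have "finite (\<Union>p\<in>msupp \<mu> \<inter> ({r..r} \<times> UNIV). {a..b} \<inter> proj -` {snd p})"
    using finite_msupp_strip finite_proj_vimage by blast
  ultimately show ?thesis by (rule finite_subset)
qed

lemma mass_isolated:
  obtains d where "d > 0" "\<And>y. \<bar>y - z\<bar> \<le> d \<Longrightarrow> y \<noteq> z \<Longrightarrow> mass r y = 0"
proof -
  have "finite ({y \<in> {z - 1..z + 1}. mass r y > 0} - {z})" by (intro finite_Diff finite_mass_pos)
  from finite_set_avoid[OF this, of z]
  obtain d where d: "d > 0" "\<forall>x\<in>{y \<in> {z - 1..z + 1}. mass r y > 0} - {z}. x \<noteq> z \<longrightarrow> d \<le> dist z x"
    by (elim exE conjE) (rule that)
  show ?thesis
  proof (rule that[of "min (d/2) 1"])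
    fix y assume "\<bar>y - z\<bar> \<le> min (d / 2) 1" "y \<noteq> z"
    moreover from this have "y \<in> {z - 1..z + 1}" by (auto simp: abs_le_iff)
    moreover have "dist z y = \<bar>y - z\<bar>" by (simp add: dist_real_def)
    ultimately have "\<not> d \<le> dist z y" "y \<in> {z - 1..z + 1} - {z}" using d(1) by auto
    then have "\<not> mass r y > 0" using d(2) \<open>y \<noteq> z\<close> by blast
    then show "mass r y = 0" using mass_nonneg[of r y] by linarith
  qed (use d in simp)
qed

definition strip_mass :: "real \<Rightarrow> real \<Rightarrow> real"
  where "strip_mass s t = measure \<mu> ({s..t} \<times> UNIV)"

lemma strip_finite: "emeasure \<mu> ({s..t} \<times> UNIV) < \<infinity>"
proof -
  let ?A = "{s..t} \<times> (UNIV :: torus set)" and ?F = "msupp \<mu> \<inter> ({s..t} \<times> UNIV)"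
  have A: "?A \<in> sets borel" by (intro borel_closed closed_Times) auto
  have F: "?F \<in> sets borel" using finite_msupp_strip by (intro borel_closed finite_imp_closed)
  have "emeasure \<mu> ?A = emeasure \<mu> ?F + emeasure \<mu> (?A - ?F)"
    by (rule emeasure_split[OF A F]) blast
  also have "emeasure \<mu> (?A - ?F) = 0" using A F by (intro emeasure_null) auto
  also have "emeasure \<mu> ?F = (\<Sum>p\<in>?F. emeasure \<mu> {p})"
    using finite_msupp_strip by (intro emeasure_eq_sum_singleton) auto
  also have "\<dots> + 0 < \<infinity>" using finite_msupp_strip point_finite by (simp add: less_top[symmetric])
  finally show ?thesis .
qed

lemma strip_borel: "{s..t::real} \<times> (UNIV :: torus set) \<in> sets borel"
  by (intro borel_closed closed_Times) auto

lemma in_strip_fmeasurable: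
  assumes "A \<in> sets borel" "A \<subseteq> {s..t::real} \<times> UNIV" shows "A \<in> fmeasurable \<mu>"
proof (rule fmeasurableI)
  have "emeasure \<mu> A \<le> emeasure \<mu> ({s..t} \<times> UNIV)"
    using assms strip_borel by (intro emeasure_mono) auto
  then show "emeasure \<mu> A < \<infinity>" using strip_finite by (rule le_less_trans)
qed (simp add: assms)

lemma strip_mono:
  assumes "A \<subseteq> {s..t} \<times> UNIV" shows "measure \<mu> A \<le> strip_mass s t"
proof (cases "A \<in> sets borel")
  case True
  then show ?thesis unfolding strip_mass_def
    using assms by (intro measure_mono_fmeasurable in_strip_fmeasurable[OF strip_borel order_refl]) simp_all
next
  case False
  then show ?thesis by (simp add: measure_notin_sets strip_mass_def)
qed

lemma strip_mass_nonneg [simp]: "strip_mass s t \<ge> 0"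
  by (simp add: strip_mass_def)

lemma mass_le_strip: "r \<in> {s..t} \<Longrightarrow> mass r z \<le> strip_mass s t"
  unfolding mass_def by (intro strip_mono) auto

lemma strip_mass_mono: "s' \<le> s \<Longrightarrow> t \<le> t' \<Longrightarrow> strip_mass s t \<le> strip_mass s' t'"
  unfolding strip_mass_def[of s t] by (intro strip_mono) auto

subsection \<open>Mass collected by a graph\<close>

text \<open>The endpoint is left out, so that masses add up when paths are concatenated.\<close>

definition graph_mass :: "(real \<Rightarrow> torus) \<Rightarrow> real \<Rightarrow> real \<Rightarrow> real"
  where "graph_mass X s t = measure \<mu> ((\<lambda>r. (r, X r)) ` {s..<t})"

lemma graph_mass_cong: "(\<And>r. r \<in> {s..<t} \<Longrightarrow> X r = Y r) \<Longrightarrow> graph_mass X s t = graph_mass Y s t"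
  unfolding graph_mass_def by (intro arg_cong[of _ _ "measure \<mu>"] image_cong) auto

lemma graph_mass_le: "graph_mass X s t \<le> strip_mass s t"
  unfolding graph_mass_def by (intro strip_mono) auto

lemma graph_borel:
  fixes X :: "real \<Rightarrow> torus"
  assumes X: "continuous_on {s..t::real} X"
  shows "(\<lambda>r. (r, X r)) ` {s..<t} \<in> sets borel"
proof -
  let ?G = "\<lambda>r. (r, X r)"
  have "compact (?G ` {s..t})"
    using X by (intro compact_continuous_image continuous_on_Pair continuous_on_id) auto
  then have "closed (?G ` {s..t})" by (rule compact_imp_closed)
  then have "?G ` {s..t} \<in> sets borel" by (rule borel_closed)
  moreover have "?G ` {s..<t} = ?G ` {s..t} - {?G t}"
    by (auto simp: less_le)
  moreover have "{?G t} \<in> sets borel" by simp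
  ultimately show ?thesis by (metis sets.Diff)
qed

lemma graph_fmeasurable:
  assumes X: "continuous_on {s..t::real} X"
  shows "(\<lambda>r. (r, X r)) ` {s..<t} \<in> fmeasurable \<mu>"
  by (rule in_strip_fmeasurable[OF graph_borel[OF X], of s t]) auto

lemma graph_mass_split:
  assumes X: "continuous_on {s..t::real} X" and "s \<le> r" "r \<le> t"
  shows "graph_mass X s t = graph_mass X s r + graph_mass X r t"
proof -
  let ?G = "\<lambda>r. (r, X r)"
  have f: "?G ` {u..<v} \<in> fmeasurable \<mu>" if "s \<le> u" "v \<le> t" for u v
    using that by (intro graph_fmeasurable continuous_on_subset[OF X]) auto
  have "{s..<t} = {s..<r} \<union> {r..<t}" using assms by auto
  then have "measure \<mu> (?G ` {s..<t}) = measure \<mu> (?G ` {s..<r} \<union> ?G ` {r..<t})"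
    by (simp add: image_Un)
  also have "\<dots> = measure \<mu> (?G ` {s..<r}) + measure \<mu> (?G ` {r..<t})"
  proof (rule measure_Union)
    show "?G ` {s..<r} \<inter> ?G ` {r..<t} = {}" by auto
    show "emeasure \<mu> (?G ` {s..<r}) \<noteq> \<infinity>" "emeasure \<mu> (?G ` {r..<t}) \<noteq> \<infinity>"
      using fmeasurableD2[OF f[of s r]] fmeasurableD2[OF f[of r t]] assms by simp_all
    show "?G ` {s..<r} \<in> sets \<mu>" "?G ` {r..<t} \<in> sets \<mu>"
      using f[of s r] f[of r t] assms fmeasurableD by auto
  qed
  finally show ?thesis by (simp add: graph_mass_def)
qed

lemma graph_mass_ge:
  assumes X: "continuous_on {s..t::real} X" and "s < t"
  shows "measure \<mu> {(s, X s)} \<le> graph_mass X s t"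
  unfolding graph_mass_def using assms(2)
  by (intro measure_mono_fmeasurable graph_fmeasurable[OF X]) auto

lemma graph_mass_free:
  assumes X: "continuous_on {s..t::real} X" and "s < t"
    and free: "\<And>r. s < r \<Longrightarrow> r < t \<Longrightarrow> r \<notin> atom_times"
  shows "graph_mass X s t = measure \<mu> {(s, X s)}"
proof -
  let ?G = "\<lambda>r. (r, X r)"
  have b: "?G ` {s..<t} \<in> sets borel" by (rule graph_borel[OF X])
  have n: "emeasure \<mu> (?G ` {s..<t} - {?G s}) = 0"
    using b free by (intro emeasure_null) (force simp: atom_times_def)+
  have "emeasure \<mu> (?G ` {s..<t}) = emeasure \<mu> {?G s} + emeasure \<mu> (?G ` {s..<t} - {?G s})"
    using b assms(2) by (intro emeasure_split) auto
  then show ?thesis by (simp add: n graph_mass_def measure_def)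
qed

end

section \<open>Two facts of real analysis\<close>

text \<open>An infimum of parabolas of equal width is a parabola plus a concave function, and a finite concave
  function on the line is continuous. This is the source of all continuity of minimal costs.\<close>

lemma continuous_inf_parabolas:
  fixes F :: "real \<Rightarrow> real"
  assumes d: "d > 0"
    and le: "\<And>z i. i \<in> I \<Longrightarrow> F z \<le> c i + (z - \<xi> i)\<^sup>2 / (2 * d)"
    and approx: "\<And>z e. e > 0 \<Longrightarrow> \<exists>i\<in>I. c i + (z - \<xi> i)\<^sup>2 / (2 * d) < F z + e"
  shows "continuous_on UNIV F"
proof -
  define H where "H = (\<lambda>z. z\<^sup>2 / (2 * d) - F z)"
  have "convex_on UNIV H"
  proof (rule convex_onI)
    fix l x y :: real
    assume l: "0 < l" "l < 1"
    define z where "z = (1 - l) * x + l * y"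
    have "H z \<le> (1 - l) * H x + l * H y"
    proof (rule field_le_epsilon)
      fix e :: real assume "e > 0"
      then obtain i where i: "i \<in> I" "c i + (z - \<xi> i)\<^sup>2 / (2 * d) < F z + e"
        using approx by blast
      define A where "A u = u\<^sup>2 / (2 * d) - (c i + (u - \<xi> i)\<^sup>2 / (2 * d))" for u
      define p q where "p = \<xi> i / d" and "q = (\<xi> i)\<^sup>2 / (2 * d) + c i"
      have A: "A u = p * u - q" for u
        using d by (simp add: A_def p_def q_def power2_eq_square field_simps)
      have "H z \<le> A z + e" using i by (simp add: H_def A_def)
      also have "A z = (1 - l) * A x + l * A y"
        unfolding A z_def by (simp add: algebra_simps)
      also have "\<dots> \<le> (1 - l) * H x + l * H y"
      proof -
        have "A w \<le> H w" for w using le[OF i(1), of w] unfolding H_def A_def by linarith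
        then show ?thesis using l by (intro add_mono mult_left_mono) auto
      qed
      finally show "H z \<le> (1 - l) * H x + l * H y + e" by simp
    qed
    then show "H ((1 - l) *\<^sub>R x + l *\<^sub>R y) \<le> (1 - l) * H x + l * H y"
      by (simp add: z_def)
  qed simp
  then have "continuous_on UNIV H" by (intro convex_on_continuous) auto
  then have "continuous_on UNIV (\<lambda>z. z\<^sup>2 / (2 * d) - H z)" using d by (intro continuous_intros) auto
  then show ?thesis by (simp add: H_def)
qed

text \<open>\<open>G - w\<close> is only lower semicontinuous: where \<open>w\<close> is positive it drops below \<open>G\<close>. In a bounded interval
  this adds finitely many points to a sublevel set of \<open>G\<close>.\<close>

lemma compact_sublevel:
  fixes G w :: "real \<Rightarrow> real"
  assumes G: "continuous_on UNIV G" and w: "\<And>x. w x \<ge> 0"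
    and fin: "\<And>a b. finite {z \<in> {a..b}. w z > 0}"
    and R: "\<And>x. G x - w x \<le> c \<Longrightarrow> \<bar>x\<bar> \<le> R"
  shows "compact {x. G x - w x \<le> c}"
proof -
  have "{x. G x - w x \<le> c} =
      ({x. G x \<le> c} \<inter> {-R..R}) \<union> {x \<in> {z \<in> {-R..R}. w z > 0}. G x - w x \<le> c}" (is "_ = ?A \<union> ?B")
  proof (intro equalityI subsetI)
    fix x assume x: "x \<in> {x. G x - w x \<le> c}"
    then have "\<bar>x\<bar> \<le> R" using R by simp
    then have "x \<in> {-R..R}" by (auto simp: abs_le_iff)
    moreover have "w x = 0 \<or> w x > 0" using w[of x] by linarith
    ultimately show "x \<in> ?A \<union> ?B" using x by auto
  next
    fix x assume "x \<in> ?A \<union> ?B"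
    then show "x \<in> {x. G x - w x \<le> c}" using w[of x] by auto
  qed
  moreover have "closed {x. G x \<le> c}"
    using closed_Collect_le[OF G continuous_on_const] by simp
  then have "compact ?A" by (simp add: Int_commute compact_Int_closed)
  moreover have "finite ?B" by (rule finite_subset[OF _ fin[of "-R" R]]) auto
  ultimately show ?thesis by (simp add: compact_Un finite_imp_compact)
qed

text \<open>The candidates are a minimizer of the continuous part \<open>G\<close> and the finitely many relevant points
  with \<open>w > 0\<close>.\<close>

lemma attains_min:
  fixes G w :: "real \<Rightarrow> real"
  assumes G: "continuous_on UNIV G" and w: "\<And>x. w x \<ge> 0"
    and fin: "\<And>a b. finite {z \<in> {a..b}. w z > 0}"
    and R: "\<And>x. G x - w x \<le> G 0 - w 0 \<Longrightarrow> \<bar>x\<bar> \<le> R"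
  shows "\<exists>x. \<forall>y. G x - w x \<le> G y - w y"
proof -
  have R0: "R \<ge> 0" using R[of 0] by simp
  obtain x1 where x1: "x1 \<in> {-R..R}" "\<And>y. y \<in> {-R..R} \<Longrightarrow> G x1 \<le> G y"
    using continuous_attains_inf[of "{-R..R}" G] R0 continuous_on_subset[OF G] by auto
  let ?C = "insert x1 {z \<in> {-R..R}. w z > 0}"
  have "finite ?C" using fin by simp
  then obtain x where x: "x \<in> ?C" "\<And>y. y \<in> ?C \<Longrightarrow> G x - w x \<le> G y - w y"
    using ex_min_if_finite[of "(\<lambda>y. G y - w y) ` ?C"] by (fastforce simp: not_less)
  have in': "G x - w x \<le> G y - w y" if "y \<in> {-R..R}" for y
  proof (cases "w y > 0")
    case True then show ?thesis using that by (intro x(2)) auto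
  next
    case False
    then have "G x1 - w x1 \<le> G y - w y" using x1(2)[OF that] w[of x1] w[of y] by linarith
    moreover have "G x - w x \<le> G x1 - w x1" by (intro x(2)) auto
    ultimately show ?thesis by simp
  qed
  have "G x - w x \<le> G y - w y" for y
  proof (cases "y \<in> {-R..R}")
    case False
    then have "\<not> \<bar>y\<bar> \<le> R" by (auto simp: abs_le_iff)
    then have "G y - w y > G 0 - w 0" using R[of y] by linarith
    then show ?thesis using in'[of 0] R0 by auto
  qed (rule in')
  then show ?thesis by blast
qed

text \<open>The cost of visiting \<open>x\<close> at time \<open>r\<close> grows with the square of its distance to the straight path.\<close>

lemma parabola_split:
  fixes s r t a b x :: real
  assumes "s < r" "r < t"
  shows "(x - a)\<^sup>2 / (2 * (r - s)) + (b - x)\<^sup>2 / (2 * (t - r)) - (b - a)\<^sup>2 / (2 * (t - s))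
    = (t - s) * (x - (a + (b - a) * (r - s) / (t - s)))\<^sup>2 / (2 * (r - s) * (t - r))"
proof -
  define u v where "u = r - s" and "v = t - r"
  have uv: "u > 0" "v > 0" "t - s = u + v" using assms by (auto simp: u_def v_def)
  have "(x - a)\<^sup>2 / (2 * u) + (b - x)\<^sup>2 / (2 * v) - (b - a)\<^sup>2 / (2 * (u + v))
    = (u + v) * (x - (a + (b - a) * u / (u + v)))\<^sup>2 / (2 * u * v)"
  proof -
    have 1: "x - (a + (b - a) * u / (u + v)) = ((x - a) * v - (b - x) * u) / (u + v)"
      using uv by (simp add: field_simps)
    have 2: "(u + v) * (N / (u + v))\<^sup>2 / (2 * u * v) = N\<^sup>2 / (2 * u * v * (u + v))" for N
      using uv by (simp add: power2_eq_square)
    have 3: "((A * v + B * u) * (u + v) - C * (u * v)) / (2 * u * v * (u + v))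
        = A / (2 * u) + B / (2 * v) - C / (2 * (u + v))" for A B C
    proof -
      have "(A * v + B * u) * (u + v) / (2 * u * v * (u + v)) = (A * v + B * u) / (2 * u * v)"
        using uv by simp
      also have "\<dots> = A / (2 * u) + B / (2 * v)" using uv by (simp add: add_divide_distrib)
      finally show ?thesis using uv by (simp add: diff_divide_distrib)
    qed
    have 4: "((x - a) * v - (b - x) * u)\<^sup>2 =
        ((x - a)\<^sup>2 * v + (b - x)\<^sup>2 * u) * (u + v) - (b - a)\<^sup>2 * (u * v)"
      by (simp add: power2_eq_square algebra_simps)
    show ?thesis unfolding 1 2 4 3 ..
  qed
  then show ?thesis unfolding uv(3) u_def[symmetric] v_def[symmetric] .
qed

lemma parabola_aligned:
  fixes s r t a b x :: real
  assumes "s < r" "r < t"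
    and "(x - a)\<^sup>2 / (2 * (r - s)) + (b - x)\<^sup>2 / (2 * (t - r)) \<le> (b - a)\<^sup>2 / (2 * (t - s))"
  shows "x = a + (b - a) * (r - s) / (t - s)"
proof -
  define D where "D = x - (a + (b - a) * (r - s) / (t - s))"
  have "(t - s) * D\<^sup>2 / (2 * (r - s) * (t - r)) \<le> 0"
    using parabola_split[OF assms(1,2), of x a b] assms(3) unfolding D_def by linarith
  then have "D\<^sup>2 \<le> 0" using assms(1,2) by (simp add: divide_le_0_iff mult_le_0_iff)
  then show ?thesis by (simp add: D_def)
qed

section \<open>The minimal action in the universal cover\<close>

context environment
begin

definition path_from :: "(real \<Rightarrow> real) \<Rightarrow> real \<Rightarrow> real \<Rightarrow> real \<Rightarrow> real"
  where "path_from g s a r = a + (LBINT q:{s..r}. g q)"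

definition cost :: "(real \<Rightarrow> real) \<Rightarrow> real \<Rightarrow> real \<Rightarrow> real \<Rightarrow> real"
  where "cost g s a t = (LBINT q:{s..t}. (g q)\<^sup>2) / 2 - graph_mass (\<lambda>r. proj (path_from g s a r)) s t"

text \<open>The drift \<open>\<theta>\<close> changes the action of a path by a function of its endpoints in the cover, so the
  minimal action for \<open>\<theta> = 0\<close> between lifted endpoints governs all \<open>\<theta>\<close> at once.\<close>

definition least_cost :: "real \<Rightarrow> real \<Rightarrow> real \<Rightarrow> real \<Rightarrow> real"
  where "least_cost s a t b = Inf {cost g s a t |g. sq_int g s t \<and> path_from g s a t = b}"

lemma path_from_start [simp]: "path_from g s a s = a"
  by (simp add: path_from_def)

lemma path_from_continuous: "sq_int g s t \<Longrightarrow> continuous_on {s..t} (path_from g s a)"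
  unfolding path_from_def by (intro continuous_intros continuous_on_prim sq_int_integrable)

lemma path_from_split:
  "sq_int g s t \<Longrightarrow> s \<le> r \<Longrightarrow> r \<le> x \<Longrightarrow> x \<le> t \<Longrightarrow> path_from g s a x = path_from g r (path_from g s a r) x"
  unfolding path_from_def
  using LBINT_split[OF sq_int_integrable[OF sq_int_subset[of g s t s x]], of r] by simp

lemma path_from_const: "s \<le> r \<Longrightarrow> path_from (\<lambda>_. c) s a r = a + c * (r - s)"
  by (simp add: path_from_def LBINT_const)

lemma cost_split:
  assumes g: "sq_int g s t" and "s \<le> r" "r \<le> t"
  shows "cost g s a t = cost g s a r + cost g r (path_from g s a r) t"
proof -
  have "graph_mass (\<lambda>x. proj (path_from g s a x)) r t
      = graph_mass (\<lambda>x. proj (path_from g r (path_from g s a r) x)) r t"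
    using assms by (intro graph_mass_cong arg_cong[of _ _ proj] path_from_split[OF g]) auto
  moreover have "graph_mass (\<lambda>x. proj (path_from g s a x)) s t
      = graph_mass (\<lambda>x. proj (path_from g s a x)) s r + graph_mass (\<lambda>x. proj (path_from g s a x)) r t"
    using assms by (intro graph_mass_split continuous_on_proj_comp path_from_continuous)
  moreover have "(LBINT q:{s..t}. (g q)\<^sup>2) = (LBINT q:{s..r}. (g q)\<^sup>2) + (LBINT q:{r..t}. (g q)\<^sup>2)"
    using assms by (intro LBINT_split) (auto simp: sq_int_def)
  ultimately show ?thesis by (simp add: cost_def)
qed

lemma cost_lower:
  assumes "sq_int g s t" "s < t" "path_from g s a t = b"
  shows "(b - a)\<^sup>2 / (2 * (t - s)) - graph_mass (\<lambda>r. proj (path_from g s a r)) s t \<le> cost g s a t"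
proof -
  define Q where "Q = (b - a)\<^sup>2 / (t - s)"
  have "Q \<le> (LBINT r:{s..t}. (g r)\<^sup>2)"
    using LBINT_sq_lower[OF assms(1,2)] assms(3) by (auto simp: path_from_def Q_def)
  then have "Q / 2 - graph_mass (\<lambda>r. proj (path_from g s a r)) s t \<le> cost g s a t"
    unfolding cost_def by simp
  moreover have "(b - a)\<^sup>2 / (2 * (t - s)) = Q / 2" by (simp only: Q_def divide_divide_eq_left mult.commute)
  ultimately show ?thesis by (simp only:)
qed

lemma cost_lower':
  assumes "sq_int g s t" "s < t" "path_from g s a t = b"
  shows "(b - a)\<^sup>2 / (2 * (t - s)) - strip_mass s t \<le> cost g s a t"
  using cost_lower[OF assms] graph_mass_le[of "\<lambda>r. proj (path_from g s a r)" s t] by linarith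

lemma least_cost_le:
  assumes "sq_int g s t" "s < t" "path_from g s a t = b"
  shows "least_cost s a t b \<le> cost g s a t"
  unfolding least_cost_def
proof (rule cInf_lower)
  show "bdd_below {cost g s a t |g. sq_int g s t \<and> path_from g s a t = b}"
    using cost_lower'[OF _ assms(2)] by (intro bdd_belowI[where m = "(b - a)\<^sup>2 / (2 * (t - s)) - strip_mass s t"]) blast
qed (use assms in blast)

lemma least_cost_ge:
  assumes "s < t" and "\<And>g. sq_int g s t \<Longrightarrow> path_from g s a t = b \<Longrightarrow> c \<le> cost g s a t"
  shows "c \<le> least_cost s a t b"
  unfolding least_cost_def
proof (rule cInf_greatest)
  have "path_from (\<lambda>_. (b - a) / (t - s)) s a t = b"
    using assms(1) by (simp add: path_from_const)
  then show "{cost g s a t |g. sq_int g s t \<and> path_from g s a t = b} \<noteq> {}"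
    using sq_int_const by blast
qed (use assms(2) in blast)

lemma least_cost_lower: "s < t \<Longrightarrow> (b - a)\<^sup>2 / (2 * (t - s)) - strip_mass s t \<le> least_cost s a t b"
  by (intro least_cost_ge cost_lower') auto

lemma least_cost_approx:
  assumes "s < t" "e > 0"
  obtains g where "sq_int g s t" "path_from g s a t = b" "cost g s a t < least_cost s a t b + e"
proof (rule ccontr)
  assume nt: "\<not> thesis"
  have "least_cost s a t b + e \<le> least_cost s a t b"
  proof (rule least_cost_ge[OF assms(1)])
    fix g assume g: "sq_int g s t" "path_from g s a t = b"
    show "least_cost s a t b + e \<le> cost g s a t"
      using that[OF g] nt by (metis not_less)
  qed
  then show False using assms(2) by simp
qed

lemma cost_line:
  assumes "s < t"
  shows "cost (\<lambda>_. (b - a) / (t - s)) s a t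
    = (b - a)\<^sup>2 / (2 * (t - s)) - graph_mass (\<lambda>r. proj (a + (b - a) / (t - s) * (r - s))) s t"
proof -
  have "graph_mass (\<lambda>r. proj (path_from (\<lambda>_. (b - a) / (t - s)) s a r)) s t
      = graph_mass (\<lambda>r. proj (a + (b - a) / (t - s) * (r - s))) s t"
    by (intro graph_mass_cong) (auto simp: path_from_const)
  moreover have "(LBINT q:{s..t}. ((b - a) / (t - s))\<^sup>2) / 2 = (b - a)\<^sup>2 / (2 * (t - s))"
  proof -
    have "(D / T)\<^sup>2 * T / 2 = D\<^sup>2 / (2 * T)" if "T > 0" for D T :: real
      using that by (simp add: power2_eq_square)
    moreover have "(LBINT q:{s..t}. ((b - a) / (t - s))\<^sup>2) = ((b - a) / (t - s))\<^sup>2 * (t - s)"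
      using assms by (intro LBINT_const) simp
    ultimately show ?thesis using assms by (metis diff_gt_0_iff_gt)
  qed
  ultimately show ?thesis unfolding cost_def by (simp only:)
qed

lemma least_cost_le_parabola:
  assumes "s < t" shows "least_cost s a t b \<le> (b - a)\<^sup>2 / (2 * (t - s)) - mass s a"
proof -
  let ?g = "\<lambda>_::real. (b - a) / (t - s)"
  have "least_cost s a t b \<le> cost ?g s a t"
    using assms by (intro least_cost_le) (auto simp: path_from_const)
  moreover have "mass s a \<le> graph_mass (\<lambda>r. proj (a + (b - a) / (t - s) * (r - s))) s t"
    using graph_mass_ge[of s t "\<lambda>r. proj (a + (b - a) / (t - s) * (r - s))"] assms
    by (simp add: mass_def continuous_on_proj_comp continuous_intros)
  ultimately show ?thesis using cost_line[OF assms, of b a] by linarith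
qed

lemma least_cost_free:
  assumes "s < t" and free: "\<And>r. s < r \<Longrightarrow> r < t \<Longrightarrow> r \<notin> atom_times"
  shows "least_cost s a t b = (b - a)\<^sup>2 / (2 * (t - s)) - mass s a"
proof (rule antisym[OF least_cost_le_parabola[OF assms(1)] least_cost_ge[OF assms(1)]])
  fix g assume g: "sq_int g s t" "path_from g s a t = b"
  have "graph_mass (\<lambda>r. proj (path_from g s a r)) s t = mass s a"
    using graph_mass_free[of s t "\<lambda>r. proj (path_from g s a r)"] assms
      continuous_on_proj_comp[OF path_from_continuous[OF g(1)]] by (simp add: mass_def)
  then show "(b - a)\<^sup>2 / (2 * (t - s)) - mass s a \<le> cost g s a t"
    using cost_lower[OF g(1) assms(1) g(2)] by simp
qed

lemma cost_paste:
  assumes "s < r" "r < t" and g: "sq_int g s r" "path_from g s a r = x" and h: "sq_int h r t"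
  obtains k where "sq_int k s t" "\<And>y. y \<in> {s..r} \<Longrightarrow> path_from k s a y = path_from g s a y"
    "\<And>y. y \<in> {r..t} \<Longrightarrow> path_from k s a y = path_from h r x y"
    "cost k s a t = cost g s a r + cost h r x t"
proof -
  define k where "k = (\<lambda>x. if x \<le> r then g x else h x)"
  note p = sq_int_paste[OF g(1) h(1) less_imp_le[OF assms(1)] less_imp_le[OF assms(2)], folded k_def]
  have pl: "path_from k s a y = path_from g s a y" if "y \<in> {s..r}" for y
    using p(2)[OF that] by (simp add: path_from_def)
  have pr: "path_from k s a y = path_from h r x y" if "y \<in> {r..t}" for y
    using p(3)[OF that] g(2) by (simp add: path_from_def)
  have "graph_mass (\<lambda>y. proj (path_from k s a y)) s t
      = graph_mass (\<lambda>y. proj (path_from k s a y)) s r + graph_mass (\<lambda>y. proj (path_from k s a y)) r t"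
    using assms by (intro graph_mass_split continuous_on_proj_comp path_from_continuous p) auto
  moreover have "graph_mass (\<lambda>y. proj (path_from k s a y)) s r = graph_mass (\<lambda>y. proj (path_from g s a y)) s r"
    by (intro graph_mass_cong) (auto simp: pl)
  moreover have "graph_mass (\<lambda>y. proj (path_from k s a y)) r t = graph_mass (\<lambda>y. proj (path_from h r x y)) r t"
    by (intro graph_mass_cong) (auto simp: pr)
  moreover have "(LBINT q:{s..t}. (k q)\<^sup>2) = (LBINT q:{s..r}. (g q)\<^sup>2) + (LBINT q:{r..t}. (h q)\<^sup>2)"
    using p(4) by (simp add: k_def)
  ultimately have "cost k s a t = cost g s a r + cost h r x t"
    by (simp add: cost_def)
  with that[OF p(1) pl pr] show thesis by blast
qed

lemma least_cost_triangle:
  assumes "s < r" "r < t"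
  shows "least_cost s a t b \<le> least_cost s a r x + least_cost r x t b"
proof (rule field_le_epsilon)
  fix e :: real assume "e > 0"
  then have e: "e / 2 > 0" by simp
  obtain g where g: "sq_int g s r" "path_from g s a r = x" "cost g s a r < least_cost s a r x + e / 2"
    using least_cost_approx[OF assms(1) e] by blast
  obtain h where h: "sq_int h r t" "path_from h r x t = b" "cost h r x t < least_cost r x t b + e / 2"
    using least_cost_approx[OF assms(2) e] by blast
  obtain k where k: "sq_int k s t" "\<And>y. y \<in> {r..t} \<Longrightarrow> path_from k s a y = path_from h r x y"
    "cost k s a t = cost g s a r + cost h r x t"
    using cost_paste[OF assms g(1,2) h(1)] by metis
  have "least_cost s a t b \<le> cost k s a t"
    using assms k(2)[of t] h(2) by (intro least_cost_le k(1)) auto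
  then show "least_cost s a t b \<le> least_cost s a r x + least_cost r x t b + e" using g(3) h(3) k(3) by simp
qed

lemma least_cost_midpoint_approx:
  assumes "s < r" "r < t" "e > 0"
  shows "\<exists>x. least_cost s a r x + least_cost r x t b < least_cost s a t b + e"
proof -
  obtain g where g: "sq_int g s t" "path_from g s a t = b" "cost g s a t < least_cost s a t b + e"
    using least_cost_approx[of s t e a b] assms by auto
  let ?x = "path_from g s a r"
  have "least_cost s a r ?x \<le> cost g s a r"
    using assms by (intro least_cost_le sq_int_subset[OF g(1)]) auto
  moreover have "least_cost r ?x t b \<le> cost g r ?x t"
    using assms g(2) path_from_split[OF g(1), of r t a] by (intro least_cost_le sq_int_subset[OF g(1)]) auto
  ultimately show ?thesis
    using cost_split[OF g(1), of r a] g(3) assms by (intro exI[of _ ?x]) auto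
qed

lemma least_cost_shift: "least_cost s (a + of_int k) t (b + of_int k) = least_cost s a t b"
proof -
  have "path_from g s (a + of_int k) r = path_from g s a r + of_int k" for g r
    by (simp add: path_from_def)
  then show ?thesis by (simp add: least_cost_def cost_def)
qed

text \<open>Just before \<open>t\<close> there are no atoms, so the cost of the last leg is a parabola of fixed width.\<close>

lemma least_cost_continuous_end:
  assumes "s < t" shows "continuous_on UNIV (least_cost s a t)"
proof -
  obtain q where q: "s < q" "q < t" "\<And>x. q \<le> x \<Longrightarrow> x < t \<Longrightarrow> x \<notin> atom_times"
    using atom_gap_left[OF assms] by blast
  have leg: "least_cost q x t z = (z - x)\<^sup>2 / (2 * (t - q))" for x z
    using q by (subst least_cost_free) (auto simp: mass_0)
  show ?thesis
  proof (rule continuous_inf_parabolas[where d = "t - q" and I = UNIV and c = "least_cost s a q" and \<xi> = "\<lambda>x. x"])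
    show "least_cost s a t z \<le> least_cost s a q i + (z - i)\<^sup>2 / (2 * (t - q))" for z i
      using least_cost_triangle[OF q(1,2), of a z i] leg by simp
    show "\<exists>i\<in>UNIV. least_cost s a q i + (z - i)\<^sup>2 / (2 * (t - q)) < least_cost s a t z + e" if "e > 0" for z e
      using least_cost_midpoint_approx[OF q(1,2) that, of a z] leg by simp
  qed (use q in simp)
qed

text \<open>The mass at the starting point is collected, which makes the cost itself discontinuous there.\<close>

lemma least_cost_continuous_start:
  assumes "s < t" shows "continuous_on UNIV (\<lambda>a. least_cost s a t b + mass s a)"
proof -
  obtain q where q: "s < q" "q < t" "\<And>x. s < x \<Longrightarrow> x \<le> q \<Longrightarrow> x \<notin> atom_times"
    using atom_gap_right[OF assms] by blast
  have leg: "least_cost s z q x = (z - x)\<^sup>2 / (2 * (q - s)) - mass s z" for x z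
    using q by (subst least_cost_free) (auto simp: mass_0 power2_commute)
  show ?thesis
  proof (rule continuous_inf_parabolas[where d = "q - s" and I = UNIV and c = "\<lambda>x. least_cost q x t b" and \<xi> = "\<lambda>x. x"])
    show "least_cost s z t b + mass s z \<le> least_cost q i t b + (z - i)\<^sup>2 / (2 * (q - s))" for z i
      using least_cost_triangle[OF q(1,2), of z b i] leg by simp
    show "\<exists>i\<in>UNIV. least_cost q i t b + (z - i)\<^sup>2 / (2 * (q - s)) < least_cost s z t b + mass s z + e" if "e > 0" for z e
      using least_cost_midpoint_approx[OF q(1,2) that, of z b] by (auto simp: leg algebra_simps)
  qed (use q in simp)
qed

lemma least_cost_coercive:
  assumes "s < r" "r < t"
  shows "\<exists>R. \<forall>x. least_cost s a r x + least_cost r x t b \<le> c \<longrightarrow> \<bar>x\<bar> \<le> R"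
proof -
  define C where "C = 2 * (r - s) * (c + strip_mass s r + strip_mass r t)"
  have "\<bar>x\<bar> \<le> \<bar>a\<bar> + 1 + \<bar>C\<bar>" if "least_cost s a r x + least_cost r x t b \<le> c" for x
  proof -
    have "(x - a)\<^sup>2 / (2 * (r - s)) \<le> c + strip_mass s r + strip_mass r t"
    proof -
      have "0 \<le> (b - x)\<^sup>2 / (2 * (t - r))" using assms by simp
      then show ?thesis using least_cost_lower[OF assms(1), of x a] least_cost_lower[OF assms(2), of b x] that by linarith
    qed
    then have "(x - a)\<^sup>2 \<le> C" using assms by (simp add: C_def field_simps)
    moreover have "\<bar>x - a\<bar> \<le> 1 + (x - a)\<^sup>2"
    proof -
      have "0 \<le> (\<bar>x - a\<bar> - 1)\<^sup>2 + \<bar>x - a\<bar>" by simp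
      then show ?thesis by (simp add: power2_eq_square algebra_simps)
    qed
    ultimately show ?thesis by linarith
  qed
  then show ?thesis by blast
qed

lemma least_cost_midpoint_compact:
  assumes "s < r" "r < t"
  shows "compact {x. least_cost s a r x + least_cost r x t b \<le> c}"
proof -
  obtain R where R: "\<And>x. least_cost s a r x + least_cost r x t b \<le> c \<Longrightarrow> \<bar>x\<bar> \<le> R"
    using least_cost_coercive[OF assms] by blast
  have "compact {x. least_cost s a r x + (least_cost r x t b + mass r x) - mass r x \<le> c}"
    using R assms by (intro compact_sublevel[where R = R] finite_mass_pos continuous_on_add
        least_cost_continuous_end least_cost_continuous_start) auto
  then show ?thesis by simp
qed

lemma least_cost_midpoint_min:
  assumes "s < r" "r < t"
  shows "\<exists>x. \<forall>y. least_cost s a r x + least_cost r x t b \<le> least_cost s a r y + least_cost r y t b"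
proof -
  obtain R where R: "\<And>x. least_cost s a r x + least_cost r x t b \<le> least_cost s a r 0 + least_cost r 0 t b \<Longrightarrow> \<bar>x\<bar> \<le> R"
    using least_cost_coercive[OF assms] by blast
  have "\<exists>x. \<forall>y. least_cost s a r x + (least_cost r x t b + mass r x) - mass r x \<le> least_cost s a r y + (least_cost r y t b + mass r y) - mass r y"
    using R assms by (intro attains_min[where R = R] finite_mass_pos continuous_on_add
        least_cost_continuous_end least_cost_continuous_start) auto
  then show ?thesis by simp
qed

lemma least_cost_midpoint:
  assumes "s < r" "r < t"
  shows "\<exists>x. least_cost s a t b = least_cost s a r x + least_cost r x t b"
proof -
  obtain x where x: "\<And>y. least_cost s a r x + least_cost r x t b \<le> least_cost s a r y + least_cost r y t b"
    using least_cost_midpoint_min[OF assms] by blast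
  have "least_cost s a r x + least_cost r x t b \<le> least_cost s a t b"
  proof (rule field_le_epsilon)
    fix e :: real assume "e > 0"
    then obtain y where "least_cost s a r y + least_cost r y t b < least_cost s a t b + e"
      using least_cost_midpoint_approx[OF assms] by blast
    then show "least_cost s a r x + least_cost r x t b \<le> least_cost s a t b + e" using x[of y] by linarith
  qed
  then show ?thesis using least_cost_triangle[OF assms, of a b x] by (intro exI[of _ x]) linarith
qed

end

lemma first_meeting:
  fixes f g :: "real \<Rightarrow> real"
  assumes "continuous_on {s..t} f" "continuous_on {s..t} g" "s < t" "f s < g s" "f t \<ge> g t"
  obtains r where "s < r" "r \<le> t" "f r = g r" "\<And>x. s \<le> x \<Longrightarrow> x < r \<Longrightarrow> f x < g x"
proof -
  define S where "S = {x \<in> {s..t}. g x \<le> f x}"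
  have "closed S" unfolding S_def using assms by (intro continuous_on_closed_Collect_le) auto
  moreover have S: "S \<noteq> {}" "bdd_below S"
    using assms by (auto simp: S_def intro!: bdd_belowI[where m = s])
  ultimately have r: "Inf S \<in> S" by (intro closed_contains_Inf)
  have low: "f x < g x" if "s \<le> x" "x < Inf S" for x
  proof (rule ccontr)
    assume "\<not> f x < g x"
    then have "x \<in> S" using that r by (auto simp: S_def)
    then show False using cInf_lower[OF _ S(2)] that(2) by force
  qed
  have "Inf S \<noteq> s" using r assms(4) by (auto simp: S_def)
  then have sr: "s < Inf S" "Inf S \<le> t" using r by (auto simp: S_def)
  have "continuous_on {s..Inf S} (\<lambda>x. f x - g x)"
    using assms sr by (auto intro!: continuous_intros intro: continuous_on_subset)
  then obtain x where x: "s \<le> x" "x \<le> Inf S" "f x - g x = 0"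
    using IVT'[of "\<lambda>x. f x - g x" s 0 "Inf S"] r sr assms(4) by (auto simp: S_def)
  then have "x = Inf S" using low[of x] by force
  then show ?thesis using that[of "Inf S"] sr x low by auto
qed

section \<open>Geodesics\<close>

context environment
begin

text \<open>Induction on the number of atom times inside the interval. It reduces statements that are additive
  in time to intervals on which a minimizing path is a straight line.\<close>

lemma atom_times_induct [consumes 1, case_names free split]:
  fixes s t :: real
  assumes "s < t"
    and free: "\<And>s t. s < t \<Longrightarrow> (\<And>r. s < r \<Longrightarrow> r < t \<Longrightarrow> r \<notin> atom_times) \<Longrightarrow> P s t"
    and split: "\<And>s r t. s < r \<Longrightarrow> r < t \<Longrightarrow> P s r \<Longrightarrow> P r t \<Longrightarrow> P s t"
  shows "P s t"
  using \<open>s < t\<close>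
proof (induction "card (atom_times \<inter> {s<..<t})" arbitrary: s t rule: less_induct)
  case less
  have fin: "finite (atom_times \<inter> {s<..<t})" for s t
    by (rule finite_subset[OF _ finite_atom_times[of s t]]) auto
  show ?case
  proof (cases "atom_times \<inter> {s<..<t} = {}")
    case True
    then show ?thesis using less.prems by (intro free) auto
  next
    case False
    then obtain r where r: "r \<in> atom_times" "s < r" "r < t" by auto
    have "card (atom_times \<inter> {s<..<r}) < card (atom_times \<inter> {s<..<t})"
      using r by (intro psubset_card_mono fin) auto
    moreover have "card (atom_times \<inter> {r<..<t}) < card (atom_times \<inter> {s<..<t})"
      using r by (intro psubset_card_mono fin) auto
    ultimately show ?thesis using r less.hyps by (intro split[of s r t]) auto
  qed
qed

lemma line_minimizes:
  assumes "s < t" "\<And>r. s < r \<Longrightarrow> r < t \<Longrightarrow> r \<notin> atom_times"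
  shows "cost (\<lambda>_. (b - a) / (t - s)) s a t = least_cost s a t b"
proof -
  have "graph_mass (\<lambda>r. proj (a + (b - a) / (t - s) * (r - s))) s t = mass s a"
    using assms by (subst graph_mass_free) (auto simp: mass_def intro!: continuous_on_proj_comp continuous_intros)
  then show ?thesis using cost_line[OF assms(1), of b a] least_cost_free[OF assms, of a b] by simp
qed

lemma minimizer_exists:
  assumes "s < t"
  shows "\<exists>g. sq_int g s t \<and> path_from g s a t = b \<and> cost g s a t = least_cost s a t b"
  using assms
proof (induction arbitrary: a b rule: atom_times_induct)
  case (free s t)
  then show ?case
    using line_minimizes[of s t b a]
    by (intro exI[of _ "\<lambda>_. (b - a) / (t - s)"]) (auto simp: path_from_const)
next
  case (split s r t)
  obtain x where x: "least_cost s a t b = least_cost s a r x + least_cost r x t b"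
    using least_cost_midpoint[OF split(1,2)] by blast
  obtain g where g: "sq_int g s r" "path_from g s a r = x" "cost g s a r = least_cost s a r x"
    using split.IH(1) by blast
  obtain h where h: "sq_int h r t" "path_from h r x t = b" "cost h r x t = least_cost r x t b"
    using split.IH(2) by blast
  obtain k where k: "sq_int k s t" "\<And>y. y \<in> {r..t} \<Longrightarrow> path_from k s a y = path_from h r x y"
    "cost k s a t = cost g s a r + cost h r x t"
    using cost_paste[OF split(1,2) g(1,2) h(1)] by metis
  then show ?case using split(1,2) g h x by (intro exI[of _ k]) auto
qed

text \<open>Action-minimizing paths are characterized by additivity of the minimal action along them; this
  avoids all reference to derivatives.\<close>

definition geodesic :: "(real \<Rightarrow> real) \<Rightarrow> real \<Rightarrow> real \<Rightarrow> bool"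
  where "geodesic f s t \<longleftrightarrow> (\<forall>u v w. s \<le> u \<longrightarrow> u < v \<longrightarrow> v < w \<longrightarrow> w \<le> t \<longrightarrow>
    least_cost u (f u) w (f w) = least_cost u (f u) v (f v) + least_cost v (f v) w (f w))"

lemma geodesicD: "geodesic f s t \<Longrightarrow> s \<le> u \<Longrightarrow> u < v \<Longrightarrow> v < w \<Longrightarrow> w \<le> t \<Longrightarrow>
    least_cost u (f u) w (f w) = least_cost u (f u) v (f v) + least_cost v (f v) w (f w)"
  by (simp add: geodesic_def)

lemma geodesic_subset: "geodesic f s t \<Longrightarrow> s \<le> s' \<Longrightarrow> t' \<le> t \<Longrightarrow> geodesic f s' t'"
  unfolding geodesic_def by (meson order_trans)

lemma geodesic_cong: "(\<And>x. x \<in> {s..t} \<Longrightarrow> f x = g x) \<Longrightarrow> geodesic f s t \<longleftrightarrow> geodesic g s t"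
  unfolding geodesic_def by (smt (verit, best) atLeastAtMost_iff)

lemma geodesic_shift: "geodesic (\<lambda>x. f x + of_int k) s t \<longleftrightarrow> geodesic f s t"
  by (simp add: geodesic_def least_cost_shift)

text \<open>Costs add up along a path, while minimal costs are subadditive; so both parts are minimal as well.\<close>

lemma minimizer_splits:
  assumes g: "sq_int g s t" "cost g s a t \<le> least_cost s a t (path_from g s a t)" and "s < r" "r < t"
  shows "cost g s a r = least_cost s a r (path_from g s a r)"
    and "cost g r (path_from g s a r) t = least_cost r (path_from g s a r) t (path_from g s a t)"
    and "least_cost s a t (path_from g s a t)
      = least_cost s a r (path_from g s a r) + least_cost r (path_from g s a r) t (path_from g s a t)"
proof -
  let ?p = "path_from g s a"
  have "least_cost s a r (?p r) \<le> cost g s a r"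
    using assms by (intro least_cost_le sq_int_subset[OF g(1)]) auto
  moreover have "least_cost r (?p r) t (?p t) \<le> cost g r (?p r) t"
    using assms path_from_split[OF g(1), of r t a] by (intro least_cost_le sq_int_subset[OF g(1)]) auto
  moreover have "cost g s a t = cost g s a r + cost g r (?p r) t"
    using assms by (intro cost_split) auto
  moreover have "least_cost s a t (?p t) \<le> least_cost s a r (?p r) + least_cost r (?p r) t (?p t)"
    by (rule least_cost_triangle[OF assms(3,4)])
  ultimately show "cost g s a r = least_cost s a r (?p r)" "cost g r (?p r) t = least_cost r (?p r) t (?p t)"
    "least_cost s a t (?p t) = least_cost s a r (?p r) + least_cost r (?p r) t (?p t)"
    using g(2) by linarith+
qed

lemma minimizer_geodesic:
  assumes g: "sq_int g s t" "cost g s a t \<le> least_cost s a t (path_from g s a t)"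
  shows "geodesic (path_from g s a) s t"
  unfolding geodesic_def
proof (intro allI impI)
  fix u v w assume uvw: "s \<le> u" "u < v" "v < w" "w \<le> t"
  let ?p = "path_from g s a"
  have p: "path_from g u (?p u) x = ?p x" if "u \<le> x" "x \<le> t" for x
    using path_from_split[OF g(1), of u x a] uvw that by simp
  have "cost g u (?p u) t \<le> least_cost u (?p u) t (?p t)"
  proof (cases "s = u")
    case True then show ?thesis using g(2) by simp
  next
    case False
    then show ?thesis using minimizer_splits(2)[OF g, of u] uvw by simp
  qed
  then have t: "cost g u (?p u) t \<le> least_cost u (?p u) t (path_from g u (?p u) t)"
    using p[of t] uvw by simp
  have gu: "sq_int g u t" using uvw by (intro sq_int_subset[OF g(1)]) auto
  have "cost g u (?p u) w \<le> least_cost u (?p u) w (path_from g u (?p u) w)"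
  proof (cases "w = t")
    case True then show ?thesis using t by simp
  next
    case False
    then show ?thesis using minimizer_splits(1)[OF gu t, of w] uvw by simp
  qed
  from minimizer_splits(3)[OF _ this uvw(2,3)] gu uvw
  show "least_cost u (?p u) w (?p w) = least_cost u (?p u) v (?p v) + least_cost v (?p v) w (?p w)"
    using p[of v] p[of w] sq_int_subset[OF gu, of u w] by simp
qed

lemma geodesic_exists:
  assumes "s < t" obtains f where "geodesic f s t" "f s = a" "f t = b"
proof -
  obtain g where g: "sq_int g s t" "path_from g s a t = b" "cost g s a t = least_cost s a t b"
    using minimizer_exists[OF assms] by blast
  then have "geodesic (path_from g s a) s t" by (intro minimizer_geodesic) auto
  then show ?thesis using g(2) by (intro that[of "path_from g s a"]) auto
qed

lemma geodesic_linear: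
  assumes f: "geodesic f s t" and "s \<le> u" "u < v" "v \<le> t"
    and free: "\<And>r. u < r \<Longrightarrow> r < v \<Longrightarrow> r \<notin> atom_times" and r: "r \<in> {u..v}"
  shows "f r = f u + (f v - f u) / (v - u) * (r - u)"
proof (cases "r = u \<or> r = v")
  case True then show ?thesis using \<open>u < v\<close> by auto
next
  case False
  then have r: "u < r" "r < v" using r by auto
  have "least_cost u (f u) v (f v) = (f v - f u)\<^sup>2 / (2 * (v - u)) - mass u (f u)"
    by (intro least_cost_free assms)
  moreover have "least_cost u (f u) r (f r) = (f r - f u)\<^sup>2 / (2 * (r - u)) - mass u (f u)"
    using r by (intro least_cost_free free) auto
  moreover have "least_cost r (f r) v (f v) = (f v - f r)\<^sup>2 / (2 * (v - r)) - mass r (f r)"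
    using r by (intro least_cost_free free) auto
  moreover have "mass r (f r) = 0" using r free by (intro mass_0) auto
  moreover have "least_cost u (f u) v (f v) = least_cost u (f u) r (f r) + least_cost r (f r) v (f v)"
    using r assms by (intro geodesicD[OF f]) auto
  ultimately have "(f r - f u)\<^sup>2 / (2 * (r - u)) + (f v - f r)\<^sup>2 / (2 * (v - r)) \<le> (f v - f u)\<^sup>2 / (2 * (v - u))"
    by linarith
  from parabola_aligned[OF r this] show ?thesis by simp
qed

lemma geodesic_minimizer:
  assumes "s < t" "geodesic f s t"
  shows "\<exists>g. sq_int g s t \<and> (\<forall>x\<in>{s..t}. path_from g s (f s) x = f x) \<and> cost g s (f s) t = least_cost s (f s) t (f t)"
  using assms
proof (induction rule: atom_times_induct)
  case (free s t)
  have "path_from (\<lambda>_. (f t - f s) / (t - s)) s (f s) x = f x" if "x \<in> {s..t}" for x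
  proof -
    have "f x = f s + (f t - f s) / (t - s) * (x - s)"
      by (rule geodesic_linear[OF free(3)]) (use free that in auto)
    then show ?thesis using that by (subst path_from_const) auto
  qed
  then show ?case
    using line_minimizes[OF free(1,2), of "f t" "f s"] sq_int_const by blast
next
  case (split s r t)
  obtain g where g: "sq_int g s r" "\<forall>x\<in>{s..r}. path_from g s (f s) x = f x"
      "cost g s (f s) r = least_cost s (f s) r (f r)"
    using split.IH(1) geodesic_subset[OF split.prems, of s r] split.hyps by auto
  obtain h where h: "sq_int h r t" "\<forall>x\<in>{r..t}. path_from h r (f r) x = f x"
      "cost h r (f r) t = least_cost r (f r) t (f t)"
    using split.IH(2) geodesic_subset[OF split.prems, of r t] split.hyps by auto
  have gr: "path_from g s (f s) r = f r" using g(2) split.hyps by auto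
  obtain k where k: "sq_int k s t"
    "\<And>y. y \<in> {s..r} \<Longrightarrow> path_from k s (f s) y = path_from g s (f s) y"
    "\<And>y. y \<in> {r..t} \<Longrightarrow> path_from k s (f s) y = path_from h r (f r) y"
    "cost k s (f s) t = cost g s (f s) r + cost h r (f r) t"
    using cost_paste[OF split.hyps(1,2) g(1) gr h(1)] by metis
  have "least_cost s (f s) t (f t) = least_cost s (f s) r (f r) + least_cost r (f r) t (f t)"
    using split.hyps by (intro geodesicD[OF split.prems]) auto
  moreover have "path_from k s (f s) x = f x" if "x \<in> {s..t}" for x
    using k(2)[of x] k(3)[of x] g(2) h(2) that by (cases "x \<le> r") auto
  ultimately show ?case using k g(3) h(3) by (intro exI[of _ k]) auto
qed

lemma geodesic_continuous: "geodesic f s t \<Longrightarrow> continuous_on {s..t} f"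
proof (cases "s < t")
  case True
  assume "geodesic f s t"
  then obtain g where "sq_int g s t" "\<forall>x\<in>{s..t}. path_from g s (f s) x = f x"
    using geodesic_minimizer[OF True] by blast
  then show ?thesis using path_from_continuous[of g s t "f s"] continuous_on_eq by metis
next
  case False
  then have "{s..t} = {} \<or> {s..t} = {s}" by auto
  then show "continuous_on {s..t} f" by (metis continuous_on_empty continuous_on_sing)
qed

lemma geodesic_paste:
  assumes "s < r" "r < t" and f: "geodesic f s r" and g: "geodesic g r t" and "f r = g r"
    and least_cost: "least_cost s (f s) r (f r) + least_cost r (f r) t (g t) \<le> least_cost s (f s) t (g t)"
  shows "geodesic (\<lambda>x. if x \<le> r then f x else g x) s t"
proof -
  obtain p where p: "sq_int p s r" "\<forall>x\<in>{s..r}. path_from p s (f s) x = f x"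
      "cost p s (f s) r = least_cost s (f s) r (f r)"
    using geodesic_minimizer[OF assms(1) f] by blast
  obtain q where q: "sq_int q r t" "\<forall>x\<in>{r..t}. path_from q r (g r) x = g x"
      "cost q r (g r) t = least_cost r (g r) t (g t)"
    using geodesic_minimizer[OF assms(2) g] by blast
  have pr: "path_from p s (f s) r = g r" using p(2) assms(1,5) by auto
  obtain k where k: "sq_int k s t"
    "\<And>y. y \<in> {s..r} \<Longrightarrow> path_from k s (f s) y = path_from p s (f s) y"
    "\<And>y. y \<in> {r..t} \<Longrightarrow> path_from k s (f s) y = path_from q r (g r) y"
    "cost k s (f s) t = cost p s (f s) r + cost q r (g r) t"
    using cost_paste[OF assms(1,2) p(1) pr q(1)] by metis
  have kt: "path_from k s (f s) t = g t" using k(3)[of t] q(2) assms(2) by auto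
  have "cost k s (f s) t \<le> least_cost s (f s) t (path_from k s (f s) t)"
    using least_cost k(4) p(3) q(3) \<open>f r = g r\<close> kt by simp
  then have "geodesic (path_from k s (f s)) s t" by (rule minimizer_geodesic[OF k(1)])
  moreover have "path_from k s (f s) x = (if x \<le> r then f x else g x)" if "x \<in> {s..t}" for x
    using k(2)[of x] k(3)[of x] p(2) q(2) that by auto
  ultimately show ?thesis
    using geodesic_cong[of s t "path_from k s (f s)" "\<lambda>x. if x \<le> r then f x else g x"] by blast
qed

lemma geodesic_left:
  assumes f: "geodesic f s t" and "s < r" "r \<le> t"
  obtains d c where "d > 0" "s \<le> r - d" "\<And>x. r - d \<le> x \<Longrightarrow> x \<le> r \<Longrightarrow> f x = f r + c * (x - r)"
proof -
  obtain q where q: "s < q" "q < r" "\<And>x. q \<le> x \<Longrightarrow> x < r \<Longrightarrow> x \<notin> atom_times"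
    using atom_gap_left[OF assms(2)] by blast
  have l: "f x = f q + (f r - f q) / (r - q) * (x - q)" if "x \<in> {q..r}" for x
    by (rule geodesic_linear[OF f]) (use q assms that in auto)
  show ?thesis
  proof (rule that[of "r - q" "(f r - f q) / (r - q)"])
    fix x assume "r - (r - q) \<le> x" "x \<le> r"
    then have "f x = f q + (f r - f q) / (r - q) * (x - q)" by (intro l) auto
    also have "\<dots> = f q + (f r - f q) / (r - q) * ((r - q) + (x - r))" by simp
    also have "\<dots> = f r + (f r - f q) / (r - q) * (x - r)" unfolding distrib_left using q by simp
    finally show "f x = f r + (f r - f q) / (r - q) * (x - r)" .
  qed (use q in auto)
qed

lemma geodesic_right:
  assumes f: "geodesic f s t" and "s \<le> r" "r < t"
  obtains d c where "d > 0" "r + d \<le> t" "\<And>x. r \<le> x \<Longrightarrow> x \<le> r + d \<Longrightarrow> f x = f r + c * (x - r)"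
proof -
  obtain q where q: "r < q" "q < t" "\<And>x. r < x \<Longrightarrow> x \<le> q \<Longrightarrow> x \<notin> atom_times"
    using atom_gap_right[OF assms(3)] by blast
  have l: "f x = f r + (f q - f r) / (q - r) * (x - r)" if "x \<in> {r..q}" for x
    by (rule geodesic_linear[OF f]) (use q assms that in auto)
  show ?thesis
  proof (rule that[of "q - r" "(f q - f r) / (q - r)"])
    fix x assume "r \<le> x" "x \<le> r + (q - r)"
    then show "f x = f r + (f q - f r) / (q - r) * (x - r)" by (intro l) auto
  qed (use q in auto)
qed

text \<open>A geodesic can bend only at an atom: if no mass is collected at \<open>r\<close>, cutting the corner by a chord
  is strictly cheaper.\<close>

lemma geodesic_smooth:
  assumes f: "geodesic f s t" and "s < r" "r < t" and m: "mass r (f r) = 0"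
  obtains d c where "d > 0" "s \<le> r - d" "r + d \<le> t" "\<And>x. \<bar>x - r\<bar> \<le> d \<Longrightarrow> f x = f r + c * (x - r)"
proof -
  obtain d1 c1 where 1: "d1 > 0" "s \<le> r - d1" "\<And>x. r - d1 \<le> x \<Longrightarrow> x \<le> r \<Longrightarrow> f x = f r + c1 * (x - r)"
    using geodesic_left[OF f assms(2) less_imp_le[OF assms(3)]] by blast
  obtain d2 c2 where 2: "d2 > 0" "r + d2 \<le> t" "\<And>x. r \<le> x \<Longrightarrow> x \<le> r + d2 \<Longrightarrow> f x = f r + c2 * (x - r)"
    using geodesic_right[OF f less_imp_le[OF assms(2)] assms(3)] by blast
  obtain d3 where 3: "d3 > 0" "\<And>q. \<bar>q - r\<bar> \<le> d3 \<Longrightarrow> q \<noteq> r \<Longrightarrow> q \<notin> atom_times"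
    using atom_gap[of r] by metis
  define d where "d = min d1 (min d2 d3)"
  have d: "d > 0" "d \<le> d1" "d \<le> d2" "d \<le> d3" using 1(1) 2(1) 3(1) by (auto simp: d_def)
  let ?u = "r - d" and ?v = "r + d"
  have "least_cost ?u (f ?u) ?v (f ?v) = least_cost ?u (f ?u) r (f r) + least_cost r (f r) ?v (f ?v)"
    using d 1(2) 2(2) by (intro geodesicD[OF f]) auto
  moreover have "least_cost ?u (f ?u) r (f r) = (f r - f ?u)\<^sup>2 / (2 * (r - ?u)) - mass ?u (f ?u)"
    using d by (intro least_cost_free 3(2)) auto
  moreover have "least_cost r (f r) ?v (f ?v) = (f ?v - f r)\<^sup>2 / (2 * (?v - r)) - mass r (f r)"
    using d by (intro least_cost_free 3(2)) auto
  moreover have "least_cost ?u (f ?u) ?v (f ?v) \<le> (f ?v - f ?u)\<^sup>2 / (2 * (?v - ?u)) - mass ?u (f ?u)"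
    using d by (intro least_cost_le_parabola) auto
  ultimately have "(f r - f ?u)\<^sup>2 / (2 * (r - ?u)) + (f ?v - f r)\<^sup>2 / (2 * (?v - r)) \<le> (f ?v - f ?u)\<^sup>2 / (2 * (?v - ?u))"
    using m by linarith
  then have "f r = f ?u + (f ?v - f ?u) * (r - ?u) / (?v - ?u)"
    using d by (intro parabola_aligned) auto
  moreover have "r - ?u = d" "?v - ?u = 2 * d" by simp_all
  ultimately have "f r = f ?u + (f ?v - f ?u) * d / (2 * d)" by (simp only:)
  also have "(f ?v - f ?u) * d / (2 * d) = (f ?v - f ?u) / 2" using d by simp
  finally have "f r = (f ?u + f ?v) / 2" by (simp add: field_simps)
  moreover have "f ?u = f r - c1 * d" "f ?v = f r + c2 * d" using 1(3)[of ?u] 2(3)[of ?v] d by simp_all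
  ultimately have "(c1 - c2) * d = 0" by (simp add: algebra_simps)
  then have c: "c1 = c2" using d by simp
  show ?thesis
  proof (rule that[of d c1])
    fix x assume x: "\<bar>x - r\<bar> \<le> d"
    show "f x = f r + c1 * (x - r)"
    proof (cases "x \<le> r")
      case True
      then show ?thesis using x d by (intro 1(3)) auto
    next
      case False
      then show ?thesis unfolding c using x d by (intro 2(3)) auto
    qed
  qed (use d 1(2) 2(2) in auto)
qed

text \<open>Geodesics between endpoints in opposite order meet; exchanging their tails there costs nothing.\<close>

lemma least_cost_exchange:
  assumes "s < t" "a \<le> a'" "b \<le> b'"
  shows "least_cost s a t b + least_cost s a' t b' \<le> least_cost s a t b' + least_cost s a' t b"
proof (cases "a = a' \<or> b = b'")
  case False
  then have less: "a < a'" "b < b'" using assms by auto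
  obtain f where f: "geodesic f s t" "f s = a" "f t = b'" using geodesic_exists[OF assms(1)] by blast
  obtain g where g: "geodesic g s t" "g s = a'" "g t = b" using geodesic_exists[OF assms(1)] by blast
  obtain r where r: "s < r" "r \<le> t" "f r = g r"
    using first_meeting[OF geodesic_continuous[OF f(1)] geodesic_continuous[OF g(1)] assms(1)] f g less by auto
  have rt: "r < t" using r f g less by (cases "r = t") auto
  show ?thesis
    using geodesicD[OF f(1), of s r t] geodesicD[OF g(1), of s r t] r rt f g
      least_cost_triangle[OF r(1) rt, of a b "f r"] least_cost_triangle[OF r(1) rt, of a' b' "f r"] by simp
qed auto

text \<open>The kinetic energy of the last piece is bounded by that of the straight competitor and the mass
  available in the strip, which gives a Hoelder bound with exponent 1/2.\<close>

lemma geodesic_oscillation: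
  assumes f: "geodesic f s t" and "s < r" "r < t"
  shows "(f t - f r)\<^sup>2 \<le> 2 * (t - r) * ((f t - f s)\<^sup>2 / (2 * (t - s)) + 2 * strip_mass s t)"
proof -
  have "(f t - f r)\<^sup>2 / (2 * (t - r)) - strip_mass r t \<le> least_cost r (f r) t (f t)"
    using assms by (intro least_cost_lower)
  moreover have "(f r - f s)\<^sup>2 / (2 * (r - s)) - strip_mass s r \<le> least_cost s (f s) r (f r)"
    using assms by (intro least_cost_lower)
  moreover have "0 \<le> (f r - f s)\<^sup>2 / (2 * (r - s))" using assms by simp
  moreover have "least_cost s (f s) t (f t) = least_cost s (f s) r (f r) + least_cost r (f r) t (f t)"
    using assms by (intro geodesicD[OF f]) auto
  moreover have "least_cost s (f s) t (f t) \<le> (f t - f s)\<^sup>2 / (2 * (t - s)) - mass s (f s)"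
    using assms by (intro least_cost_le_parabola) auto
  moreover have "mass s (f s) \<ge> 0" by simp
  moreover have "strip_mass s r \<le> strip_mass s t" "strip_mass r t \<le> strip_mass s t"
    using assms by (auto intro!: strip_mass_mono)
  ultimately have "(f t - f r)\<^sup>2 / (2 * (t - r)) \<le> (f t - f s)\<^sup>2 / (2 * (t - s)) + 2 * strip_mass s t"
    by linarith
  then show ?thesis using assms by (simp add: pos_divide_le_eq mult.commute)
qed

text \<open>A detour of at most half a turn to a sufficiently heavy isolated atom always pays.\<close>

lemma geodesic_bottleneck:
  assumes f: "geodesic f s t" and "M > 0" "s \<le> r - M" "r + M \<le> t"
    and iso: "msupp \<mu> \<inter> ({r - M..r + M} \<times> UNIV) = {(r, y)}" and heavy: "measure \<mu> {(r, y)} > 1 / (4 * M)"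
  shows "proj (f r) = y"
proof (rule ccontr)
  assume ne: "proj (f r) \<noteq> y"
  let ?u = "r - M" and ?v = "r + M"
  have free: "q \<notin> atom_times" if "q \<noteq> r" "?u \<le> q" "q \<le> ?v" for q
  proof
    assume "q \<in> atom_times"
    then obtain x where "(q, x) \<in> msupp \<mu>" by (auto simp: atom_times_def)
    then have "(q, x) \<in> msupp \<mu> \<inter> ({r - M..r + M} \<times> UNIV)" using that by auto
    then show False using iso that by auto
  qed
  have K1: "least_cost ?u a r b = (b - a)\<^sup>2 / (2 * M)" for a b
  proof -
    have "least_cost ?u a r b = (b - a)\<^sup>2 / (2 * (r - ?u)) - mass ?u a"
      using \<open>M > 0\<close> by (intro least_cost_free free) auto
    moreover have "mass ?u a = 0" using \<open>M > 0\<close> by (intro mass_0 free) auto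
    ultimately show ?thesis by simp
  qed
  have K2: "least_cost r a ?v b = (b - a)\<^sup>2 / (2 * M) - mass r a" for a b
  proof -
    have "least_cost r a ?v b = (b - a)\<^sup>2 / (2 * (?v - r)) - mass r a"
      using \<open>M > 0\<close> by (intro least_cost_free free) auto
    then show ?thesis by simp
  qed
  have m0: "mass r (f r) = 0"
    using ne iso \<open>M > 0\<close> unfolding mass_eq_0_iff by auto
  define a b where "a = f ?u" and "b = f ?v"
  have geo: "least_cost ?u a ?v b = (f r - a)\<^sup>2 / (2 * M) + (b - f r)\<^sup>2 / (2 * M)"
    using geodesicD[OF f, of ?u r ?v] assms K1 K2 m0 by (simp add: a_def b_def)
  have mid: "(f r - a)\<^sup>2 / (2 * M) + (b - f r)\<^sup>2 / (2 * M) \<ge> (b - a)\<^sup>2 / (4 * M)"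
  proof -
    have "(f r - a)\<^sup>2 + (b - f r)\<^sup>2 - (b - a)\<^sup>2 / 2 = 2 * (f r - (a + b) / 2)\<^sup>2"
      by (simp add: power2_eq_square field_simps)
    then have "(b - a)\<^sup>2 / 2 \<le> (f r - a)\<^sup>2 + (b - f r)\<^sup>2" by (smt (verit) zero_le_power2)
    then have "(b - a)\<^sup>2 / 2 / (2 * M) \<le> ((f r - a)\<^sup>2 + (b - f r)\<^sup>2) / (2 * M)"
      using \<open>M > 0\<close> by (intro divide_right_mono) auto
    then show ?thesis by (simp add: add_divide_distrib)
  qed
  obtain c where c: "y = proj c" using proj_surj by blast
  \<comment> \<open>the lift of \<open>y\<close> closest to the midpoint of the straight path\<close>
  define z where "z = c - of_int (round (c - (a + b) / 2))"
  define e where "e = z - (a + b) / 2"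
  have e: "\<bar>e\<bar> \<le> 1 / 2"
  proof -
    define q where "q = c - (a + b) / 2"
    have "e = q - of_int (round q)" by (simp add: e_def z_def q_def)
    then show ?thesis using of_int_round_abs_le[of q] by (simp add: abs_minus_commute)
  qed
  have "e\<^sup>2 \<le> (1 / 2)\<^sup>2" using power_mono[OF e, of 2] by simp
  then have e2: "e\<^sup>2 / M \<le> 1 / (4 * M)"
    using divide_right_mono[of "e\<^sup>2" "(1 / 2)\<^sup>2" M] \<open>M > 0\<close> by (simp add: power2_eq_square)
  have "mass r z > 1 / (4 * M)" using heavy by (simp add: mass_def z_def c)
  moreover have "(z - a)\<^sup>2 / (2 * M) + (b - z)\<^sup>2 / (2 * M) = (b - a)\<^sup>2 / (4 * M) + e\<^sup>2 / M"
    using \<open>M > 0\<close> by (simp add: e_def power2_eq_square field_simps)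
  moreover have "least_cost ?u a ?v b \<le> least_cost ?u a r z + least_cost r z ?v b"
    using \<open>M > 0\<close> by (intro least_cost_triangle) auto
  ultimately show False using K1[of a z] K2[of z b] geo mid e2 by linarith
qed

end

section \<open>One-sided minimizers and their lifts\<close>

lemma weak_deriv_on_cong:
  "(\<And>r. r \<in> {s..t} \<Longrightarrow> X r = Y r) \<Longrightarrow> weak_deriv_on X g s t \<longleftrightarrow> weak_deriv_on Y g s t"
  by (simp add: weak_deriv_on_def)

lemma left_deriv_linear:
  assumes d: "d > 0" and X: "\<And>x. t - d \<le> x \<Longrightarrow> x \<le> t \<Longrightarrow> X x = proj (z + c * (x - t))"
  shows "left_deriv X t = c"
  unfolding left_deriv_def
proof (rule the_equality)
  let ?l = "\<lambda>x. z + c * (x - t)"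
  have ev: "\<forall>\<^sub>F r in at_left t. X r = proj (?l r)"
    using d by (auto simp: eventually_at_left_field intro!: exI[of _ "t - d"] X)
  have l: "(?l has_real_derivative c) (at_left t)"
    by (auto intro!: derivative_eq_intros)
  show "has_torus_derivative X c (at_left t) t"
    unfolding has_torus_derivative_def using ev l X[of t] d by (intro exI[of _ ?l]) auto
  fix D assume "has_torus_derivative X D (at_left t) t"
  then obtain f where f: "(f has_real_derivative D) (at_left t)" "X t = proj (f t)"
    "\<forall>\<^sub>F r in at_left t. X r = proj (f r)"
    by (auto simp: has_torus_derivative_def)
  define h where "h = (\<lambda>r. f r - ?l r)"
  have h: "(h has_real_derivative D - c) (at_left t)"
    unfolding h_def by (intro DERIV_diff f l)
  have ht: "h t \<in> \<int>" using f(2) X[of t] d by (simp add: h_def proj_eq_iff[symmetric])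
  have "(h \<longlongrightarrow> h t) (at_left t)"
    using DERIV_continuous[OF h] by (simp add: continuous_within)
  then have "\<forall>\<^sub>F r in at_left t. dist (h r) (h t) < 1" by (rule tendstoD) simp
  then have c: "\<forall>\<^sub>F r in at_left t. h r = h t"
    using f(3) ev
  proof eventually_elim
    case (elim r)
    then have "h r \<in> \<int>" by (simp add: h_def proj_eq_iff[symmetric])
    then have "h r - h t \<in> \<int>" using ht by simp
    then show "h r = h t" using elim(1) Ints_nonzero_abs_ge1[of "h r - h t"] by (auto simp: dist_real_def)
  qed
  have "((\<lambda>r. (h r - h t) / (r - t)) \<longlongrightarrow> D - c) (at_left t)"
    using h by (simp add: has_field_derivative_iff)
  moreover have "\<forall>\<^sub>F r in at_left t. (h r - h t) / (r - t) = 0"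
    using c by eventually_elim simp
  ultimately have "((\<lambda>r. 0) \<longlongrightarrow> D - c) (at_left t)"
    by (rule Lim_transform_eventually)
  then have "D - c = 0" using tendsto_unique[OF _ _ tendsto_const] trivial_limit_at_left_real by blast
  then show "D = c" by simp
qed

context environment
begin

lemma H1_lift_exists:
  assumes "\<exists>g. weak_deriv_on X g s t"
  obtains a where "sq_int (wderiv s t X) s t" "\<And>r. r \<in> {s..t} \<Longrightarrow> X r = proj (path_from (wderiv s t X) s a r)"
proof -
  have "weak_deriv_on X (wderiv s t X) s t" unfolding wderiv_def using assms by (rule someI_ex)
  then show ?thesis using that unfolding weak_deriv_on_iff path_from_def by blast
qed

lemma lift_path_from:
  assumes X: "\<exists>g. weak_deriv_on X g s t" and f: "continuous_on {s..t} f" "\<And>r. r \<in> {s..t} \<Longrightarrow> X r = proj (f r)"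
    and "s \<le> t"
  shows "sq_int (wderiv s t X) s t" "\<And>r. r \<in> {s..t} \<Longrightarrow> path_from (wderiv s t X) s (f s) r = f r"
proof -
  obtain a where a: "sq_int (wderiv s t X) s t" "\<And>r. r \<in> {s..t} \<Longrightarrow> X r = proj (path_from (wderiv s t X) s a r)"
    using H1_lift_exists[OF X] by blast
  show "sq_int (wderiv s t X) s t" by (rule a)
  fix r assume r: "r \<in> {s..t}"
  have "path_from (wderiv s t X) s a r - f r = path_from (wderiv s t X) s a s - f s"
    using r \<open>s \<le> t\<close> a f
    by (intro lift_unique[of "{s..t}"] path_from_continuous) auto
  then show "path_from (wderiv s t X) s (f s) r = f r" by (simp add: path_from_def)
qed

lemma displacement_lift:
  assumes "\<exists>g. weak_deriv_on X g s t" "continuous_on {s..t} f" "\<And>r. r \<in> {s..t} \<Longrightarrow> X r = proj (f r)" "s \<le> t"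
  shows "displacement X s t = f t - f s"
  using lift_path_from(2)[OF assms, of t] \<open>s \<le> t\<close> by (simp add: displacement_def path_from_def)

lemma displacement_self [simp]: "displacement X t t = 0"
  by (simp add: displacement_def)

lemma action_lift:
  assumes X: "\<exists>g. weak_deriv_on X g s t" and f: "continuous_on {s..t} f" "\<And>r. r \<in> {s..t} \<Longrightarrow> X r = proj (f r)"
    and "s < t"
  shows "action \<mu> \<theta> s t X = cost (wderiv s t X) s (f s) t - \<theta> * (f t - f s) + \<theta>\<^sup>2 * (t - s) / 2"
proof -
  note l = lift_path_from[OF X f less_imp_le[OF \<open>s < t\<close>]]
  have 1: "graph_mass (\<lambda>r. proj (path_from (wderiv s t X) s (f s) r)) s t = graph_mass X s t"
    using l(2) f(2) by (intro graph_mass_cong) auto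
  have 2: "(LBINT q:{s..t}. wderiv s t X q) = f t - f s"
    using l(2)[of t] \<open>s < t\<close> by (simp add: path_from_def)
  have 3: "(LBINT r:{s..t}. (wderiv s t X r - \<theta>)\<^sup>2)
      = (LBINT r:{s..t}. (wderiv s t X r)\<^sup>2) - 2 * \<theta> * (LBINT r:{s..t}. wderiv s t X r) + \<theta>\<^sup>2 * (t - s)"
    by (rule LBINT_sq_diff) (use l(1) \<open>s < t\<close> in auto)
  show ?thesis
    unfolding action_def graph_mass_def[symmetric] cost_def 1 3 2
    by (simp add: algebra_simps add_divide_distrib diff_divide_distrib)
qed

lemma geodesic_weak_deriv:
  assumes "geodesic f s t" "s < t" "\<And>r. r \<in> {s..t} \<Longrightarrow> X r = proj (f r)"
  shows "\<exists>g. weak_deriv_on X g s t"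
proof -
  obtain g where "sq_int g s t" "\<forall>x\<in>{s..t}. path_from g s (f s) x = f x"
    using geodesic_minimizer[OF assms(2,1)] by blast
  then have "weak_deriv_on X g s t"
    unfolding weak_deriv_on_iff using assms(3) by (auto simp: path_from_def intro!: exI[of _ "f s"])
  then show ?thesis by blast
qed

lemma action_geodesic:
  assumes f: "geodesic f s t" and "s < t" and X: "\<And>r. r \<in> {s..t} \<Longrightarrow> X r = proj (f r)"
  shows "action \<mu> \<theta> s t X = least_cost s (f s) t (f t) - \<theta> * (f t - f s) + \<theta>\<^sup>2 * (t - s) / 2"
proof -
  obtain g where g: "sq_int g s t" "\<forall>x\<in>{s..t}. path_from g s (f s) x = f x" "cost g s (f s) t = least_cost s (f s) t (f t)"
    using geodesic_minimizer[OF assms(2,1)] by blast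
  note w = geodesic_weak_deriv[OF f \<open>s < t\<close> X] and c = geodesic_continuous[OF f]
  note l = lift_path_from[OF w c X less_imp_le[OF \<open>s < t\<close>]]
  have eq: "path_from (wderiv s t X) s (f s) r = path_from g s (f s) r" if "r \<in> {s..t}" for r
    using l(2) g(2) that by simp
  have "(LBINT q:{s..t}. (wderiv s t X q)\<^sup>2) = (LBINT q:{s..t}. (g q)\<^sup>2)"
    by (rule LBINT_sq_unique[OF l(1) g(1)]) (use eq in \<open>auto simp: path_from_def\<close>)
  moreover have "graph_mass (\<lambda>r. proj (path_from (wderiv s t X) s (f s) r)) s t
      = graph_mass (\<lambda>r. proj (path_from g s (f s) r)) s t"
    using eq by (intro graph_mass_cong) auto
  ultimately have "cost (wderiv s t X) s (f s) t = least_cost s (f s) t (f t)"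
    using g(3) by (simp add: cost_def)
  then show ?thesis using action_lift[OF w c X \<open>s < t\<close>] by simp
qed

text \<open>In the cover, a competitor of \<open>f\<close> on the torus with the same endpoints starts at
  \<open>f s + k\<close> for an integer \<open>k\<close>; the term \<open>\<theta> k\<close> is the change of the drift contribution.\<close>

definition torus_min :: "real \<Rightarrow> (real \<Rightarrow> real) \<Rightarrow> real \<Rightarrow> real \<Rightarrow> bool"
  where "torus_min \<theta> f s t \<longleftrightarrow> geodesic f s t \<and>
    (\<forall>k::int. least_cost s (f s) t (f t) \<le> least_cost s (f s + of_int k) t (f t) + \<theta> * of_int k)"

text \<open>The lifts of one-sided minimizers.\<close>

definition half_min :: "real \<Rightarrow> (real \<Rightarrow> real) \<Rightarrow> real \<Rightarrow> bool"
  where "half_min \<theta> f t \<longleftrightarrow> (\<forall>s<t. torus_min \<theta> f s t)"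

lemma torus_min_geodesic: "torus_min \<theta> f s t \<Longrightarrow> geodesic f s t"
  by (simp add: torus_min_def)

lemma torus_min_class: "torus_min \<theta> f s t \<Longrightarrow> least_cost s (f s) t (f t) \<le> least_cost s (f s + of_int k) t (f t) + \<theta> * of_int k"
  by (simp add: torus_min_def)

lemma torus_min_cong: assumes "\<And>x. x \<in> {s..t} \<Longrightarrow> f x = g x" "s \<le> t" shows "torus_min \<theta> f s t \<longleftrightarrow> torus_min \<theta> g s t"
proof -
  have "f s = g s" "f t = g t" using assms by auto
  then show ?thesis using geodesic_cong[of s t f g] assms(1) by (simp add: torus_min_def)
qed

lemma torus_min_iff_minimizer:
  assumes "s < t" and f: "continuous_on {s..t} f" and X: "\<And>r. r \<in> {s..t} \<Longrightarrow> X r = proj (f r)"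
  shows "restrict X {s..t} \<in> minimizers \<mu> \<theta> s (X s) t (X t) \<longleftrightarrow> torus_min \<theta> f s t"
proof
  assume t: "torus_min \<theta> f s t"
  let ?Y = "restrict X {s..t}"
  have Y: "?Y r = proj (f r)" if "r \<in> {s..t}" for r using X that by simp
  note g = torus_min_geodesic[OF t]
  have "\<exists>g. weak_deriv_on ?Y g s t" by (rule geodesic_weak_deriv[OF g \<open>s < t\<close> Y])
  then have "?Y \<in> H1 s t" unfolding H1_def using restrict_extensional by blast
  moreover have "action \<mu> \<theta> s t ?Y \<le> action \<mu> \<theta> s t Z" if Z: "Z \<in> H1 s t" "Z s = X s" "Z t = X t" for Z
  proof -
    have w: "\<exists>g. weak_deriv_on Z g s t" using Z(1) by (simp add: H1_def)
    obtain a where a: "sq_int (wderiv s t Z) s t" "\<And>r. r \<in> {s..t} \<Longrightarrow> Z r = proj (path_from (wderiv s t Z) s a r)"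
      using H1_lift_exists[OF w] by blast
    let ?h = "path_from (wderiv s t Z) s a"
    have st: "s \<in> {s..t}" "t \<in> {s..t}" using \<open>s < t\<close> by auto
    have "proj (?h s) = proj (f s)" "proj (?h t) = proj (f t)"
      using Z a(2) X st by metis+
    then obtain k j :: int where kj: "?h s = f s + of_int k" "?h t = f t + of_int j"
      using proj_eqE by metis
    have "least_cost s (f s) t (f t) \<le> least_cost s (f s + of_int (k - j)) t (f t) + \<theta> * of_int (k - j)"
      by (rule torus_min_class[OF t])
    also have "least_cost s (f s + of_int (k - j)) t (f t) = least_cost s (f s + of_int (k - j) + of_int j) t (f t + of_int j)"
      by (simp only: least_cost_shift)
    also have "\<dots> = least_cost s (?h s) t (?h t)" using kj by simp
    also have "\<dots> \<le> cost (wderiv s t Z) s (?h s) t"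
      using \<open>s < t\<close> by (intro least_cost_le a) auto
    finally have "least_cost s (f s) t (f t) \<le> cost (wderiv s t Z) s (?h s) t + \<theta> * of_int (k - j)" by simp
    moreover have "?h t - ?h s = f t - f s - of_int (k - j)" using kj by simp
    moreover have "action \<mu> \<theta> s t ?Y = least_cost s (f s) t (f t) - \<theta> * (f t - f s) + \<theta>\<^sup>2 * (t - s) / 2"
      by (rule action_geodesic[OF g \<open>s < t\<close> Y])
    moreover have "action \<mu> \<theta> s t Z
        = cost (wderiv s t Z) s (?h s) t - \<theta> * (?h t - ?h s) + \<theta>\<^sup>2 * (t - s) / 2"
      by (rule action_lift[OF w path_from_continuous[OF a(1)] a(2) \<open>s < t\<close>])
    ultimately show ?thesis by (simp only: right_diff_distrib)
  qed
  ultimately show "?Y \<in> minimizers \<mu> \<theta> s (X s) t (X t)"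
    using \<open>s < t\<close> by (auto simp: minimizers_def)
next
  let ?Y = "restrict X {s..t}"
  assume m: "?Y \<in> minimizers \<mu> \<theta> s (X s) t (X t)"
  have Y: "?Y r = proj (f r)" if "r \<in> {s..t}" for r using X that by simp
  have w: "\<exists>g. weak_deriv_on ?Y g s t" using m by (simp add: minimizers_def H1_def)
  note l = lift_path_from[OF w f Y less_imp_le[OF \<open>s < t\<close>]]
  let ?g = "wderiv s t ?Y"
  have le: "cost ?g s (f s) t \<le> least_cost s (f s + of_int k) t (f t) + \<theta> * of_int k" for k :: int
  proof -
    obtain h where h: "geodesic h s t" "h s = f s + of_int k" "h t = f t"
      using geodesic_exists[OF \<open>s < t\<close>] by blast
    let ?Z = "restrict (\<lambda>r. proj (h r)) {s..t}"
    have Z: "?Z r = proj (h r)" if "r \<in> {s..t}" for r using that by simp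
    have "\<exists>g. weak_deriv_on ?Z g s t" by (rule geodesic_weak_deriv[OF h(1) \<open>s < t\<close> Z])
    then have "?Z \<in> H1 s t" unfolding H1_def using restrict_extensional by blast
    moreover have "?Z s = X s" "?Z t = X t" using h X \<open>s < t\<close> by auto
    ultimately have "action \<mu> \<theta> s t ?Y \<le> action \<mu> \<theta> s t ?Z"
      using m by (simp add: minimizers_def)
    moreover have "action \<mu> \<theta> s t ?Y
        = cost ?g s (f s) t - \<theta> * (f t - f s) + \<theta>\<^sup>2 * (t - s) / 2"
      by (rule action_lift[OF w f Y \<open>s < t\<close>])
    moreover have "action \<mu> \<theta> s t ?Z = least_cost s (h s) t (h t) - \<theta> * (h t - h s) + \<theta>\<^sup>2 * (t - s) / 2"
      by (rule action_geodesic[OF h(1) \<open>s < t\<close> Z])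
    ultimately show ?thesis unfolding h(2,3) by (simp only: algebra_simps)
  qed
  have l2: "path_from ?g s (f s) r = f r" if "r \<in> {s..t}" for r
    by (rule lift_path_from(2)[OF w f Y less_imp_le[OF \<open>s < t\<close>] that])
  have pt: "path_from ?g s (f s) t = f t" by (rule l2) (use \<open>s < t\<close> in simp)
  have sq: "sq_int ?g s t" by (rule lift_path_from(1)[OF w f Y less_imp_le[OF \<open>s < t\<close>]])
  have "least_cost s (f s) t (f t) \<le> cost ?g s (f s) t" by (rule least_cost_le[OF sq \<open>s < t\<close> pt])
  moreover have "cost ?g s (f s) t \<le> least_cost s (f s) t (path_from ?g s (f s) t)"
    unfolding pt using le[of 0] unfolding of_int_0 add_0_right mult_zero_right .
  then have "geodesic (path_from ?g s (f s)) s t" by (rule minimizer_geodesic[OF sq])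
  then have "geodesic f s t" using l2 geodesic_cong[of s t "path_from ?g s (f s)" f] by blast
  ultimately show "torus_min \<theta> f s t" unfolding torus_min_def using le by (meson order_trans)
qed

lemma half_min_geodesic: assumes "half_min \<theta> f t" shows "geodesic f s t"
proof (cases "s < t")
  case True
  then have "torus_min \<theta> f s t" using assms by (simp add: half_min_def)
  then show ?thesis by (rule torus_min_geodesic)
next
  case False
  then show ?thesis unfolding geodesic_def by linarith
qed

lemma half_min_shift: "half_min \<theta> (\<lambda>x. f x + of_int k) t \<longleftrightarrow> half_min \<theta> f t"
proof -
  have "least_cost s (a + of_int k + of_int j) t (b + of_int k) = least_cost s (a + of_int j) t b" for s a t b and j :: int
    using least_cost_shift[of s "a + of_int j" k t b] by (simp add: algebra_simps)
  then show ?thesis by (simp add: half_min_def torus_min_def geodesic_shift least_cost_shift)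
qed

text \<open>Fixing the lift at the endpoint \<open>t\<close> and going back by the displacement defines the lift on the whole
  half-line at once.\<close>

lemma half_minimizers_lift:
  assumes X: "X \<in> half_minimizers_at \<mu> \<theta> t (proj z)"
  obtains f where "half_min \<theta> f t" "f t = z" "X = restrict (\<lambda>r. proj (f r)) {..t}"
proof -
  define f where "f = (\<lambda>r. z - displacement X r t)"
  have loc: "X \<in> extensional {..t}" "\<And>s. s < t \<Longrightarrow> restrict X {s..t} \<in> H1 s t" and Xt: "X t = proj z"
    and min: "\<And>s. s < t \<Longrightarrow> restrict X {s..t} \<in> minimizers \<mu> \<theta> s (X s) t (X t)"
    using X by (auto simp: half_minimizers_at_def half_minimizers_def H1_loc_def)
  have w: "\<exists>g. weak_deriv_on X g s t" if "s < t" for s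
    using loc(2)[OF that] weak_deriv_on_cong[of s t "restrict X {s..t}" X] by (auto simp: H1_def)
  have main: "continuous_on {s..t} f \<and> (\<forall>r\<in>{s..t}. X r = proj (f r))" if s: "s < t" for s
  proof -
    obtain a where a: "sq_int (wderiv s t X) s t" "\<And>r. r \<in> {s..t} \<Longrightarrow> X r = proj (path_from (wderiv s t X) s a r)"
      using H1_lift_exists[OF w[OF s]] by blast
    let ?p = "path_from (wderiv s t X) s a"
    have c: "continuous_on {s..t} ?p" using a by (intro path_from_continuous)
    have "proj (?p t) = proj z" using a(2)[of t] Xt s by simp
    then obtain j :: int where j: "?p t = z + of_int j" using proj_eqE by metis
    have d: "displacement X r t = ?p t - ?p r" if r: "r \<in> {s..t}" for r
    proof (cases "r = t")
      case False
      then have "r < t" using r by simp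
      then show ?thesis using r a(2)
        by (intro displacement_lift w) (auto intro: continuous_on_subset[OF c])
    qed simp
    have f: "f r = ?p r - of_int j" if "r \<in> {s..t}" for r using d[OF that] j by (simp add: f_def)
    have "continuous_on {s..t} (\<lambda>r. ?p r - of_int j)" using c by (intro continuous_intros)
    then have "continuous_on {s..t} f" by (rule continuous_on_eq) (simp add: f)
    then show ?thesis using f a(2) by simp
  qed
  have "torus_min \<theta> f s t" if "s < t" for s
    using torus_min_iff_minimizer[of s t f X \<theta>] main[OF that] min[OF that] that by simp
  then have "half_min \<theta> f t" by (simp add: half_min_def)
  moreover have "f t = z" by (simp add: f_def)
  moreover have "X = restrict (\<lambda>r. proj (f r)) {..t}"
  proof
    fix r show "X r = restrict (\<lambda>r. proj (f r)) {..t} r"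
    proof (cases "r \<le> t")
      case True
      then have "r \<in> {r - 1..t}" "r - 1 < t" by auto
      then show ?thesis using main[of "r - 1"] True by auto
    qed (use loc(1) in \<open>simp add: extensional_def\<close>)
  qed
  ultimately show ?thesis by (rule that)
qed

lemma half_min_in_half_minimizers_at:
  assumes f: "half_min \<theta> f t"
  shows "restrict (\<lambda>r. proj (f r)) {..t} \<in> half_minimizers_at \<mu> \<theta> t (proj (f t))"
proof -
  let ?X = "restrict (\<lambda>r. proj (f r)) {..t}"
  have "restrict ?X {s..t} \<in> minimizers \<mu> \<theta> s (?X s) t (?X t)" if "s < t" for s
    using f that torus_min_iff_minimizer[OF that geodesic_continuous[OF half_min_geodesic[OF f]], of ?X \<theta>]
    by (simp add: half_min_def)
  then show ?thesis
    by (simp add: half_minimizers_at_def half_minimizers_def H1_loc_def minimizers_def)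
qed

lemma displacement_half_min:
  assumes "half_min \<theta> f t" "r \<le> t"
  shows "displacement (restrict (\<lambda>r. proj (f r)) {..t}) r t = f t - f r"
proof (cases "r = t")
  case False
  then have "r < t" using assms by simp
  then show ?thesis using half_min_geodesic[OF assms(1), of r]
    by (intro displacement_lift geodesic_weak_deriv[of f] geodesic_continuous) auto
qed simp

definition leftmost :: "real \<Rightarrow> (real \<Rightarrow> real) \<Rightarrow> real \<Rightarrow> bool"
  where "leftmost \<theta> f t \<longleftrightarrow> half_min \<theta> f t \<and> (\<forall>g. half_min \<theta> g t \<longrightarrow> g t = f t \<longrightarrow> (\<forall>r\<le>t. f r \<le> g r))"

definition rightmost :: "real \<Rightarrow> (real \<Rightarrow> real) \<Rightarrow> real \<Rightarrow> bool"
  where "rightmost \<theta> f t \<longleftrightarrow> half_min \<theta> f t \<and> (\<forall>g. half_min \<theta> g t \<longrightarrow> g t = f t \<longrightarrow> (\<forall>r\<le>t. g r \<le> f r))"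

lemma path_le_half_min:
  assumes "half_min \<theta> f t" "half_min \<theta> g t" "f t = g t"
  shows "path_le t (restrict (\<lambda>r. proj (f r)) {..t}) (restrict (\<lambda>r. proj (g r)) {..t}) \<longleftrightarrow> (\<forall>r\<le>t. f r \<le> g r)"
  using assms by (simp add: path_le_def displacement_half_min)

lemma the_least:
  assumes "X \<in> A" and least: "\<And>Y. Y \<in> A \<Longrightarrow> R X Y" and antisym: "\<And>Y. Y \<in> A \<Longrightarrow> R Y X \<Longrightarrow> Y = X"
  shows "(THE X. X \<in> A \<and> (\<forall>Y\<in>A. R Y X \<longrightarrow> Y = X)) = X"
proof (rule the_equality)
  show "X \<in> A \<and> (\<forall>Y\<in>A. R Y X \<longrightarrow> Y = X)" using assms by blast
  fix Y assume Y: "Y \<in> A \<and> (\<forall>Z\<in>A. R Z Y \<longrightarrow> Z = Y)"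
  then have "R X Y" using least by blast
  then show "Y = X" using Y assms(1) by blast
qed

lemma path_le_antisym:
  assumes f: "half_min \<theta> f t" and Y: "Y \<in> half_minimizers_at \<mu> \<theta> t (proj (f t))"
    and le: "path_le t (restrict (\<lambda>r. proj (f r)) {..t}) Y" "path_le t Y (restrict (\<lambda>r. proj (f r)) {..t})"
  shows "Y = restrict (\<lambda>r. proj (f r)) {..t}"
proof -
  obtain g where g: "half_min \<theta> g t" "g t = f t" "Y = restrict (\<lambda>r. proj (g r)) {..t}"
    using half_minimizers_lift[OF Y] by blast
  have "g r = f r" if "r \<le> t" for r
    using le that unfolding g(3) path_le_half_min[OF f g(1) g(2)[symmetric]] path_le_half_min[OF g(1) f g(2)]
    by (simp add: order_antisym)
  then show ?thesis unfolding g(3) by (intro restrict_ext) simp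
qed

lemma XL_eq:
  assumes f: "leftmost \<theta> f t"
  shows "XL \<mu> \<theta> t (proj (f t)) = restrict (\<lambda>r. proj (f r)) {..t}" (is "_ = ?X")
proof -
  have h: "half_min \<theta> f t" using f by (simp add: leftmost_def)
  have least: "path_le t ?X Y" if Y: "Y \<in> half_minimizers_at \<mu> \<theta> t (proj (f t))" for Y
  proof -
    obtain g where g: "half_min \<theta> g t" "g t = f t" "Y = restrict (\<lambda>r. proj (g r)) {..t}"
      using half_minimizers_lift[OF Y] by blast
    then show ?thesis using f unfolding g(3) path_le_half_min[OF h g(1) g(2)[symmetric]] by (simp add: leftmost_def)
  qed
  show ?thesis unfolding XL_def
    using half_min_in_half_minimizers_at[OF h] least path_le_antisym[OF h] by (intro the_least) auto
qed

lemma XR_eq: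
  assumes f: "rightmost \<theta> f t"
  shows "XR \<mu> \<theta> t (proj (f t)) = restrict (\<lambda>r. proj (f r)) {..t}" (is "_ = ?X")
proof -
  have h: "half_min \<theta> f t" using f by (simp add: rightmost_def)
  have greatest: "path_le t Y ?X" if Y: "Y \<in> half_minimizers_at \<mu> \<theta> t (proj (f t))" for Y
  proof -
    obtain g where g: "half_min \<theta> g t" "g t = f t" "Y = restrict (\<lambda>r. proj (g r)) {..t}"
      using half_minimizers_lift[OF Y] by blast
    then show ?thesis using f unfolding g(3) path_le_half_min[OF g(1) h g(2)] by (simp add: rightmost_def)
  qed
  show ?thesis unfolding XR_def
    using half_min_in_half_minimizers_at[OF h] greatest path_le_antisym[OF h]
    by (intro the_least[where R = "\<lambda>Y X. path_le t X Y"]) auto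
qed

text \<open>The last time interval without atoms is decisive: there both extremal lifts are linear, with slopes
  \<^const>\<open>uL\<close> and \<^const>\<open>uR\<close>.\<close>

lemma shock_iff:
  assumes f: "leftmost \<theta> f t" and g: "rightmost \<theta> g t" and eq: "f t = g t"
  shows "(\<theta>, t, proj (f t)) \<in> shocks \<mu> \<longleftrightarrow> (\<forall>d>0. \<exists>r. t - d \<le> r \<and> r \<le> t \<and> f r \<noteq> g r)"
    and "(\<theta>, t, proj (f t)) \<in> shocks \<mu> \<Longrightarrow> \<exists>d>0. \<forall>r. t - d \<le> r \<longrightarrow> r < t \<longrightarrow> f r < g r \<and> g r < f r + 1"
proof -
  have hf: "half_min \<theta> f t" and hg: "half_min \<theta> g t" and le: "\<And>r. r \<le> t \<Longrightarrow> f r \<le> g r"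
    using f g eq by (auto simp: leftmost_def rightmost_def)
  have t1: "t - 1 < t" by simp
  obtain d1 c1 where 1: "d1 > 0" "\<And>x. t - d1 \<le> x \<Longrightarrow> x \<le> t \<Longrightarrow> f x = f t + c1 * (x - t)"
    using geodesic_left[OF half_min_geodesic[OF hf] t1 order_refl] by blast
  obtain d2 c2 where 2: "d2 > 0" "\<And>x. t - d2 \<le> x \<Longrightarrow> x \<le> t \<Longrightarrow> g x = g t + c2 * (x - t)"
    using geodesic_left[OF half_min_geodesic[OF hg] t1 order_refl] by blast
  have "uL \<mu> \<theta> t (proj (f t)) = c1"
    unfolding uL_def XL_eq[OF f]
  proof (rule left_deriv_linear[OF 1(1), where z = "f t"])
    fix x assume "t - d1 \<le> x" "x \<le> t"
    from 1(2)[OF this] this(2) show "restrict (\<lambda>r. proj (f r)) {..t} x = proj (f t + c1 * (x - t))"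
      by simp
  qed
  moreover have "uR \<mu> \<theta> t (proj (f t)) = c2"
    unfolding uR_def eq XR_eq[OF g]
  proof (rule left_deriv_linear[OF 2(1), where z = "g t"])
    fix x assume "t - d2 \<le> x" "x \<le> t"
    from 2(2)[OF this] this(2) show "restrict (\<lambda>r. proj (g r)) {..t} x = proj (g t + c2 * (x - t))"
      by simp
  qed
  ultimately have s: "(\<theta>, t, proj (f t)) \<in> shocks \<mu> \<longleftrightarrow> c1 > c2"
    by (simp add: shocks_def)
  define d where "d = min d1 d2"
  have d: "d > 0" using 1(1) 2(1) by (simp add: d_def)
  have diff: "g x - f x = (c1 - c2) * (t - x)" if "t - d \<le> x" "x \<le> t" for x
    using 1(2)[of x] 2(2)[of x] that eq by (simp add: d_def algebra_simps)
  have "c1 \<ge> c2"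
  proof -
    have "(c1 - c2) * d \<ge> 0" using diff[of "t - d"] le[of "t - d"] d by simp
    then show ?thesis using d by (simp add: zero_le_mult_iff)
  qed
  have near: "\<exists>d>0. \<forall>r. t - d \<le> r \<longrightarrow> r < t \<longrightarrow> f r < g r \<and> g r < f r + 1" if c: "c1 > c2"
  proof -
    define e where "e = min d (1 / (2 * (c1 - c2)))"
    have e: "e > 0" "e \<le> d" "(c1 - c2) * e < 1"
    proof -
      show "e > 0" "e \<le> d" using d c by (auto simp: e_def)
      have "(c1 - c2) * e \<le> (c1 - c2) * (1 / (2 * (c1 - c2)))"
        using c by (intro mult_left_mono) (auto simp: e_def)
      also have "\<dots> = 1 / 2" using c by simp
      finally show "(c1 - c2) * e < 1" by simp
    qed
    have "f r < g r \<and> g r < f r + 1" if "t - e \<le> r" "r < t" for r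
    proof -
      have "g r - f r = (c1 - c2) * (t - r)" using that e by (intro diff) auto
      moreover have "(c1 - c2) * (t - r) > 0" using that c by simp
      moreover have "(c1 - c2) * (t - r) \<le> (c1 - c2) * e" using that c by (intro mult_left_mono) auto
      ultimately show ?thesis using e(3) by linarith
    qed
    then show ?thesis using e(1) by blast
  qed
  show "\<exists>d>0. \<forall>r. t - d \<le> r \<longrightarrow> r < t \<longrightarrow> f r < g r \<and> g r < f r + 1" if "(\<theta>, t, proj (f t)) \<in> shocks \<mu>"
    using near s that by blast
  show "(\<theta>, t, proj (f t)) \<in> shocks \<mu> \<longleftrightarrow> (\<forall>d>0. \<exists>r. t - d \<le> r \<and> r \<le> t \<and> f r \<noteq> g r)"
  proof
    assume "(\<theta>, t, proj (f t)) \<in> shocks \<mu>"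
    then obtain e where e: "e > 0" "\<And>r. t - e \<le> r \<Longrightarrow> r < t \<Longrightarrow> f r < g r" using near s by blast
    show "\<forall>d>0. \<exists>r. t - d \<le> r \<and> r \<le> t \<and> f r \<noteq> g r"
    proof (intro allI impI)
      fix d' :: real assume "d' > 0"
      then show "\<exists>r. t - d' \<le> r \<and> r \<le> t \<and> f r \<noteq> g r"
        using e(1) e(2)[of "t - min d' e"] by (intro exI[of _ "t - min d' e"]) auto
    qed
  next
    assume "\<forall>d>0. \<exists>r. t - d \<le> r \<and> r \<le> t \<and> f r \<noteq> g r"
    then obtain r where r: "t - d \<le> r" "r \<le> t" "f r \<noteq> g r" using d by blast
    then have "(c1 - c2) * (t - r) \<noteq> 0" using diff[of r] by auto
    then have "c1 \<noteq> c2" by auto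
    then show "(\<theta>, t, proj (f t)) \<in> shocks \<mu>" using s \<open>c1 \<ge> c2\<close> by simp
  qed
qed

text \<open>Going back in time from a shock, the gap between the extremal lifts moves continuously inside
  \<open>(0, 1)\<close> until the paths meet on the torus. The shock is global if the gap is 1 at that moment, that
  is, if the gap has not returned to 0 first.\<close>

lemma global_shock_iff:
  assumes f: "leftmost \<theta> f t" and g: "rightmost \<theta> g t" and eq: "f t = g t"
    and meet: "\<exists>s<t. proj (f s) = proj (g s)"
  shows "(\<theta>, t, proj (f t)) \<in> GS \<mu> \<longleftrightarrow>
    (\<exists>T<t. proj (f T) = proj (g T) \<and> (\<forall>r. T \<le> r \<longrightarrow> r < t \<longrightarrow> f r < g r))" (is "_ \<longleftrightarrow> ?W")
    and "(\<theta>, t, proj (f t)) \<in> GS \<mu> \<Longrightarrow>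
    \<exists>T<t. g T = f T + 1 \<and> (\<forall>r. T < r \<longrightarrow> r < t \<longrightarrow> proj (f r) \<noteq> proj (g r)) \<and> (\<forall>r. T \<le> r \<longrightarrow> r < t \<longrightarrow> f r < g r)"
proof -
  have hf: "half_min \<theta> f t" and hg: "half_min \<theta> g t" and le: "\<And>r. r \<le> t \<Longrightarrow> f r \<le> g r"
    using f g eq by (auto simp: leftmost_def rightmost_def)
  define S where "S = {s. s < t \<and> proj (f s) = proj (g s)}"
  define V where "V = Sup S"
  note L = XL_eq[OF f]
  have R: "XR \<mu> \<theta> t (proj (f t)) = restrict (\<lambda>r. proj (g r)) {..t}" using XR_eq[OF g] eq by simp
  have "{s. s < t \<and> XL \<mu> \<theta> t (proj (f t)) s = XR \<mu> \<theta> t (proj (f t)) s} = S"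
    unfolding L R S_def by auto
  then have Tv: "T_vee \<mu> \<theta> t (proj (f t)) = V" by (simp add: T_vee_def V_def)
  have S: "S \<noteq> {}" "bdd_above S"
    using meet by (auto simp: S_def intro!: bdd_aboveI[where M = t])
  have Vt: "V \<le> t" unfolding V_def using S by (intro cSup_least) (auto simp: S_def)
  have "(\<theta>, t, proj (f t)) \<in> GS \<mu> \<longleftrightarrow> (\<theta>, t, proj (f t)) \<in> shocks \<mu> \<and>
      displacement (XL \<mu> \<theta> t (proj (f t))) (T_vee \<mu> \<theta> t (proj (f t))) t
        > displacement (XR \<mu> \<theta> t (proj (f t))) (T_vee \<mu> \<theta> t (proj (f t))) t"
    by (simp add: GS_def)
  then have G: "(\<theta>, t, proj (f t)) \<in> GS \<mu> \<longleftrightarrow> (\<theta>, t, proj (f t)) \<in> shocks \<mu> \<and> f V < g V"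
    unfolding L R Tv displacement_half_min[OF hf Vt] displacement_half_min[OF hg Vt] using eq by auto
  have VS: "V \<in> S" if sh: "(\<theta>, t, proj (f t)) \<in> shocks \<mu>"
  proof -
    obtain e where e: "e > 0" "\<And>r. t - e \<le> r \<Longrightarrow> r < t \<Longrightarrow> f r < g r \<and> g r < f r + 1"
      using shock_iff(2)[OF f g eq sh] by blast
    have Se: "s \<le> t - e" if "s \<in> S" for s
    proof (rule ccontr)
      assume "\<not> s \<le> t - e"
      then have "f s < g s \<and> g s < f s + 1" using that by (intro e(2)) (auto simp: S_def)
      moreover have "proj (g s) = proj (f s)" using that by (simp add: S_def)
      then obtain k :: int where "g s = f s + of_int k" by (rule proj_eqE)
      ultimately show False by auto
    qed
    obtain s0 where s0: "s0 \<in> S" using S by blast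
    have c: "continuous_on {s0..t} f" "continuous_on {s0..t} g"
      using hf hg by (auto intro!: geodesic_continuous half_min_geodesic)
    let ?S = "{r \<in> {s0..t - e}. (\<lambda>r. dist (proj (f r)) (proj (g r))) r = 0}"
    have "{s0..t - e} \<subseteq> {s0..t}" using e(1) by auto
    then have "closed ?S"
      using c by (intro continuous_closed_preimage_constant continuous_on_dist continuous_on_proj_comp)
        (auto intro: continuous_on_subset)
    moreover have "V = Sup ?S"
      unfolding V_def
    proof (rule antisym)
      show "Sup S \<le> Sup ?S"
      proof (rule cSup_least[OF S(1)])
        fix s assume s: "s \<in> S"
        have bd: "bdd_above ?S" by (auto intro!: bdd_aboveI[where M = "t - e"])
        have "max s s0 \<in> S" using s s0 by (auto simp: max_def)
        then have "max s s0 \<in> ?S" using Se[of "max s s0"] by (auto simp: S_def)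
        then have "max s s0 \<le> Sup ?S" using bd by (rule cSup_upper)
        then show "s \<le> Sup ?S" by simp
      qed
      have "s0 \<in> ?S" using Se[OF s0] s0 by (auto simp: S_def)
      then show "Sup ?S \<le> Sup S"
        using e(1) by (intro cSup_subset_mono S) (auto simp: S_def)
    qed
    moreover have "s0 \<in> ?S" using Se[OF s0] s0 by (auto simp: S_def)
    moreover have "bdd_above ?S" by (rule bdd_aboveI[where M = "t - e"]) auto
    ultimately have "V \<in> ?S" using closed_contains_Sup[of ?S] by blast
    then show ?thesis using e(1) by (auto simp: S_def)
  qed
  have up: "r \<notin> S" if "V < r" for r
    using that cSup_upper[OF _ S(2), of r] unfolding V_def by fastforce
  have pos: "f r < g r" if "f V < g V" "V \<le> r" "r < t" for r
  proof (cases "r = V")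
    case False
    then have "r \<notin> S" using that up by simp
    then have "f r \<noteq> g r" using that by (auto simp: S_def)
    then show ?thesis using le[of r] that by simp
  qed (use that in simp)
  show strong: "\<exists>T<t. g T = f T + 1 \<and> (\<forall>r. T < r \<longrightarrow> r < t \<longrightarrow> proj (f r) \<noteq> proj (g r)) \<and> (\<forall>r. T \<le> r \<longrightarrow> r < t \<longrightarrow> f r < g r)"
    if gs: "(\<theta>, t, proj (f t)) \<in> GS \<mu>"
  proof -
    have V: "V \<in> S" "f V < g V" using gs G VS by auto
    have "proj (g V) = proj (f V)" using V(1) by (simp add: S_def)
    then obtain k :: int where k: "g V = f V + of_int k" by (rule proj_eqE)
    have "k = 1"
    proof (rule ccontr)
      assume "k \<noteq> 1"
      then have "k \<ge> 2" using k V(2) by auto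
      then have g2: "g V - f V \<ge> 2" using k by simp
      have "continuous_on {V..t} (\<lambda>r. g r - f r)"
        using hf hg by (intro continuous_intros geodesic_continuous half_min_geodesic)
      then obtain r where r: "V \<le> r" "r \<le> t" "g r - f r = 1"
        using IVT2'[of "\<lambda>r. g r - f r" t 1 V] g2 eq Vt by auto
      then have "r \<noteq> V" "r \<noteq> t" using g2 eq by auto
      moreover have "proj (f r) = proj (g r)"
        using r(3) proj_shift1(1)[of "f r"] by (simp add: algebra_simps)
      ultimately have "r \<in> S" "V < r" using r by (auto simp: S_def)
      then show False using up by blast
    qed
    then show ?thesis using k pos[OF V(2)] V(1) up by (intro exI[of _ V]) (auto simp: S_def)
  qed
  show "(\<theta>, t, proj (f t)) \<in> GS \<mu> \<longleftrightarrow> ?W"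
  proof
    assume "(\<theta>, t, proj (f t)) \<in> GS \<mu>"
    then obtain T where "T < t" "g T = f T + 1" "\<And>r. T \<le> r \<Longrightarrow> r < t \<Longrightarrow> f r < g r" using strong by blast
    then show ?W by (intro exI[of _ T]) auto
  next
    assume ?W
    then obtain T where T: "T < t" "T \<in> S" "\<And>r. T \<le> r \<Longrightarrow> r < t \<Longrightarrow> f r < g r" by (auto simp: S_def)
    have sh: "(\<theta>, t, proj (f t)) \<in> shocks \<mu>"
      unfolding shock_iff(1)[OF f g eq]
    proof (intro allI impI)
      fix d :: real assume "d > 0"
      then show "\<exists>r. t - d \<le> r \<and> r \<le> t \<and> f r \<noteq> g r"
        using T(1) T(3)[of "max (t - d) T"] by (intro exI[of _ "max (t - d) T"]) auto
    qed
    have "T \<le> V" unfolding V_def using T(2) S(2) by (rule cSup_upper)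
    then have "f V < g V" using VS[OF sh] by (intro T(3)) (auto simp: S_def)
    then show "(\<theta>, t, proj (f t)) \<in> GS \<mu>" using G sh by blast
  qed
qed

end

section \<open>Generalized inverses of a monotone function\<close>

definition lower_inv :: "(real \<Rightarrow> real) \<Rightarrow> real \<Rightarrow> real"
  where "lower_inv D \<theta> = Inf {z. \<theta> \<le> D z}"

definition upper_inv :: "(real \<Rightarrow> real) \<Rightarrow> real \<Rightarrow> real"
  where "upper_inv D \<theta> = Sup {z. D z \<le> \<theta>}"

locale monotone_onto =
  fixes D :: "real \<Rightarrow> real"
  assumes mono: "x \<le> y \<Longrightarrow> D x \<le> D y"
    and cont: "continuous_on UNIV D"
    and unbounded: "\<exists>x. D x < c" "\<exists>x. c < D x"
begin

lemma lower_inv_le_iff: "lower_inv D \<theta> \<le> z \<longleftrightarrow> \<theta> \<le> D z"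
proof -
  let ?S = "{z. \<theta> \<le> D z}"
  obtain x where x: "\<theta> < D x" using unbounded by blast
  obtain y where y: "D y < \<theta>" using unbounded by blast
  have bdd: "bdd_below ?S"
  proof (rule bdd_belowI[of _ y])
    fix w assume w: "w \<in> ?S"
    show "y \<le> w" using mono[of w y] w y by force
  qed
  have "closed ?S" using closed_Collect_le[OF continuous_on_const cont] by simp
  then have "Inf ?S \<in> ?S" using x bdd by (intro closed_contains_Inf) (auto intro: less_imp_le)
  then have 1: "\<theta> \<le> D (lower_inv D \<theta>)" by (simp add: lower_inv_def)
  show ?thesis
  proof
    assume "lower_inv D \<theta> \<le> z"
    then show "\<theta> \<le> D z" using 1 mono order_trans by blast
  next
    assume "\<theta> \<le> D z"
    then show "lower_inv D \<theta> \<le> z" unfolding lower_inv_def using bdd by (intro cInf_lower) auto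
  qed
qed

lemma le_upper_inv_iff: "z \<le> upper_inv D \<theta> \<longleftrightarrow> D z \<le> \<theta>"
proof -
  let ?S = "{z. D z \<le> \<theta>}"
  obtain x where x: "\<theta> < D x" using unbounded by blast
  obtain y where y: "D y < \<theta>" using unbounded by blast
  have bdd: "bdd_above ?S"
  proof (rule bdd_aboveI[of _ x])
    fix w assume w: "w \<in> ?S"
    show "w \<le> x" using mono[of x w] w x by force
  qed
  have "closed ?S" using closed_Collect_le[OF cont continuous_on_const] by simp
  then have "Sup ?S \<in> ?S" using y bdd by (intro closed_contains_Sup) (auto intro: less_imp_le)
  then have 1: "D (upper_inv D \<theta>) \<le> \<theta>" by (simp add: upper_inv_def)
  show ?thesis
  proof
    assume "z \<le> upper_inv D \<theta>"
    then show "D z \<le> \<theta>" using 1 mono order_trans by blast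
  next
    assume "D z \<le> \<theta>"
    then show "z \<le> upper_inv D \<theta>" unfolding upper_inv_def using bdd by (intro cSup_upper) auto
  qed
qed

lemma lower_le_upper: "lower_inv D \<theta> \<le> upper_inv D \<theta>"
proof -
  obtain x where x: "\<theta> < D x" using unbounded by blast
  obtain y where y: "D y < \<theta>" using unbounded by blast
  have yx: "y \<le> x" using mono[of x y] x y by force
  obtain w where "D w = \<theta>"
    using IVT'[of D y \<theta> x] x y yx continuous_on_subset[OF cont] by auto
  then show ?thesis using lower_inv_le_iff[of \<theta> w] le_upper_inv_iff[of w \<theta>] by simp
qed

lemma between_iff: "lower_inv D \<theta> \<le> z \<and> z \<le> upper_inv D \<theta> \<longleftrightarrow> D z = \<theta>"
  using lower_inv_le_iff le_upper_inv_iff by (auto intro: antisym)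

lemma less_lower_inv_iff: "z < lower_inv D \<theta> \<longleftrightarrow> D z < \<theta>"
  using lower_inv_le_iff[of \<theta> z] by auto

lemma upper_inv_less_iff: "upper_inv D \<theta> < z \<longleftrightarrow> \<theta> < D z"
  using le_upper_inv_iff[of z \<theta>] by auto

lemma upper_inv_less_lower_inv: "\<theta>' < \<theta> \<Longrightarrow> upper_inv D \<theta>' < lower_inv D \<theta>"
  using between_iff[of \<theta>' "upper_inv D \<theta>'"] lower_le_upper[of \<theta>'] less_lower_inv_iff by simp

lemma inverses_tendsto_left:
  "(lower_inv D \<longlongrightarrow> lower_inv D \<theta>) (at_left \<theta>)" "(upper_inv D \<longlongrightarrow> lower_inv D \<theta>) (at_left \<theta>)"
proof -
  have ev: "\<forall>\<^sub>F \<theta>' in at_left \<theta>. l < lower_inv D \<theta>' \<and> upper_inv D \<theta>' < lower_inv D \<theta>"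
    if "l < lower_inv D \<theta>" for l
  proof -
    have "D l < \<theta>" using that less_lower_inv_iff by simp
    then have "\<forall>\<^sub>F \<theta>' in at_left \<theta>. D l < \<theta>' \<and> \<theta>' < \<theta>"
      by (auto simp: eventually_at_left_field)
    then show ?thesis by eventually_elim (metis less_lower_inv_iff upper_inv_less_lower_inv)
  qed
  show "(lower_inv D \<longlongrightarrow> lower_inv D \<theta>) (at_left \<theta>)"
  proof (rule order_tendstoI)
    fix l assume "l < lower_inv D \<theta>"
    from ev[OF this] show "\<forall>\<^sub>F \<theta>' in at_left \<theta>. l < lower_inv D \<theta>'" by eventually_elim simp
  next
    fix u assume u: "lower_inv D \<theta> < u"
    from ev[of "lower_inv D \<theta> - 1"] show "\<forall>\<^sub>F \<theta>' in at_left \<theta>. lower_inv D \<theta>' < u"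
      using u lower_le_upper by (auto elim!: eventually_mono intro: le_less_trans less_trans)
  qed
  show "(upper_inv D \<longlongrightarrow> lower_inv D \<theta>) (at_left \<theta>)"
  proof (rule order_tendstoI)
    fix l assume "l < lower_inv D \<theta>"
    from ev[OF this] show "\<forall>\<^sub>F \<theta>' in at_left \<theta>. l < upper_inv D \<theta>'"
      using lower_le_upper by (auto elim!: eventually_mono intro: less_le_trans)
  next
    fix u assume u: "lower_inv D \<theta> < u"
    from ev[of "lower_inv D \<theta> - 1"] show "\<forall>\<^sub>F \<theta>' in at_left \<theta>. upper_inv D \<theta>' < u"
      using u by (auto elim!: eventually_mono intro: less_trans)
  qed
qed

lemma inverses_tendsto_right:
  "(lower_inv D \<longlongrightarrow> upper_inv D \<theta>) (at_right \<theta>)" "(upper_inv D \<longlongrightarrow> upper_inv D \<theta>) (at_right \<theta>)"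
proof -
  have ev: "\<forall>\<^sub>F \<theta>' in at_right \<theta>. upper_inv D \<theta>' < u \<and> upper_inv D \<theta> < lower_inv D \<theta>'"
    if "upper_inv D \<theta> < u" for u
  proof -
    have "\<theta> < D u" using that upper_inv_less_iff by simp
    then have "\<forall>\<^sub>F \<theta>' in at_right \<theta>. \<theta>' < D u \<and> \<theta> < \<theta>'"
      by (auto simp: eventually_at_right_field)
    then show ?thesis by eventually_elim (metis upper_inv_less_iff upper_inv_less_lower_inv)
  qed
  show "(lower_inv D \<longlongrightarrow> upper_inv D \<theta>) (at_right \<theta>)"
  proof (rule order_tendstoI)
    fix u assume "upper_inv D \<theta> < u"
    from ev[OF this] show "\<forall>\<^sub>F \<theta>' in at_right \<theta>. lower_inv D \<theta>' < u"
      using lower_le_upper by (auto elim!: eventually_mono intro: le_less_trans)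
  next
    fix l assume l: "l < upper_inv D \<theta>"
    from ev[of "upper_inv D \<theta> + 1"] show "\<forall>\<^sub>F \<theta>' in at_right \<theta>. l < lower_inv D \<theta>'"
      using l by (auto elim!: eventually_mono intro: less_trans)
  qed
  show "(upper_inv D \<longlongrightarrow> upper_inv D \<theta>) (at_right \<theta>)"
  proof (rule order_tendstoI)
    fix u assume "upper_inv D \<theta> < u"
    from ev[OF this] show "\<forall>\<^sub>F \<theta>' in at_right \<theta>. upper_inv D \<theta>' < u" by eventually_elim simp
  next
    fix l assume l: "l < upper_inv D \<theta>"
    from ev[of "upper_inv D \<theta> + 1"] show "\<forall>\<^sub>F \<theta>' in at_right \<theta>. l < upper_inv D \<theta>'"
      using l lower_le_upper by (auto elim!: eventually_mono intro: less_trans less_le_trans)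
  qed
qed

end

section \<open>Winding\<close>

context environment
begin

definition turn_cost :: "real \<Rightarrow> real \<Rightarrow> real \<Rightarrow> real \<Rightarrow> real"
  where "turn_cost s a t z = least_cost s a t (z + 1) - least_cost s a t z"

lemma turn_cost_shift: "turn_cost s (a + of_int k) t z = turn_cost s a t (z - of_int k)"
proof -
  have "least_cost s (a + of_int k) t y = least_cost s a t (y - of_int k)" for y
    using least_cost_shift[of s a k t "y - of_int k"] by simp
  then show ?thesis by (simp add: turn_cost_def algebra_simps)
qed

lemma turn_cost_bounds:
  assumes "s < t" shows "(2 * (z - a) + 1) / (2 * (t - s)) - strip_mass s t \<le> turn_cost s a t z"
    and "turn_cost s a t z \<le> (2 * (z - a) + 1) / (2 * (t - s)) + strip_mass s t"
proof -
  have 1: "(z + 1 - a)\<^sup>2 / (2 * (t - s)) - (z - a)\<^sup>2 / (2 * (t - s)) = (2 * (z - a) + 1) / (2 * (t - s))"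
    unfolding diff_divide_distrib[symmetric] by (simp add: power2_eq_square algebra_simps)
  have up: "least_cost s a t y \<le> (y - a)\<^sup>2 / (2 * (t - s))" for y
    using least_cost_le_parabola[OF assms, of a y] mass_nonneg[of s a] by linarith
  note low = least_cost_lower[OF assms, of _ a]
  show "(2 * (z - a) + 1) / (2 * (t - s)) - strip_mass s t \<le> turn_cost s a t z"
    using low[of "z + 1"] up[of z] 1 unfolding turn_cost_def by linarith
  show "turn_cost s a t z \<le> (2 * (z - a) + 1) / (2 * (t - s)) + strip_mass s t"
    using low[of z] up[of "z + 1"] 1 unfolding turn_cost_def by linarith
qed

lemma monotone_onto_turn_cost: assumes "s < t" shows "monotone_onto (turn_cost s a t)"
proof
  fix x y :: real assume "x \<le> y"
  then have "least_cost s (a - 1) t x + least_cost s a t y \<le> least_cost s (a - 1) t y + least_cost s a t x"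
    by (intro least_cost_exchange assms) auto
  moreover have "least_cost s (a - 1) t w = least_cost s a t (w + 1)" for w
    using least_cost_shift[of s "a - 1" 1 t w] by simp
  ultimately show "turn_cost s a t x \<le> turn_cost s a t y" by (simp add: turn_cost_def)
next
  have "continuous_on UNIV (\<lambda>z::real. z + 1)" by (intro continuous_intros)
  then have "continuous_on UNIV (\<lambda>z. least_cost s a t (z + 1))"
    using continuous_on_compose2[OF least_cost_continuous_end[OF assms, of a], of UNIV "\<lambda>z. z + 1"] by simp
  then show "continuous_on UNIV (turn_cost s a t)"
    unfolding turn_cost_def by (intro continuous_on_diff least_cost_continuous_end assms)
next
  fix c
  show "\<exists>x. turn_cost s a t x < c"
  proof
    let ?x = "a + (t - s) * (c - strip_mass s t) - 1"
    have "turn_cost s a t ?x \<le> (2 * (?x - a) + 1) / (2 * (t - s)) + strip_mass s t"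
      by (rule turn_cost_bounds(2)[OF assms])
    also have "2 * (?x - a) + 1 = 2 * (t - s) * (c - strip_mass s t) - 1" by (simp add: algebra_simps)
    also have "\<dots> / (2 * (t - s)) + strip_mass s t = c - 1 / (2 * (t - s))"
      using assms by (simp add: diff_divide_distrib)
    finally have "turn_cost s a t ?x \<le> c - 1 / (2 * (t - s))" .
    moreover have "1 / (2 * (t - s)) > 0" using assms by simp
    ultimately show "turn_cost s a t ?x < c" by linarith
  qed
  show "\<exists>x. c < turn_cost s a t x"
  proof
    let ?x = "a + (t - s) * (c + strip_mass s t)"
    have "c < c + 1 / (2 * (t - s))" using assms by simp
    also have "\<dots> = (2 * (t - s) * (c + strip_mass s t) + 1) / (2 * (t - s)) - strip_mass s t"
      using assms by (simp add: add_divide_distrib)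
    also have "2 * (t - s) * (c + strip_mass s t) + 1 = 2 * (?x - a) + 1" by simp
    also have "(2 * (?x - a) + 1) / (2 * (t - s)) - strip_mass s t \<le> turn_cost s a t ?x"
      by (rule turn_cost_bounds(1)[OF assms])
    finally show "c < turn_cost s a t ?x" .
  qed
qed

text \<open>Call \<open>k\<close> the winding number of a path that starts at \<open>a + k\<close>. By convexity of the minimal cost in
  this number, optimality among all winding numbers is optimality among the two neighbouring ones.\<close>

lemma winding_optimal_iff:
  assumes "s < t"
  shows "(\<forall>j::int. least_cost s b t z \<le> least_cost s (b + of_int j) t z + \<theta> * of_int j) \<longleftrightarrow>
    turn_cost s b t (z - 1) \<le> \<theta> \<and> \<theta> \<le> turn_cost s b t z"
proof -
  interpret monotone_onto "turn_cost s b t" by (rule monotone_onto_turn_cost[OF assms])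
  have sh: "least_cost s (b + of_int j) t z = least_cost s b t (z - of_int j)" for j :: int
    using least_cost_shift[of s b j t "z - of_int j"] by simp
  show ?thesis unfolding sh
  proof (intro iffI conjI allI)
    assume *: "\<forall>j::int. least_cost s b t z \<le> least_cost s b t (z - of_int j) + \<theta> * of_int j"
    show "turn_cost s b t (z - 1) \<le> \<theta>" using *[rule_format, of 1] by (simp add: turn_cost_def)
    show "\<theta> \<le> turn_cost s b t z" using *[rule_format, of "-1"] by (simp add: turn_cost_def)
  next
    fix j :: int
    assume *: "turn_cost s b t (z - 1) \<le> \<theta> \<and> \<theta> \<le> turn_cost s b t z"
    have up: "least_cost s b t z + \<theta> * real n \<le> least_cost s b t (z + real n)" for n
    proof (induction n)
      case (Suc n)
      have "turn_cost s b t z \<le> turn_cost s b t (z + real n)" by (intro mono) simp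
      then have "\<theta> \<le> turn_cost s b t (z + real n)" using * by simp
      then show ?case using Suc by (simp add: turn_cost_def algebra_simps)
    qed simp
    have down: "least_cost s b t z \<le> least_cost s b t (z - real n) + \<theta> * real n" for n
    proof (induction n)
      case (Suc n)
      have "turn_cost s b t (z - real n - 1) \<le> turn_cost s b t (z - 1)" by (intro mono) simp
      then have "turn_cost s b t (z - real n - 1) \<le> \<theta>" using * by simp
      then show ?case using Suc by (simp add: turn_cost_def algebra_simps)
    qed simp
    show "least_cost s b t z \<le> least_cost s b t (z - of_int j) + \<theta> * of_int j"
    proof (cases "j \<ge> 0")
      case True
      then show ?thesis using down[of "nat j"] by simp
    next
      case False
      then have "real (nat (- j)) = - of_int j" by simp
      then show ?thesis using up[of "nat (- j)"] by simp
    qed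
  qed
qed

lemma torus_min_iff: "s < t \<Longrightarrow> torus_min \<theta> f s t \<longleftrightarrow>
    geodesic f s t \<and> turn_cost s (f s) t (f t - 1) \<le> \<theta> \<and> \<theta> \<le> turn_cost s (f s) t (f t)"
  unfolding torus_min_def by (subst winding_optimal_iff) auto

lemma torus_min_restrict:
  assumes f: "torus_min \<theta> f s t" and "s \<le> u" "u < v" "v \<le> t"
  shows "torus_min \<theta> f u v"
proof -
  note g = torus_min_geodesic[OF f]
  have right: "torus_min \<theta> f s v"
  proof (cases "v = t")
    case False
    then have v: "s < v" "v < t" using assms by auto
    have "least_cost s (f s) v (f v) \<le> least_cost s (f s + of_int k) v (f v) + \<theta> * of_int k" for k :: int
      using geodesicD[OF g, of s v t] torus_min_class[OF f, of k] least_cost_triangle[OF v, of "f s + of_int k" "f t" "f v"] v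
      by simp
    then show ?thesis unfolding torus_min_def using geodesic_subset[OF g, of s v] v by simp
  qed (use f in simp)
  show ?thesis
  proof (cases "s = u")
    case False
    then have u: "s < u" using assms by auto
    have "least_cost u (f u) v (f v) \<le> least_cost u (f u + of_int k) v (f v) + \<theta> * of_int k" for k :: int
      using geodesicD[OF torus_min_geodesic[OF right], of s u v] torus_min_class[OF right, of k]
        least_cost_triangle[OF u assms(3), of "f s + of_int k" "f v" "f u + of_int k"] u assms least_cost_shift[of s "f s" k u "f u"]
      by simp
    then show ?thesis unfolding torus_min_def using geodesic_subset[OF g, of u v] assms by simp
  qed (use right in simp)
qed

lemma half_min_restrict: assumes "half_min \<theta> f t" "r \<le> t" shows "half_min \<theta> f r"
  unfolding half_min_def
proof (intro allI impI)
  fix s assume "s < r"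
  then show "torus_min \<theta> f s r" using assms torus_min_restrict[of \<theta> f s t s r] by (simp add: half_min_def)
qed

text \<open>Sorting both pairs of endpoints does not raise the total cost: if it changes the pairing, the
  two geodesics cross and can exchange their tails.\<close>

lemma least_cost_min_max:
  assumes "s < t"
  shows "least_cost s (min a a') t (min b b') + least_cost s (max a a') t (max b b') \<le> least_cost s a t b + least_cost s a' t b'"
proof -
  consider "a \<le> a'" "b \<le> b'" | "a' \<le> a" "b' \<le> b" | "a \<le> a'" "b' \<le> b" | "a' \<le> a" "b \<le> b'" by linarith
  then show ?thesis
  proof cases
    case 3 then show ?thesis using least_cost_exchange[OF assms 3] by (simp add: min_def max_def)
  next
    case 4 then show ?thesis using least_cost_exchange[OF assms 4] by (simp add: min_def max_def)
  qed (auto simp: min_def max_def)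
qed

lemma geodesicI_end:
  assumes "\<And>u v. s \<le> u \<Longrightarrow> u < v \<Longrightarrow> v < t \<Longrightarrow> least_cost u (f u) v (f v) + least_cost v (f v) t (f t) \<le> least_cost u (f u) t (f t)"
  shows "geodesic f s t"
  unfolding geodesic_def
proof (intro allI impI)
  have eq: "least_cost u (f u) t (f t) = least_cost u (f u) v (f v) + least_cost v (f v) t (f t)" if "s \<le> u" "u < v" "v < t" for u v
    using assms[OF that] least_cost_triangle[OF that(2,3)] by (intro antisym)
  fix u v w assume *: "s \<le> u" "u < v" "v < w" "w \<le> t"
  show "least_cost u (f u) w (f w) = least_cost u (f u) v (f v) + least_cost v (f v) w (f w)"
  proof (cases "w = t")
    case True then show ?thesis using eq * by simp
  next
    case False
    then show ?thesis using eq[of u v] eq[of u w] eq[of v w] * by simp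
  qed
qed

lemma geodesic_min_max:
  assumes f: "geodesic f s t" and g: "geodesic g s t" and "f t = g t"
  shows "geodesic (\<lambda>x. min (f x) (g x)) s t" "geodesic (\<lambda>x. max (f x) (g x)) s t"
proof -
  let ?m = "\<lambda>x. min (f x) (g x)" and ?M = "\<lambda>x. max (f x) (g x)"
  have both: "least_cost u (?m u) v (?m v) + least_cost v (?m v) t (f t) \<le> least_cost u (?m u) t (f t) \<and>
     least_cost u (?M u) v (?M v) + least_cost v (?M v) t (f t) \<le> least_cost u (?M u) t (f t)" if "s \<le> u" "u < v" "v < t" for u v
  proof -
    have mm: "least_cost x (?m x) t (f t) + least_cost x (?M x) t (f t) = least_cost x (f x) t (f t) + least_cost x (g x) t (f t)" for x
      by (simp add: min_def max_def)
    show ?thesis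
      using mm[of u] mm[of v] least_cost_min_max[OF that(2), of "f u" "g u" "f v" "g v"]
        geodesicD[OF f that(1,2,3)] geodesicD[OF g that(1,2,3)] \<open>f t = g t\<close>
        least_cost_triangle[OF that(2,3), of "?m u" "f t" "?m v"] least_cost_triangle[OF that(2,3), of "?M u" "f t" "?M v"]
      by simp
  qed
  show "geodesic ?m s t" "geodesic ?M s t"
    using both \<open>f t = g t\<close> by (auto intro!: geodesicI_end)
qed

lemma torus_min_min_max:
  assumes f: "torus_min \<theta> f s t" and g: "torus_min \<theta> g s t" and "f t = g t"
  shows "torus_min \<theta> (\<lambda>x. min (f x) (g x)) s t" "torus_min \<theta> (\<lambda>x. max (f x) (g x)) s t"
  using geodesic_min_max[OF torus_min_geodesic[OF f] torus_min_geodesic[OF g] assms(3)] torus_min_class[OF f] torus_min_class[OF g] assms(3)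
  by (simp_all add: torus_min_def min_def max_def)

text \<open>The conditions defining a minimizer involve its positions at two times besides the endpoint. So a
  path defined time by time is a minimizer if any two of its positions are attained together.\<close>

lemma half_min_of_pairs:
  assumes "\<And>p q. p \<le> q \<Longrightarrow> q < t \<Longrightarrow> \<exists>f. torus_min \<theta> f p t \<and> f p = h p \<and> f q = h q \<and> f t = h t"
  shows "half_min \<theta> h t"
  unfolding half_min_def torus_min_def
proof (intro allI impI conjI)
  fix s assume "s < t"
  show "geodesic h s t"
  proof (rule geodesicI_end)
    fix u v assume uv: "s \<le> u" "u < v" "v < t"
    then obtain f where f: "torus_min \<theta> f u t" "f u = h u" "f v = h v" "f t = h t"
      using assms[of u v] by auto
    show "least_cost u (h u) v (h v) + least_cost v (h v) t (h t) \<le> least_cost u (h u) t (h t)"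
      using geodesicD[OF torus_min_geodesic[OF f(1)], of u v t] f uv by simp
  qed
  fix k :: int
  obtain f where f: "torus_min \<theta> f s t" "f s = h s" "f t = h t"
    using assms[of s s] \<open>s < t\<close> by auto
  show "least_cost s (h s) t (h t) \<le> least_cost s (h s + of_int k) t (h t) + \<theta> * of_int k"
    using torus_min_class[OF f(1), of k] f by simp
qed

end

section \<open>Bottlenecks\<close>

locale bottlenecks = environment +
  fixes M :: real and base :: "real \<Rightarrow> real"
  assumes M_pos: "M > 0"
    and base_le: "base t \<le> t - M"
    and base_atom: "\<exists>y. msupp \<mu> \<inter> ({base t - M..base t + M} \<times> UNIV) = {(base t, y)} \<and>
      measure \<mu> {(base t, y)} > 1 / (4 * M)"
    and base_top: "filterlim base at_top at_top"
begin

definition bottleneck :: "real \<Rightarrow> real \<Rightarrow> bool"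
  where "bottleneck s a \<longleftrightarrow> msupp \<mu> \<inter> ({s - M..s + M} \<times> UNIV) = {(s, proj a)} \<and>
    measure \<mu> {(s, proj a)} > 1 / (4 * M)"

lemma bottleneck_base: "\<exists>a. bottleneck (base t) a"
  using base_atom[of t] proj_surj unfolding bottleneck_def by metis

lemma bottleneck_below: obtains s a where "s + M \<le> t" "bottleneck s a"
proof -
  have "base t + M \<le> t" using base_le[of t] by simp
  then show ?thesis using bottleneck_base[of t] that by blast
qed

lemma bottleneck_above: obtains s a where "t \<le> s" "bottleneck s a"
proof -
  have "\<forall>\<^sub>F x in at_top. t \<le> base x" using base_top by (simp add: filterlim_at_top)
  then obtain x where "t \<le> base x" by (auto simp: eventually_at_top_linorder)
  then show ?thesis using bottleneck_base[of x] that by blast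
qed

lemma bottleneck_pass:
  assumes "bottleneck s a" "geodesic f u v" "u \<le> s - M" "s + M \<le> v"
  obtains k :: int where "f s = a + of_int k"
proof -
  have "proj (f s) = proj a"
    using assms M_pos unfolding bottleneck_def by (intro geodesic_bottleneck[of f u v M]) auto
  then show ?thesis using that by (rule proj_eqE)
qed

lemma half_min_pass:
  assumes "bottleneck s a" "half_min \<theta> f t" "s + M \<le> t"
  obtains k :: int where "f s = a + of_int k"
  using bottleneck_pass[OF assms(1) half_min_geodesic[OF assms(2), of "s - M"] order_refl assms(3)] by blast

text \<open>Concatenation at a bottleneck preserves minimality, since every competitor can be compared on
  both sides of it.\<close>

lemma torus_min_paste:
  assumes b: "bottleneck s a" "q \<le> s - M" "s + M \<le> t"
    and f: "torus_min \<theta> f q s" and g: "torus_min \<theta> g s t" and fs: "f s = g s" "g s = a + of_int k"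
  shows "torus_min \<theta> (\<lambda>x. if x \<le> s then f x else g x) q t"
proof -
  have qst: "q < s" "s < t" using b M_pos by auto
  have main: "least_cost q (f q) s (f s) + least_cost s (f s) t (g t) \<le> least_cost q (f q + of_int j) t (g t) + \<theta> * of_int j" for j :: int
  proof -
    obtain c where c: "geodesic c q t" "c q = f q + of_int j" "c t = g t"
      using geodesic_exists[of q t] qst by (metis less_trans)
    obtain k' :: int where k': "c s = a + of_int k'"
      using bottleneck_pass[OF b(1) c(1) b(2,3)] by blast
    define i where "i = k' - k"
    have cs: "c s = f s + of_int i" using k' fs by (simp add: i_def)
    have "least_cost q (f q + of_int j) t (g t) = least_cost q (f q + of_int j) s (f s + of_int i) + least_cost s (f s + of_int i) t (g t)"
      using geodesicD[OF c(1), of q s t] qst c cs by simp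
    moreover have "least_cost q (f q + of_int j) s (f s + of_int i) = least_cost q (f q + of_int (j - i)) s (f s)"
      using least_cost_shift[of q "f q + of_int (j - i)" i s "f s"] by simp
    moreover have "least_cost q (f q) s (f s) \<le> least_cost q (f q + of_int (j - i)) s (f s) + \<theta> * of_int (j - i)"
      by (rule torus_min_class[OF f])
    moreover have "least_cost s (f s) t (g t) \<le> least_cost s (f s + of_int i) t (g t) + \<theta> * of_int i"
      using torus_min_class[OF g, of i] fs by simp
    moreover have "\<theta> * of_int (j - i) + \<theta> * of_int i = \<theta> * of_int j" by (simp add: algebra_simps)
    ultimately show ?thesis by linarith
  qed
  have geo: "geodesic (\<lambda>x. if x \<le> s then f x else g x) q t"
    using main[of 0] fs by (intro geodesic_paste qst torus_min_geodesic[OF f] torus_min_geodesic[OF g]) auto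
  have "least_cost q (f q) t (g t) \<le> least_cost q (f q) s (f s) + least_cost s (f s) t (g t)" by (rule least_cost_triangle[OF qst])
  then have "least_cost q (f q) t (g t) \<le> least_cost q (f q + of_int j) t (g t) + \<theta> * of_int j" for j :: int
    using main[of j] by linarith
  then show ?thesis using geo qst by (simp add: torus_min_def)
qed

lemma bottleneck_separated:
  assumes "bottleneck s a" "bottleneck q b" "q < s" shows "q < s - M"
proof (rule ccontr)
  assume "\<not> q < s - M"
  moreover have "(q, proj b) \<in> msupp \<mu>" using assms(2) unfolding bottleneck_def by blast
  ultimately have "(q, proj b) \<in> msupp \<mu> \<inter> ({s - M..s + M} \<times> UNIV)" using assms(3) M_pos by auto
  then have "q = s" using assms(1) unfolding bottleneck_def by auto
  then show False using assms(3) by simp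
qed

text \<open>The winding number \<open>k\<close> is chosen such that \<open>z - k\<close> lies at most one turn above the first point
  where a further turn costs as much as the drift gains.\<close>

lemma torus_min_exists:
  assumes "s < t"
  obtains f and k :: int where "torus_min \<theta> f s t" "f t = z" "f s = a + of_int k"
proof -
  interpret monotone_onto "turn_cost s a t" by (rule monotone_onto_turn_cost[OF assms])
  let ?l = "lower_inv (turn_cost s a t) \<theta>"
  define k where "k = \<lfloor>z - ?l\<rfloor>"
  have "?l \<le> z - of_int k" "z - of_int k < ?l + 1" unfolding k_def by linarith+
  then have "\<theta> \<le> turn_cost s a t (z - of_int k)" "turn_cost s a t (z - of_int k - 1) < \<theta>"
    using lower_inv_le_iff[of \<theta> "z - of_int k"] less_lower_inv_iff[of "z - of_int k - 1" \<theta>] by auto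
  then have c: "\<theta> \<le> turn_cost s (a + of_int k) t z" "turn_cost s (a + of_int k) t (z - 1) \<le> \<theta>"
    unfolding turn_cost_shift by (auto simp: algebra_simps)
  obtain f where "geodesic f s t" "f s = a + of_int k" "f t = z" using geodesic_exists[OF assms] by blast
  then show ?thesis using c that[of f k] torus_min_iff[OF assms, of \<theta> f] by simp
qed

definition based :: "real \<Rightarrow> (real \<Rightarrow> real) \<Rightarrow> real \<Rightarrow> real \<Rightarrow> bool"
  where "based \<theta> f s t \<longleftrightarrow> torus_min \<theta> f s t \<and> bottleneck s (f s)"

lemma bottleneck_shift: "bottleneck s (a + of_int k) \<longleftrightarrow> bottleneck s a"
  by (simp add: bottleneck_def)

lemma bottleneck_lift: "bottleneck s a \<Longrightarrow> bottleneck s b \<Longrightarrow> \<exists>k::int. b = a + of_int k"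
  unfolding bottleneck_def by (metis insertI1 old.prod.inject proj_eqE singletonD)

lemma based_restrict:
  assumes "based \<theta> f q t" "bottleneck s a" "q \<le> s" "s + M \<le> t"
  shows "based \<theta> f s t"
proof (cases "q = s")
  case False
  have f: "torus_min \<theta> f q t" "bottleneck q (f q)" using assms(1) by (auto simp: based_def)
  then have q: "q < s - M" using bottleneck_separated[OF assms(2) f(2)] assms(3) False by simp
  obtain k :: int where "f s = a + of_int k"
    using bottleneck_pass[OF assms(2) torus_min_geodesic[OF f(1)] less_imp_le[OF q] assms(4)] by blast
  then show ?thesis
    using torus_min_restrict[OF f(1), of s t] assms(2,3,4) M_pos by (simp add: based_def bottleneck_shift)
qed (use assms in simp)

lemma based_extend:
  assumes "based \<theta> f s t" "bottleneck q b" "q < s" "s + M \<le> t"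
  shows "\<exists>g. based \<theta> g q t \<and> (\<forall>x\<ge>s. g x = f x)"
proof -
  have f: "torus_min \<theta> f s t" "bottleneck s (f s)" using assms(1) by (auto simp: based_def)
  have q: "q < s - M" by (rule bottleneck_separated[OF f(2) assms(2,3)])
  obtain h and k :: int where h: "torus_min \<theta> h q s" "h s = f s" "h q = b + of_int k"
    using torus_min_exists[OF assms(3)] by blast
  let ?g = "\<lambda>x. if x \<le> s then h x else f x"
  have "torus_min \<theta> ?g q t"
    using q by (intro torus_min_paste[OF f(2) _ assms(4) h(1) f(1), of 0]) (auto simp: h)
  moreover have "?g q = b + of_int k" using h assms(3) by simp
  ultimately show ?thesis using assms(2) h(2)
    by (intro exI[of _ ?g]) (auto simp: based_def bottleneck_shift)
qed

lemma based_half_min: "half_min \<theta> f t \<Longrightarrow> bottleneck s a \<Longrightarrow> s + M \<le> t \<Longrightarrow> based \<theta> f s t"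
  using half_min_pass[of s a \<theta> f t] M_pos unfolding based_def half_min_def
  by (metis add_le_same_cancel1 bottleneck_shift linorder_not_less order_le_less_trans)

text \<open>The set in which the extremal paths have to be found at time \<open>r\<close>.\<close>

definition positions :: "real \<Rightarrow> real \<Rightarrow> real \<Rightarrow> real \<Rightarrow> real \<Rightarrow> real set"
  where "positions \<theta> s t z r = {f r |f. based \<theta> f s t \<and> f t = z}"

text \<open>Minimizers can be cut at a bottleneck and extended at it to an earlier one.\<close>

lemma positions_independent:
  assumes "bottleneck s a" "bottleneck q b" "s + M \<le> t" "q + M \<le> t" "s \<le> r" "q \<le> r"
  shows "positions \<theta> s t z r = positions \<theta> q t z r"
proof -
  have *: "positions \<theta> s t z r = positions \<theta> q t z r"
    if "bottleneck s a" "bottleneck q b" "s + M \<le> t" "q + M \<le> t" "s \<le> r" "q < s" for s q a b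
  proof (intro equalityI subsetI)
    note ass = that
    fix v assume "v \<in> positions \<theta> s t z r"
    then obtain f where f: "v = f r" "based \<theta> f s t" "f t = z" by (auto simp: positions_def)
    from based_extend[OF f(2) ass(2,6,3)]
    obtain g where "based \<theta> g q t" "\<forall>x\<ge>s. g x = f x" by blast
    then show "v \<in> positions \<theta> q t z r" using f ass M_pos by (auto simp: positions_def intro!: exI[of _ g])
  next
    fix v assume "v \<in> positions \<theta> q t z r"
    then obtain f where "v = f r" "based \<theta> f q t" "f t = z" by (auto simp: positions_def)
    then show "v \<in> positions \<theta> s t z r" using based_restrict[of \<theta> f q t s a] that
      by (auto simp: positions_def)
  qed
  consider "q < s" | "s < q" | "q = s" by linarith
  then show ?thesis using *[of s a q b] *[of q b s a] assms by cases auto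
qed

lemma positions_compact:
  assumes b: "bottleneck s a" "s + M \<le> t" and "s < r" "r < t"
  shows "compact (positions \<theta> s t z r)" "positions \<theta> s t z r \<noteq> {}"
proof -
  have st: "s < t" using assms by simp
  interpret monotone_onto "turn_cost s a t" by (rule monotone_onto_turn_cost[OF st])
  let ?l = "lower_inv (turn_cost s a t) \<theta>" and ?u = "upper_inv (turn_cost s a t) \<theta>"
  define I where "I = {k::int. turn_cost s (a + of_int k) t (z - 1) \<le> \<theta> \<and> \<theta> \<le> turn_cost s (a + of_int k) t z}"
  have "I \<subseteq> {\<lceil>z - 1 - ?u\<rceil>..\<lfloor>z - ?l\<rfloor>}"
  proof
    fix k assume "k \<in> I"
    then have "?l \<le> z - of_int k" "z - of_int k - 1 \<le> ?u"
      unfolding lower_inv_le_iff le_upper_inv_iff by (auto simp: I_def turn_cost_shift algebra_simps)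
    then show "k \<in> {\<lceil>z - 1 - ?u\<rceil>..\<lfloor>z - ?l\<rfloor>}" by (auto simp: ceiling_le_iff le_floor_iff)
  qed
  then have finI: "finite I" using finite_subset by blast
  have "positions \<theta> s t z r =
      (\<Union>k\<in>I. {v. least_cost s (a + of_int k) r v + least_cost r v t z \<le> least_cost s (a + of_int k) t z})" (is "_ = ?U")
  proof (intro equalityI subsetI)
    fix v assume "v \<in> positions \<theta> s t z r"
    then obtain f where f: "v = f r" "torus_min \<theta> f s t" "bottleneck s (f s)" "f t = z"
      by (auto simp: positions_def based_def)
    obtain k :: int where k: "f s = a + of_int k" using bottleneck_lift[OF b(1) f(3)] by blast
    then have "k \<in> I" using f torus_min_iff[OF st, of \<theta> f] by (simp add: I_def)
    moreover have "least_cost s (f s) t z = least_cost s (f s) r v + least_cost r v t z"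
      using geodesicD[OF torus_min_geodesic[OF f(2)], of s r t] f assms by simp
    ultimately show "v \<in> ?U" unfolding k by (intro UN_I[of k]) auto
  next
    fix v assume "v \<in> ?U"
    then obtain k where k: "k \<in> I" "least_cost s (a + of_int k) r v + least_cost r v t z \<le> least_cost s (a + of_int k) t z" by blast
    obtain f where f: "geodesic f s r" "f s = a + of_int k" "f r = v" using geodesic_exists[OF assms(3)] by blast
    obtain g where g: "geodesic g r t" "g r = v" "g t = z" using geodesic_exists[OF assms(4)] by blast
    let ?h = "\<lambda>x. if x \<le> r then f x else g x"
    have "geodesic ?h s t"
      using f g k assms by (intro geodesic_paste) auto
    then have "based \<theta> ?h s t"
      unfolding based_def torus_min_iff[OF st] using f g k b assms by (auto simp: I_def bottleneck_shift)
    then show "v \<in> positions \<theta> s t z r"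
      using f g assms by (auto simp: positions_def intro!: exI[of _ ?h])
  qed
  then show "compact (positions \<theta> s t z r)"
    using finI assms least_cost_midpoint_compact by (auto intro!: compact_UN)
  obtain f and k :: int where f: "torus_min \<theta> f s t" "f t = z" "f s = a + of_int k"
    using torus_min_exists[OF st] by blast
  then have "based \<theta> f s t" using b by (simp add: based_def bottleneck_shift)
  then show "positions \<theta> s t z r \<noteq> {}" using f(2) by (auto simp: positions_def)
qed

text \<open>The extremal paths are defined time by time, by extremal positions. Two extremal positions are
  attained by one and the same minimizer, the minimum or maximum of two minimizers.\<close>

lemma extremal_exist:
  "\<exists>f. leftmost \<theta> f t \<and> f t = z" "\<exists>f. rightmost \<theta> f t \<and> f t = z"
proof -
  have "\<forall>r. \<exists>s. r < t \<longrightarrow> (\<exists>a. bottleneck s a \<and> s + M \<le> t \<and> s < r)"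
  proof (intro allI)
    fix r
    obtain s a where "s + M \<le> r - 1" "bottleneck s a" using bottleneck_below by blast
    then show "\<exists>s. r < t \<longrightarrow> (\<exists>a. bottleneck s a \<and> s + M \<le> t \<and> s < r)" using M_pos by (intro exI[of _ s]) auto
  qed
  then obtain bs where bs: "\<And>r. r < t \<Longrightarrow> \<exists>a. bottleneck (bs r) a \<and> bs r + M \<le> t \<and> bs r < r"
    by metis
  define V where "V r = positions \<theta> (bs r) t z r" for r
  have V: "compact (V r)" "V r \<noteq> {}" if "r < t" for r
    using bs[OF that] that positions_compact unfolding V_def by blast+
  define L where "L r = (if r < t then Inf (V r) else z)" for r
  define R where "R r = (if r < t then Sup (V r) else z)" for r
  have LV: "L r \<in> V r" "R r \<in> V r" and bd: "\<And>v. v \<in> V r \<Longrightarrow> L r \<le> v \<and> v \<le> R r" if r: "r < t" for r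
  proof -
    have "closed (V r)" "bdd_below (V r)" "bdd_above (V r)"
      using V(1)[OF r] by (auto simp: compact_imp_closed compact_imp_bounded bounded_imp_bdd_below bounded_imp_bdd_above)
    then show "L r \<in> V r" "R r \<in> V r" "\<And>v. v \<in> V r \<Longrightarrow> L r \<le> v \<and> v \<le> R r"
      using V(2)[OF r] r by (auto simp: L_def R_def closed_contains_Inf closed_contains_Sup cInf_lower cSup_upper)
  qed
  have tb: "v \<in> V r \<longleftrightarrow> v \<in> positions \<theta> s t z r" if "bottleneck s a" "s + M \<le> t" "s \<le> r" "r < t" for s a r v
    using bs[OF that(4)] positions_independent[of s a "bs r" _ t r \<theta> z] that unfolding V_def by fastforce
  have pairs: "\<exists>f. torus_min \<theta> f p t \<and> f p = L p \<and> f q = L q \<and> f t = z"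
    "\<exists>f. torus_min \<theta> f p t \<and> f p = R p \<and> f q = R q \<and> f t = z" if pq: "p \<le> q" "q < t" for p q
  proof -
    have pt: "p < t" using pq by simp
    obtain s a where s: "bottleneck s a" "s + M \<le> t" "s < p" using bs[OF pt] by blast
    have ex: "\<exists>f. based \<theta> f s t \<and> f t = z \<and> f r = v" if "p \<le> r" "r < t" "v \<in> V r" for r v
      using tb[OF s(1,2), of r v] that s(3) by (auto simp: positions_def)
    have in_V: "f r \<in> V r" if "based \<theta> f s t" "f t = z" "p \<le> r" "r < t" for f r
      using tb[OF s(1,2), of r "f r"] that s(3) by (auto simp: positions_def)
    obtain f g where f: "based \<theta> f s t" "f t = z" "f p = L p" and g: "based \<theta> g s t" "g t = z" "g q = L q"
      using ex[of p "L p"] ex[of q "L q"] LV pq pt by blast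
    have "torus_min \<theta> (\<lambda>x. min (f x) (g x)) p t"
      using f g s(3) pt by (intro torus_min_restrict[OF torus_min_min_max(1)[of \<theta> f s t g]]) (auto simp: based_def)
    moreover have "L p \<le> g p" "L q \<le> f q" using in_V bd f g pq pt by blast+
    ultimately show "\<exists>f. torus_min \<theta> f p t \<and> f p = L p \<and> f q = L q \<and> f t = z"
      using f g by (intro exI[of _ "\<lambda>x. min (f x) (g x)"]) auto
    obtain f g where f: "based \<theta> f s t" "f t = z" "f p = R p" and g: "based \<theta> g s t" "g t = z" "g q = R q"
      using ex[of p "R p"] ex[of q "R q"] LV pq pt by blast
    have "torus_min \<theta> (\<lambda>x. max (f x) (g x)) p t"
      using f g s(3) pt by (intro torus_min_restrict[OF torus_min_min_max(2)[of \<theta> f s t g]]) (auto simp: based_def)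
    moreover have "g p \<le> R p" "f q \<le> R q" using in_V bd f g pq pt by blast+
    ultimately show "\<exists>f. torus_min \<theta> f p t \<and> f p = R p \<and> f q = R q \<and> f t = z"
      using f g by (intro exI[of _ "\<lambda>x. max (f x) (g x)"]) auto
  qed
  have t: "L t = z" "R t = z" by (auto simp: L_def R_def)
  have hm: "half_min \<theta> L t" "half_min \<theta> R t"
    using pairs t by (auto intro!: half_min_of_pairs)
  have bounds: "L r \<le> g r \<and> g r \<le> R r" if g: "half_min \<theta> g t" "g t = z" "r \<le> t" for g r
  proof (cases "r = t")
    case True then show ?thesis using g t by simp
  next
    case False
    then have r: "r < t" using g by simp
    obtain a where s: "bottleneck (bs r) a" "bs r + M \<le> t" "bs r < r" using bs[OF r] by blast
    have "g r \<in> V r"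
      using based_half_min[OF g(1) s(1,2)] g(2) unfolding V_def positions_def by blast
    then show ?thesis using bd[OF r] by blast
  qed
  show "\<exists>f. leftmost \<theta> f t \<and> f t = z"
    using hm t bounds by (intro exI[of _ L]) (auto simp: leftmost_def)
  show "\<exists>f. rightmost \<theta> f t \<and> f t = z"
    using hm t bounds by (intro exI[of _ R]) (auto simp: rightmost_def)
qed

lemma half_min_extend:
  assumes b: "bottleneck s a" "s + M \<le> t" and f: "torus_min \<theta> f s t" "f s = a + of_int k"
  obtains h where "half_min \<theta> h t" "\<And>x. s \<le> x \<Longrightarrow> h x = f x"
proof -
  obtain g where g: "half_min \<theta> g s" "g s = f s"
    using extremal_exist(1)[of \<theta> s "f s"] by (auto simp: leftmost_def)
  let ?h = "\<lambda>x. if x \<le> s then g x else f x"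
  have "half_min \<theta> ?h t" unfolding half_min_def
  proof (intro allI impI)
    fix u assume u: "u < t"
    \<comment> \<open>starting before the strip of the bottleneck, so that competitors have to pass through it\<close>
    let ?q = "min u (s - M)"
    have "torus_min \<theta> ?h ?q t"
      using g f M_pos by (intro torus_min_paste[OF b(1) _ b(2) _ f(1), where k = k]) (auto simp: half_min_def)
    then show "torus_min \<theta> ?h u t" using u by (intro torus_min_restrict[of \<theta> ?h ?q t u t]) auto
  qed
  then show ?thesis using g by (intro that[of ?h]) auto
qed

text \<open>Up to the drift term, all minimizers that start in a bottleneck and end in the same point have the
  same cost, so one may replace the other.\<close>

lemma half_min_glue:
  assumes f: "half_min \<theta> f t" and g: "half_min \<theta> g r" and "r \<le> t" "f r = g r"
  shows "half_min \<theta> (\<lambda>x. if x \<le> r then g x else f x) t" (is "half_min \<theta> ?h t")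
proof (cases "r = t")
  case True
  have "torus_min \<theta> ?h s t \<longleftrightarrow> torus_min \<theta> g s t" if "s < t" for s
    using that True by (intro torus_min_cong) auto
  then show ?thesis using g True by (simp add: half_min_def)
next
  case False
  then have rt: "r < t" using assms by simp
  show ?thesis unfolding half_min_def
  proof (intro allI impI)
    fix u assume u: "u < t"
    obtain s a where s: "s + M \<le> min u r" "bottleneck s a" using bottleneck_below by blast
    have sr: "s < r" "s \<le> u" using s M_pos by auto
    obtain k :: int where k: "f s = a + of_int k" using half_min_pass[OF s(2) f] s rt by auto
    obtain l :: int where l: "g s = a + of_int l" using half_min_pass[OF s(2) g] s by auto
    define j where "j = k - l"
    have fs: "f s = g s + of_int j" using k l by (simp add: j_def)
    have tf: "torus_min \<theta> f s r" "torus_min \<theta> f s t" "torus_min \<theta> g s r"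
      using f g sr rt half_min_restrict[OF f, of r] by (auto simp: half_min_def)
    have "least_cost s (g s) r (g r) \<le> least_cost s (f s) r (g r) + \<theta> * of_int j"
      using torus_min_class[OF tf(3), of j] fs by simp
    have 1: "least_cost s (f s) t (f t) = least_cost s (f s) r (g r) + least_cost r (g r) t (f t)"
      using geodesicD[OF torus_min_geodesic[OF tf(2)], of s r t] sr rt assms(4) by simp
    have main: "least_cost s (g s) r (g r) + least_cost r (g r) t (f t) \<le> least_cost s (g s + of_int i) t (f t) + \<theta> * of_int i" for i :: int
    proof -
      have "least_cost s (f s) t (f t) \<le> least_cost s (g s + of_int i) t (f t) + \<theta> * of_int (i - j)"
        using torus_min_class[OF tf(2), of "i - j"] fs by simp
      moreover have "\<theta> * of_int (i - j) + \<theta> * of_int j = \<theta> * of_int i" by (simp add: algebra_simps)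
      ultimately show ?thesis using 1 \<open>least_cost s (g s) r (g r) \<le> _\<close> by linarith
    qed
    have "geodesic ?h s t"
      using main[of 0] assms(4) sr rt tf by (intro geodesic_paste torus_min_geodesic half_min_geodesic[OF f]) (auto dest: torus_min_geodesic)
    moreover have "least_cost s (g s) t (f t) \<le> least_cost s (g s) r (g r) + least_cost r (g r) t (f t)" by (rule least_cost_triangle[OF sr(1) rt])
    then have "least_cost s (g s) t (f t) \<le> least_cost s (g s + of_int i) t (f t) + \<theta> * of_int i" for i :: int
      using main[of i] by linarith
    ultimately have "torus_min \<theta> ?h s t" using sr rt by (simp add: torus_min_def)
    then show "torus_min \<theta> ?h u t" using u sr by (intro torus_min_restrict[of \<theta> ?h s t u t]) auto
  qed
qed

lemma shock_of_two:
  assumes f: "half_min \<theta> f t" and g: "half_min \<theta> g t" "f t = g t"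
    and ne: "\<And>d. d > 0 \<Longrightarrow> \<exists>x. t - d \<le> x \<and> x \<le> t \<and> f x \<noteq> g x"
  shows "(\<theta>, t, proj (f t)) \<in> shocks \<mu>"
proof -
  obtain L where L: "leftmost \<theta> L t" "L t = f t" using extremal_exist by blast
  obtain R where R: "rightmost \<theta> R t" "R t = f t" using extremal_exist by blast
  have "\<exists>r. t - d \<le> r \<and> r \<le> t \<and> L r \<noteq> R r" if d: "d > 0" for d
  proof -
    obtain x where x: "t - d \<le> x" "x \<le> t" "f x \<noteq> g x" using ne[OF d] by blast
    have "L x \<le> f x" "L x \<le> g x" "f x \<le> R x" "g x \<le> R x"
      using L R f g x by (auto simp: leftmost_def rightmost_def)
    then have "L x \<noteq> R x" using x(3) by linarith
    then show ?thesis using x by blast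
  qed
  then have "(\<theta>, t, proj (L t)) \<in> shocks \<mu>" using shock_iff(1)[OF L(1) R(1)] L R by simp
  then show ?thesis using L by simp
qed

text \<open>Where two minimizers merge at an interior point of one of them, there is an atom: off the
  atoms, minimizers do not bend, whether one arrives along the first or along the second.\<close>

lemma merge_at_atom:
  assumes f: "half_min \<theta> f t" and g: "half_min \<theta> g r" and "r < t" "f r = g r"
    and ne: "\<And>d. d > 0 \<Longrightarrow> \<exists>x. r - d \<le> x \<and> x \<le> r \<and> f x \<noteq> g x"
  shows "mass r (f r) > 0" "(\<theta>, r, proj (f r)) \<in> shocks \<mu>"
proof -
  show "(\<theta>, r, proj (f r)) \<in> shocks \<mu>"
    using assms by (intro shock_of_two[OF half_min_restrict[OF f] g]) auto
  show "mass r (f r) > 0"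
  proof (rule ccontr)
    assume "\<not> mass r (f r) > 0"
    then have m: "mass r (f r) = 0" using mass_nonneg[of r "f r"] by linarith
    let ?h = "\<lambda>x. if x \<le> r then g x else f x"
    have h: "half_min \<theta> ?h t" using assms by (intro half_min_glue[OF f g]) auto
    have r1: "r - 1 < r" by simp
    obtain d c where 1: "d > 0" "r + d \<le> t" "\<And>x. \<bar>x - r\<bar> \<le> d \<Longrightarrow> f x = f r + c * (x - r)"
      using geodesic_smooth[OF half_min_geodesic[OF f] r1 assms(3) m] by blast
    have m': "mass r (?h r) = 0" using m assms(4) by simp
    obtain d' c' where 2: "d' > 0" "r + d' \<le> t" "\<And>x. \<bar>x - r\<bar> \<le> d' \<Longrightarrow> ?h x = ?h r + c' * (x - r)"
      using geodesic_smooth[OF half_min_geodesic[OF h] r1 assms(3) m'] by blast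
    define e where "e = min d d'"
    have e: "e > 0" "e \<le> d" "e \<le> d'" using 1(1) 2(1) by (auto simp: e_def)
    have "f (r + e) = f r + c * e" using 1(3)[of "r + e"] e by simp
    moreover have "f (r + e) = f r + c' * e" using 2(3)[of "r + e"] e assms(4) by simp
    ultimately have "c = c'" using e by simp
    obtain x where x: "r - e \<le> x" "x \<le> r" "f x \<noteq> g x" using ne[OF e(1)] by blast
    have "f x = f r + c * (x - r)" using x e by (intro 1(3)) auto
    moreover have "g x = f r + c' * (x - r)" using 2(3)[of x] x e assms(4) by simp
    ultimately show False using x(3) \<open>c = c'\<close> by simp
  qed
qed

end

section \<open>Global shocks and winding\<close>

context environment
begin

text \<open>If all geodesics to \<open>(t, z)\<close> pass through one atom, so do those to nearby endpoints: the
  competitors avoiding that position cost definitely more, and both costs depend continuously on the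
  endpoint.\<close>

lemma geodesics_through_atom_stable:
  assumes "s < r" "r < t" and m: "mass r \<rho> > 0"
    and uniq: "\<And>v. least_cost s a r v + least_cost r v t z \<le> least_cost s a t z \<Longrightarrow> v = \<rho>"
  obtains e where "e > 0" "\<And>z'. \<bar>z' - z\<bar> < e \<Longrightarrow> least_cost s a t z' = least_cost s a r \<rho> + least_cost r \<rho> t z'"
proof -
  define c where "c = (\<lambda>z v. least_cost s a r v + least_cost r v t z)"
  define F where "F z = Inf {c z v |v. v \<noteq> \<rho>}" for z
  have st: "s < t" using assms by simp
  have low: "least_cost s a t z \<le> c z v" for z v unfolding c_def by (rule least_cost_triangle[OF assms(1,2)])
  have bdd: "bdd_below {c z v |v. v \<noteq> \<rho>}" for z using low by (intro bdd_belowI[of _ "least_cost s a t z"]) auto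
  have ne: "{c z v |v. v \<noteq> \<rho>} \<noteq> {}" for z by (auto intro: exI[of _ "\<rho> + 1"])
  have F_le: "F z \<le> c z v" if "v \<noteq> \<rho>" for z v
    unfolding F_def using that by (intro cInf_lower bdd) auto
  obtain q where q: "r < q" "q < t" "\<And>x. q \<le> x \<Longrightarrow> x < t \<Longrightarrow> x \<notin> atom_times"
    using atom_gap_left[OF assms(2)] by blast
  have leg: "least_cost q x t z = (z - x)\<^sup>2 / (2 * (t - q))" for x z
    using q by (subst least_cost_free) (auto simp: mass_0)
  have cont: "continuous_on UNIV F"
  proof (rule continuous_inf_parabolas[where d = "t - q" and I = "(- {\<rho>}) \<times> UNIV"
        and c = "\<lambda>i. least_cost s a r (fst i) + least_cost r (fst i) q (snd i)" and \<xi> = snd])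
    fix z and i :: "real \<times> real" assume i: "i \<in> (- {\<rho>}) \<times> UNIV"
    have "F z \<le> c z (fst i)" using i by (intro F_le) auto
    also have "\<dots> \<le> least_cost s a r (fst i) + least_cost r (fst i) q (snd i) + (z - snd i)\<^sup>2 / (2 * (t - q))"
      using least_cost_triangle[OF q(1,2), of "fst i" z "snd i"] leg by (simp add: c_def)
    finally show "F z \<le> least_cost s a r (fst i) + least_cost r (fst i) q (snd i) + (z - snd i)\<^sup>2 / (2 * (t - q))" .
  next
    fix z e :: real assume e: "e > 0"
    have "F z < F z + e / 2" using e by simp
    then obtain v where v: "v \<noteq> \<rho>" "c z v < F z + e / 2"
      using cInf_lessD[OF ne[of z]] unfolding F_def by blast
    obtain x where "least_cost r v q x + least_cost q x t z < least_cost r v t z + e / 2"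
      using least_cost_midpoint_approx[OF q(1,2), of "e / 2" v z] e by auto
    then show "\<exists>i\<in>(- {\<rho>}) \<times> UNIV. least_cost s a r (fst i) + least_cost r (fst i) q (snd i) + (z - snd i)\<^sup>2 / (2 * (t - q)) < F z + e"
      using v leg by (intro bexI[of _ "(v, x)"]) (auto simp: c_def)
  qed (use q in simp)
  have "F z > least_cost s a t z"
  proof -
    \<comment> \<open>at \<open>\<rho>\<close>, forgo the mass: then the minimum is attained and exceeds the true minimal cost\<close>
    define w where "w x = (if x = \<rho> then 0 else mass r x)" for x
    obtain R where R: "\<And>x. least_cost s a r x + least_cost r x t z \<le> c z 0 + mass r \<rho> \<Longrightarrow> \<bar>x\<bar> \<le> R"
      using least_cost_coercive[OF assms(1,2)] by blast
    let ?G = "\<lambda>x. least_cost s a r x + (least_cost r x t z + mass r x)"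
    have Gw: "?G x - w x = c z x + (if x = \<rho> then mass r \<rho> else 0)" for x
      by (simp add: w_def c_def)
    have "\<exists>x. \<forall>y. ?G x - w x \<le> ?G y - w y"
    proof (rule attains_min[where R = R])
      show "continuous_on UNIV ?G"
        by (intro continuous_on_add least_cost_continuous_end least_cost_continuous_start assms)
      show "w x \<ge> 0" for x by (simp add: w_def)
      show "finite {z \<in> {a..b}. w z > 0}" for a b
        by (rule finite_subset[OF _ finite_mass_pos[of a b r]]) (auto simp: w_def split: if_splits)
      show "\<bar>x\<bar> \<le> R" if "?G x - w x \<le> ?G 0 - w 0" for x
      proof (rule R)
        have "c z x \<le> ?G x - w x" "?G 0 - w 0 \<le> c z 0 + mass r \<rho>" unfolding Gw using m by auto
        then show "least_cost s a r x + least_cost r x t z \<le> c z 0 + mass r \<rho>" using that unfolding c_def by linarith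
      qed
    qed
    then obtain x where x: "\<And>y. c z x + (if x = \<rho> then mass r \<rho> else 0) \<le> c z y + (if y = \<rho> then mass r \<rho> else 0)"
      unfolding Gw by blast
    have "least_cost s a t z < c z x + (if x = \<rho> then mass r \<rho> else 0)"
    proof (cases "x = \<rho>")
      case True
      then show ?thesis using low[of z x] m by simp
    next
      case False
      then have "\<not> c z x \<le> least_cost s a t z" using uniq[of x] by (auto simp: c_def)
      then show ?thesis using False by simp
    qed
    also have "\<dots> \<le> F z" unfolding F_def
    proof (intro cInf_greatest ne)
      fix y assume "y \<in> {c z v |v. v \<noteq> \<rho>}"
      then obtain v where "y = c z v" "v \<noteq> \<rho>" by blast
      then show "c z x + (if x = \<rho> then mass r \<rho> else 0) \<le> y" using x[of v] by simp
    qed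
    finally show ?thesis .
  qed
  moreover have "continuous_on UNIV (\<lambda>z. F z - least_cost s a t z)"
    by (intro continuous_on_diff cont least_cost_continuous_end st)
  then have "isCont (\<lambda>z. F z - least_cost s a t z) z" by (simp add: continuous_on_eq_continuous_at)
  ultimately obtain e where e: "e > 0"
      "\<And>z'. dist z' z < e \<Longrightarrow> dist (F z' - least_cost s a t z') (F z - least_cost s a t z) < F z - least_cost s a t z"
    unfolding continuous_at_eps_delta by (metis diff_gt_0_iff_gt)
  show ?thesis
  proof (rule that[OF e(1)])
    fix z' assume "\<bar>z' - z\<bar> < e"
    then have lt: "least_cost s a t z' < F z'" using e(2)[of z'] by (simp add: dist_real_def)
    obtain v where v: "least_cost s a t z' = least_cost s a r v + least_cost r v t z'" using least_cost_midpoint[OF assms(1,2)] by blast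
    have "v = \<rho>"
    proof (rule ccontr)
      assume "v \<noteq> \<rho>"
      from F_le[OF this, of z'] show False using v lt by (simp add: c_def)
    qed
    then show "least_cost s a t z' = least_cost s a r \<rho> + least_cost r \<rho> t z'" using v by simp
  qed
qed

text \<open>A competitor of the path through the atom either arrives near it and misses its mass, or it has to
  travel a fixed distance in a short time.\<close>

lemma geodesics_after_atom:
  assumes "s < r" and m: "mass r \<rho> > 0"
  obtains d where "d > 0" "\<And>t v. r < t \<Longrightarrow> t < r + d \<Longrightarrow> least_cost s a r v + least_cost r v t \<rho> \<le> least_cost s a t \<rho> \<Longrightarrow> v = \<rho>"
proof -
  obtain d1 where d1: "d1 > 0" "\<And>q. \<bar>q - r\<bar> \<le> d1 \<Longrightarrow> q \<noteq> r \<Longrightarrow> q \<notin> atom_times" using atom_gap[of r] by metis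
  obtain d2 where d2: "d2 > 0" "\<And>y. \<bar>y - \<rho>\<bar> \<le> d2 \<Longrightarrow> y \<noteq> \<rho> \<Longrightarrow> mass r y = 0" using mass_isolated[of \<rho> r] by metis
  have "isCont (least_cost s a r) \<rho>"
    using least_cost_continuous_end[OF assms(1), of a] by (simp add: continuous_on_eq_continuous_at)
  then obtain d3 where d3: "d3 > 0" "\<And>y. dist y \<rho> < d3 \<Longrightarrow> dist (least_cost s a r y) (least_cost s a r \<rho>) < mass r \<rho>"
    using m unfolding continuous_at_eps_delta by (auto simp: dist_real_def)
  define e where "e = min d2 (d3 / 2)"
  have e: "e > 0" "e \<le> d2" "e < d3" using d2(1) d3(1) by (auto simp: e_def)
  define C where "C = least_cost s a r \<rho> + strip_mass s r + strip_mass r r + 1"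
  \<comment> \<open>so short that travelling the distance \<open>e\<close> costs more than \<open>C\<close>\<close>
  define d where "d = min d1 (e\<^sup>2 / (2 * (\<bar>C\<bar> + 1)))"
  have d: "d > 0" "d \<le> d1" "d \<le> e\<^sup>2 / (2 * (\<bar>C\<bar> + 1))" using d1(1) e(1) by (auto simp: d_def)
  show ?thesis
  proof (rule that[OF d(1)])
    fix t v assume t: "r < t" "t < r + d" and le: "least_cost s a r v + least_cost r v t \<rho> \<le> least_cost s a t \<rho>"
    have leg: "least_cost r y t \<rho> = (\<rho> - y)\<^sup>2 / (2 * (t - r)) - mass r y" for y
      using t d d1 by (intro least_cost_free) auto
    have "least_cost s a t \<rho> \<le> least_cost s a r \<rho> + least_cost r \<rho> t \<rho>" by (rule least_cost_triangle[OF assms(1) t(1)])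
    then have le2: "least_cost s a r v + (\<rho> - v)\<^sup>2 / (2 * (t - r)) - mass r v \<le> least_cost s a r \<rho> - mass r \<rho>"
      using le leg by simp
    show "v = \<rho>"
    proof (rule ccontr)
      assume ne: "v \<noteq> \<rho>"
      show False
      proof (cases "\<bar>v - \<rho>\<bar> \<le> e")
        case True
        then have "mass r v = 0" using ne e by (intro d2(2)) auto
        moreover have "\<bar>least_cost s a r v - least_cost s a r \<rho>\<bar> < mass r \<rho>"
          using d3(2)[of v] True e by (simp add: dist_real_def)
        moreover have "(\<rho> - v)\<^sup>2 / (2 * (t - r)) \<ge> 0" using t by simp
        ultimately show False using le2 by linarith
      next
        case False
        then have "e\<^sup>2 \<le> (\<rho> - v)\<^sup>2" using e(1) by (intro abs_le_square_iff[THEN iffD1]) auto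
        then have "e\<^sup>2 / (2 * (t - r)) \<le> (\<rho> - v)\<^sup>2 / (2 * (t - r))"
          using t by (intro divide_right_mono) auto
        moreover have "\<bar>C\<bar> + 1 \<le> e\<^sup>2 / (2 * (t - r))"
        proof -
          have "t - r \<le> e\<^sup>2 / (2 * (\<bar>C\<bar> + 1))" using t d by simp
          then have "(t - r) * (2 * (\<bar>C\<bar> + 1)) \<le> e\<^sup>2" by (simp add: pos_le_divide_eq)
          then show ?thesis using t by (simp add: pos_le_divide_eq algebra_simps)
        qed
        moreover have "least_cost s a r v \<ge> - strip_mass s r"
          using least_cost_lower[OF assms(1), of v a] assms(1) by (smt (verit) divide_nonneg_nonneg zero_le_power2)
        moreover have "mass r v \<le> strip_mass r r" by (intro mass_le_strip) auto
        ultimately show False using le2 m C_def by linarith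
      qed
    qed
  qed
qed

text \<open>A maximum principle: the minimizer to \<open>f t\<close>, continued from time \<open>r\<close> on by its own shift by one turn,
  is a competitor for the endpoint one turn further.\<close>

lemma turn_cost_le_along:
  assumes f: "geodesic f s t" and "s < r" "r < t"
  shows "turn_cost s (f s) t (f t) \<le> turn_cost s (f s) r (f r)"
proof -
  have "least_cost s (f s) t (f t + 1) \<le> least_cost s (f s) r (f r + 1) + least_cost r (f r + 1) t (f t + 1)"
    by (rule least_cost_triangle[OF assms(2,3)])
  moreover have "least_cost r (f r + 1) t (f t + 1) = least_cost r (f r) t (f t)" using least_cost_shift[of r "f r" 1] by simp
  moreover have "least_cost s (f s) t (f t) = least_cost s (f s) r (f r) + least_cost r (f r) t (f t)"
    using assms by (intro geodesicD[OF f]) auto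
  ultimately show ?thesis by (simp add: turn_cost_def)
qed

lemma turn_cost_ge_along:
  assumes f: "geodesic f s t" and "s < r" "r < t"
  shows "turn_cost s (f s) r (f r - 1) \<le> turn_cost s (f s) t (f t - 1)"
proof -
  have "least_cost s (f s) t (f t - 1) \<le> least_cost s (f s) r (f r - 1) + least_cost r (f r - 1) t (f t - 1)"
    by (rule least_cost_triangle[OF assms(2,3)])
  moreover have "least_cost r (f r - 1) t (f t - 1) = least_cost r (f r) t (f t)" using least_cost_shift[of r "f r" "-1"] by simp
  moreover have "least_cost s (f s) t (f t) = least_cost s (f s) r (f r) + least_cost r (f r) t (f t)"
    using assms by (intro geodesicD[OF f]) auto
  ultimately show ?thesis by (simp add: turn_cost_def)
qed

abbreviation lo :: "real \<Rightarrow> real \<Rightarrow> real \<Rightarrow> real \<Rightarrow> real"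
  where "lo s a \<theta> t \<equiv> lower_inv (turn_cost s a t) \<theta>"

abbreviation hi :: "real \<Rightarrow> real \<Rightarrow> real \<Rightarrow> real \<Rightarrow> real"
  where "hi s a \<theta> t \<equiv> upper_inv (turn_cost s a t) \<theta>"

lemma lo_le_iff: "s < t \<Longrightarrow> lo s a \<theta> t \<le> z \<longleftrightarrow> \<theta> \<le> turn_cost s a t z"
  by (rule monotone_onto.lower_inv_le_iff[OF monotone_onto_turn_cost])

lemma le_hi_iff: "s < t \<Longrightarrow> z \<le> hi s a \<theta> t \<longleftrightarrow> turn_cost s a t z \<le> \<theta>"
  by (rule monotone_onto.le_upper_inv_iff[OF monotone_onto_turn_cost])

lemma lo_le_hi: "s < t \<Longrightarrow> lo s a \<theta> t \<le> hi s a \<theta> t"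
  by (rule monotone_onto.lower_le_upper[OF monotone_onto_turn_cost])

lemma between_lo_hi_iff: "s < t \<Longrightarrow> lo s a \<theta> t \<le> z \<and> z \<le> hi s a \<theta> t \<longleftrightarrow> turn_cost s a t z = \<theta>"
  by (rule monotone_onto.between_iff[OF monotone_onto_turn_cost])

text \<open>The winding numbers that are optimal for the endpoint \<open>z\<close> are the integers \<open>k\<close> with
  \<open>lo \<le> z - k \<le> hi + 1\<close>. Hence there are at least two of them exactly if some lift of \<open>proj z\<close> lies
  between \<open>lo\<close> and \<open>hi\<close>.\<close>

lemma torus_min_winding_iff:
  assumes "s < t" "f s = a + of_int k"
  shows "torus_min \<theta> f s t \<longleftrightarrow> geodesic f s t \<and> lo s a \<theta> t \<le> f t - of_int k \<and> f t - of_int k \<le> hi s a \<theta> t + 1"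
proof -
  have "f t - of_int k \<le> hi s a \<theta> t + 1 \<longleftrightarrow> f t - 1 - of_int k \<le> hi s a \<theta> t" by linarith
  then show ?thesis
    unfolding torus_min_iff[OF assms(1)] lo_le_iff[OF assms(1)] assms(2) turn_cost_shift
    using le_hi_iff[OF assms(1), of "f t - 1 - of_int k" a \<theta>] by auto
qed

end

context bottlenecks
begin

lemma half_min_winding:
  assumes "half_min \<theta> f t" "f s = a + of_int k" "s < r" "r \<le> t"
  shows "lo s a \<theta> r \<le> f r - of_int k" "f r - of_int k \<le> hi s a \<theta> r + 1"
proof -
  have "torus_min \<theta> f s r" using half_min_restrict[OF assms(1,4)] assms(3) by (simp add: half_min_def)
  then show "lo s a \<theta> r \<le> f r - of_int k" "f r - of_int k \<le> hi s a \<theta> r + 1"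
    using torus_min_winding_iff[of s r f a k \<theta>] assms(2,3) by auto
qed

lemma half_min_with_winding:
  assumes b: "bottleneck s a" "s + M \<le> t" and k: "lo s a \<theta> t \<le> z - of_int k" "z - of_int k \<le> hi s a \<theta> t + 1"
    and f: "geodesic f s t" "f s = a + of_int k" "f t = z"
  obtains h where "half_min \<theta> h t" "\<And>x. s \<le> x \<Longrightarrow> h x = f x"
proof -
  have "s < t" using b M_pos by simp
  then have "torus_min \<theta> f s t" using k f by (simp add: torus_min_winding_iff)
  then show ?thesis using half_min_extend[where f = f and k = k and \<theta> = \<theta>, OF b] f(2) that by blast
qed

lemma half_min_with_winding_exists:
  assumes b: "bottleneck s a" "s + M \<le> t" and k: "lo s a \<theta> t \<le> z - of_int k" "z - of_int k \<le> hi s a \<theta> t + 1"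
  obtains h where "half_min \<theta> h t" "h s = a + of_int k" "h t = z"
proof -
  have st: "s < t" using b M_pos by simp
  obtain f where f: "geodesic f s t" "f s = a + of_int k" "f t = z"
    using geodesic_exists[OF st] by blast
  obtain h where "half_min \<theta> h t" "\<And>x. s \<le> x \<Longrightarrow> h x = f x"
    using half_min_with_winding[OF b k f] by blast
  then show ?thesis using f st by (intro that[of h]) auto
qed

lemma half_min_continuous: "half_min \<theta> f t \<Longrightarrow> continuous_on {s..t} f"
  by (intro geodesic_continuous half_min_geodesic)

text \<open>The point sought is the last one before which the two minimizers differ; there they merge.\<close>

lemma separation_atom:
  assumes f: "half_min \<theta> f t" and h: "half_min \<theta> h t" and "s < r" "r < t"
    and eq: "\<And>x. r \<le> x \<Longrightarrow> x \<le> t \<Longrightarrow> h x = f x" and ne: "h s \<noteq> f s"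
  obtains q where "s < q" "q \<le> r" "\<And>x. q \<le> x \<Longrightarrow> x \<le> t \<Longrightarrow> h x = f x"
    "mass q (f q) > 0" "(\<theta>, q, proj (f q)) \<in> shocks \<mu>"
proof -
  define S where "S = {x \<in> {s..t}. h x \<noteq> f x}"
  define q where "q = Sup S"
  have sS: "s \<in> S" using ne assms by (auto simp: S_def)
  have up: "x \<le> r" if "x \<in> S" for x using that eq[of x] by (force simp: S_def)
  have bdd: "bdd_above S" using up by (intro bdd_aboveI[of _ r]) auto
  have qr: "q \<le> r" unfolding q_def using sS up by (intro cSup_least) auto
  have sq: "s \<le> q" unfolding q_def using sS bdd by (rule cSup_upper)
  have after: "h x = f x" if "q < x" "x \<le> t" for x
  proof (rule ccontr)
    assume "h x \<noteq> f x"
    then have "x \<in> S" using that sq by (auto simp: S_def)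
    then have "x \<le> q" unfolding q_def using bdd by (rule cSup_upper)
    then show False using that by simp
  qed
  have hq: "h q = f q"
  proof -
    have "continuous_on {q..t} (\<lambda>x. h x - f x)"
      by (intro continuous_on_diff half_min_continuous[OF f] half_min_continuous[OF h])
    moreover have "closure {q<..t} = {q..t}" using qr assms by simp
    moreover have "\<And>x. x \<in> {q<..t} \<Longrightarrow> h x - f x = 0" using after by simp
    ultimately have "h q - f q = 0"
      using continuous_constant_on_closure[of "{q<..t}" "\<lambda>x. h x - f x" 0 q] qr assms by auto
    then show ?thesis by simp
  qed
  then have "q \<noteq> s" using ne by auto
  then have sq': "s < q" using sq by simp
  have near: "\<exists>x. q - d \<le> x \<and> x \<le> q \<and> f x \<noteq> h x" if "d > 0" for d
  proof -
    have "q - d < Sup S" using that by (simp add: q_def)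
    then obtain x where x: "x \<in> S" "q - d < x" using less_cSupD[of S "q - d"] sS by blast
    then have "x \<le> q" unfolding q_def using bdd by (intro cSup_upper)
    then show ?thesis using x by (intro exI[of _ x]) (auto simp: S_def)
  qed
  have qt: "q < t" using qr assms by simp
  have "mass q (f q) > 0" "(\<theta>, q, proj (f q)) \<in> shocks \<mu>"
    using merge_at_atom[OF f half_min_restrict[OF h less_imp_le[OF qt]] qt hq[symmetric] near] by auto
  moreover have "h x = f x" if "q \<le> x" "x \<le> t" for x
    using that after[of x] hq by (cases "x = q") auto
  ultimately show ?thesis using that[OF sq' qr] by blast
qed

lemma meeting_atom:
  assumes f: "half_min \<theta> f t" and g: "half_min \<theta> g t" and "s < t" "f s < g s" "f r = g r" "s \<le> r" "r < t"
  obtains q where "s < q" "q \<le> r" "f q = g q" "\<And>x. s \<le> x \<Longrightarrow> x < q \<Longrightarrow> f x < g x"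
    "mass q (f q) > 0" "(\<theta>, q, proj (f q)) \<in> shocks \<mu>"
proof -
  have sr: "s < r" using assms by (cases "s = r") auto
  obtain q where q: "s < q" "q \<le> r" "f q = g q" "\<And>x. s \<le> x \<Longrightarrow> x < q \<Longrightarrow> f x < g x"
    using first_meeting[of s r f g] sr assms
      continuous_on_subset[OF half_min_continuous[OF f, of s], of "{s..r}"]
      continuous_on_subset[OF half_min_continuous[OF g, of s], of "{s..r}"] by auto
  have near: "\<exists>x. q - d \<le> x \<and> x \<le> q \<and> f x \<noteq> g x" if "d > 0" for d
    using q(1) q(4)[of "max s (q - d)"] that by (intro exI[of _ "max s (q - d)"]) auto
  have qt: "q < t" using q assms by simp
  show ?thesis
    using that[OF q] merge_at_atom[OF f half_min_restrict[OF g less_imp_le[OF qt]] qt q(3) near] by blast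
qed

end

text \<open>What distinguishes \<^const>\<open>Omega_tilde\<close> within \<^const>\<open>Omega1\<close>, expressed on lifts.\<close>

locale simple_bottlenecks = bottlenecks +
  assumes shock_atoms: "(\<theta>, r, proj x) \<in> shocks \<mu> \<Longrightarrow> mass r x > 0 \<Longrightarrow> (\<theta>, r, proj x) \<in> GS \<mu>"
    and unique_atom: "(\<theta>, r, proj x) \<in> GS \<mu> \<Longrightarrow> mass r x > 0 \<Longrightarrow>
      (\<theta>, q, proj y) \<in> GS \<mu> \<Longrightarrow> mass q y > 0 \<Longrightarrow> r = q \<and> proj x = proj y"
begin

lemma shock_atom_unique:
  assumes "(\<theta>, r, proj x) \<in> shocks \<mu>" "mass r x > 0" "(\<theta>, q, proj y) \<in> shocks \<mu>" "mass q y > 0"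
  shows "r = q" "proj x = proj y"
  using unique_atom[OF shock_atoms[OF assms(1,2)] assms(2) shock_atoms[OF assms(3,4)] assms(4)] by auto

lemma extremal_meet: "bottleneck s a \<Longrightarrow> s + M \<le> t \<Longrightarrow> half_min \<theta> f t \<Longrightarrow> half_min \<theta> g t \<Longrightarrow> proj (f s) = proj (g s)"
  by (metis half_min_pass proj_shift(1))

text \<open>Both winding numbers \<open>0\<close> and \<open>-1\<close> are optimal for \<open>z\<close>, so the extremal lifts start at least one turn
  apart. If they met later, they would do so in an atom, and all minimizers to \<open>z\<close> would be caught
  between them and pass through it. This is stable under moving \<open>z\<close>, so \<open>z\<close> would be an interior point
  of the interval where one turn costs \<open>\<theta>\<close>.\<close>

lemma global_shock_at_lo_hi:
  assumes b: "bottleneck s a" "s + M \<le> t" and z: "z = lo s a \<theta> t \<or> z = hi s a \<theta> t"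
  shows "(\<theta>, t, proj z) \<in> GS \<mu>"
proof -
  have st: "s < t" using b M_pos by simp
  have z': "lo s a \<theta> t \<le> z" "z \<le> hi s a \<theta> t" using z lo_le_hi[OF st, of a \<theta>] by auto
  obtain f where f: "leftmost \<theta> f t" "f t = z" using extremal_exist by blast
  obtain g where g: "rightmost \<theta> g t" "g t = z" using extremal_exist by blast
  have hf: "half_min \<theta> f t" and hg: "half_min \<theta> g t" using f g by (auto simp: leftmost_def rightmost_def)
  have fg: "f r \<le> h r" "h r \<le> g r" if "half_min \<theta> h t" "h t = z" "r \<le> t" for h r
    using f g that by (auto simp: leftmost_def rightmost_def)
  obtain i :: int where i: "f s = a + of_int i" using half_min_pass[OF b(1) hf b(2)] by blast
  obtain j :: int where j: "g s = a + of_int j" using half_min_pass[OF b(1) hg b(2)] by blast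
  obtain h0 where h0: "half_min \<theta> h0 t" "h0 s = a + of_int 0" "h0 t = z"
    using half_min_with_winding_exists[OF b, of \<theta> z 0] z' by auto
  obtain h1 where h1: "half_min \<theta> h1 t" "h1 s = a + of_int (-1)" "h1 t = z"
    using half_min_with_winding_exists[OF b, of \<theta> z "-1"] z' by auto
  have ij: "i \<le> -1" "0 \<le> j"
    using fg(1)[OF h1(1,3), of s] fg(2)[OF h0(1,3), of s] i j h0 h1 st by auto
  have less: "f r < g r" if r: "s \<le> r" "r < t" for r
  proof (rule ccontr)
    assume "\<not> f r < g r"
    then have eq: "f r = g r" using fg(1)[OF hg g(2), of r] r by auto
    have "f s < g s" using i j ij by simp
    then obtain q where q: "s < q" "q \<le> r" "f q = g q" "mass q (f q) > 0"
      using meeting_atom[OF hf hg st _ eq r(1,2)] by blast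
    define \<rho> where "\<rho> = f q"
    have qt: "q < t" using q r by simp
    have all: "h q = \<rho>" if "half_min \<theta> h t" "h t = z" for h
      using fg[OF that, of q] q qt by (simp add: \<rho>_def)
    have "lo s a \<theta> q \<le> \<rho> - of_int j" "\<rho> - of_int i \<le> hi s a \<theta> q + 1"
      using half_min_winding[OF hg j q(1)] half_min_winding[OF hf i q(1)] qt q(3) by (auto simp: \<rho>_def)
    then have "lo s a \<theta> q \<le> \<rho>" "\<rho> \<le> hi s a \<theta> q" using ij by linarith+
    then have Dq: "turn_cost s a q \<rho> = \<theta>" using between_lo_hi_iff[OF q(1), of a \<theta> \<rho>] by simp
    have uniq: "v = \<rho>" if k: "lo s a \<theta> t \<le> z - of_int k" "z - of_int k \<le> hi s a \<theta> t + 1"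
      and le: "least_cost s (a + of_int k) q v + least_cost q v t z \<le> least_cost s (a + of_int k) t z" for k :: int and v
    proof -
      obtain p1 where p1: "geodesic p1 s q" "p1 s = a + of_int k" "p1 q = v" using geodesic_exists[OF q(1)] by blast
      obtain p2 where p2: "geodesic p2 q t" "p2 q = v" "p2 t = z" using geodesic_exists[OF qt] by blast
      let ?p = "\<lambda>x. if x \<le> q then p1 x else p2 x"
      have gp: "geodesic ?p s t" using p1 p2 le q qt by (intro geodesic_paste) auto
      obtain h where "half_min \<theta> h t" "\<And>x. s \<le> x \<Longrightarrow> h x = ?p x"
        using half_min_with_winding[OF b k gp] p1 p2 q qt st by auto
      then show ?thesis using all[of h] p1 p2 q qt st by simp
    qed
    have pos: "mass q \<rho> > 0" using q(4) by (simp add: \<rho>_def)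
    obtain e0 where e0: "e0 > 0" "\<And>z'. \<bar>z' - z\<bar> < e0 \<Longrightarrow> least_cost s a t z' = least_cost s a q \<rho> + least_cost q \<rho> t z'"
      using geodesics_through_atom_stable[OF q(1) qt pos, of a z] uniq[of 0] z' by auto
    obtain e1 where e1: "e1 > 0" "\<And>z'. \<bar>z' - z\<bar> < e1 \<Longrightarrow> least_cost s (a - 1) t z' = least_cost s (a - 1) q \<rho> + least_cost q \<rho> t z'"
      using geodesics_through_atom_stable[OF q(1) qt pos, of "a - 1" z] uniq[of "-1"] z' by auto
    have sh: "least_cost s (a - 1) t' y = least_cost s a t' (y + 1)" for t' y using least_cost_shift[of s "a - 1" 1 t' y] by simp
    define e where "e = min e0 e1 / 2"
    have e: "e > 0" "e < e0" "e < e1" using e0(1) e1(1) by (auto simp: e_def)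
    have turn_cost: "turn_cost s a t z' = \<theta>" if "\<bar>z' - z\<bar> \<le> e" for z'
    proof -
      have "least_cost s a t z' = least_cost s a q \<rho> + least_cost q \<rho> t z'" using that e by (intro e0(2)) auto
      moreover have "least_cost s (a - 1) t z' = least_cost s (a - 1) q \<rho> + least_cost q \<rho> t z'" using that e by (intro e1(2)) auto
      ultimately show ?thesis using Dq by (simp add: turn_cost_def sh)
    qed
    have "lo s a \<theta> t \<le> z - e" "z + e \<le> hi s a \<theta> t"
      using between_lo_hi_iff[OF st, of a \<theta> "z - e"] between_lo_hi_iff[OF st, of a \<theta> "z + e"] turn_cost e by auto
    then show False using z e(1) by auto
  qed
  have "\<exists>s<t. proj (f s) = proj (g s)" using extremal_meet[OF b hf hg] st by blast
  then have "(\<theta>, t, proj (f t)) \<in> GS \<mu>"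
    using global_shock_iff(1)[OF f(1) g(1)] f(2) g(2) less extremal_meet[OF b hf hg] st by auto
  then show ?thesis using f by simp
qed

text \<open>Otherwise the winding number of the rightmost path stays optimal for some endpoints left of \<open>z\<close>, and
  that of the leftmost path for some endpoints right of \<open>z\<close>. Such a minimizer crosses the leftmost
  (rightmost) path to \<open>z\<close>, which yields a path to \<open>z\<close> that merges with it in a shock on an atom
  after the last meeting \<open>T\<close> of the two extremal paths. As there is one such atom only, the extremal
  paths meet in it, contradicting the choice of \<open>T\<close>.\<close>

lemma global_shock_lo_or_hi:
  assumes b: "bottleneck s a" "s + M \<le> t" and gs: "(\<theta>, t, x) \<in> GS \<mu>"
  shows "x = proj (lo s a \<theta> t) \<or> x = proj (hi s a \<theta> t)"
proof -
  have st: "s < t" using b M_pos by simp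
  obtain z where z: "x = proj z" using proj_surj by blast
  obtain f where f: "leftmost \<theta> f t" "f t = z" using extremal_exist by blast
  obtain g where g: "rightmost \<theta> g t" "g t = z" using extremal_exist by blast
  have hf: "half_min \<theta> f t" and hg: "half_min \<theta> g t" using f g by (auto simp: leftmost_def rightmost_def)
  have left: "f r \<le> h r" and right: "h r \<le> g r" if "half_min \<theta> h t" "h t = z" "r \<le> t" for h r
    using f g that by (auto simp: leftmost_def rightmost_def)
  have "\<exists>s<t. proj (f s) = proj (g s)" using extremal_meet[OF b hf hg] st by blast
  then obtain T where T: "T < t" "g T = f T + 1" "\<And>r. T < r \<Longrightarrow> r < t \<Longrightarrow> proj (f r) \<noteq> proj (g r)"
    "\<And>r. T \<le> r \<Longrightarrow> r < t \<Longrightarrow> f r < g r"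
    using global_shock_iff(2)[OF f(1) g(1)] gs z f(2) g(2) by auto
  have sT: "s \<le> T"
    using T(3)[of s] st extremal_meet[OF b hf hg] by force
  obtain i :: int where i: "f s = a + of_int i" using half_min_pass[OF b(1) hf b(2)] by blast
  obtain j :: int where j: "g s = a + of_int j" using half_min_pass[OF b(1) hg b(2)] by blast
  have shift1: "half_min \<theta> (\<lambda>x. h x + 1) r" "half_min \<theta> (\<lambda>x. h x - 1) r" if "half_min \<theta> h r" for h r
    using that half_min_shift[of \<theta> h 1 r] half_min_shift[of \<theta> h "-1" r] by auto
  have ij: "i < j"
  proof -
    have "half_min \<theta> (\<lambda>x. g x - 1) T" using half_min_restrict[OF shift1(2)[OF hg], of T] T by simp
    then have "half_min \<theta> (\<lambda>x. if x \<le> T then g x - 1 else f x) t"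
      using T by (intro half_min_glue[OF hf]) auto
    then have "f s \<le> g s - 1" using left[of "\<lambda>x. if x \<le> T then g x - 1 else f x" s] sT T f by auto
    then show ?thesis using i j by simp
  qed
  have wi: "z - of_int i \<le> hi s a \<theta> t + 1" and wj: "lo s a \<theta> t \<le> z - of_int j"
    using half_min_winding[OF hf i st] half_min_winding[OF hg j st] f g by auto
  show ?thesis
  proof (rule ccontr)
    assume no: "\<not> ?thesis"
    have "z - of_int j \<noteq> lo s a \<theta> t"
    proof
      assume "z - of_int j = lo s a \<theta> t"
      then have "x = proj (lo s a \<theta> t)" using z proj_shift(3)[of z j] by simp
      then show False using no by simp
    qed
    then have lt1: "lo s a \<theta> t + of_int j < z" using wj by simp
    have "z - of_int (i + 1) \<noteq> hi s a \<theta> t"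
    proof
      assume "z - of_int (i + 1) = hi s a \<theta> t"
      then have "x = proj (hi s a \<theta> t)" using z proj_shift(3)[of z "i + 1"] by simp
      then show False using no by simp
    qed
    then have lt2: "z < hi s a \<theta> t + 1 + of_int i" using wi by simp
    note lh = lo_le_hi[OF st, of a \<theta>]
    \<comment> \<open>a minimizer of the winding number of \<open>g\<close> crosses \<open>f\<close>\<close>
    obtain h where h: "half_min \<theta> h t" "h s = a + of_int j" "h t = lo s a \<theta> t + of_int j"
      using half_min_with_winding_exists[OF b, of \<theta> "lo s a \<theta> t + of_int j" j] lh by auto
    have fh: "f s < h s" "h t < f t" using i h ij f lt1 by auto
    obtain r where r: "s < r" "r \<le> t" "f r = h r"
      using first_meeting[of s t f h] half_min_continuous[OF hf] half_min_continuous[OF h(1)] st fh by (metis less_imp_le)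
    have rt: "r < t" using r fh by (cases "r = t") auto
    let ?p = "\<lambda>x. if x \<le> r then h x else f x"
    have p: "half_min \<theta> ?p t" using r rt half_min_restrict[OF h(1), of r] by (intro half_min_glue[OF hf]) auto
    obtain q where q: "s < q" "q \<le> r" "\<And>x. q \<le> x \<Longrightarrow> x \<le> t \<Longrightarrow> ?p x = f x"
      "mass q (f q) > 0" "(\<theta>, q, proj (f q)) \<in> shocks \<mu>"
    proof (rule separation_atom[OF hf p r(1) rt])
      show "?p x = f x" if "r \<le> x" "x \<le> t" for x using that r by (cases "x = r") auto
      show "?p s \<noteq> f s" using r fh by simp
    qed blast
    have qT: "T < q"
    proof (rule ccontr)
      assume "\<not> T < q"
      then have qT: "q \<le> T" "s < T" using q by auto
      have "half_min \<theta> (\<lambda>x. ?p x + 1) T" using half_min_restrict[OF shift1(1)[OF p], of T] T by simp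
      then have "half_min \<theta> (\<lambda>x. if x \<le> T then ?p x + 1 else g x) t"
        using T q(3)[of T] qT by (intro half_min_glue[OF hg]) auto
      from right[OF this, of s] show False using qT T g r j h by simp
    qed
    \<comment> \<open>a minimizer of the winding number of \<open>f\<close> crosses \<open>g\<close>\<close>
    obtain h' where h': "half_min \<theta> h' t" "h' s = a + of_int i" "h' t = hi s a \<theta> t + 1 + of_int i"
      using half_min_with_winding_exists[OF b, of \<theta> "hi s a \<theta> t + 1 + of_int i" i] lh by auto
    have gh: "h' s < g s" "g t < h' t" using j h' ij g lt2 by auto
    obtain r' where r': "s < r'" "r' \<le> t" "h' r' = g r'"
      using first_meeting[of s t h' g] half_min_continuous[OF hg] half_min_continuous[OF h'(1)] st gh by (metis less_imp_le)
    have rt': "r' < t" using r' gh by (cases "r' = t") auto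
    let ?p' = "\<lambda>x. if x \<le> r' then h' x else g x"
    have p': "half_min \<theta> ?p' t" using r' rt' half_min_restrict[OF h'(1), of r'] by (intro half_min_glue[OF hg]) auto
    obtain q' where q': "s < q'" "q' \<le> r'" "\<And>x. q' \<le> x \<Longrightarrow> x \<le> t \<Longrightarrow> ?p' x = g x"
      "mass q' (g q') > 0" "(\<theta>, q', proj (g q')) \<in> shocks \<mu>"
    proof (rule separation_atom[OF hg p' r'(1) rt'])
      show "?p' x = g x" if "r' \<le> x" "x \<le> t" for x using that r' by (cases "x = r'") auto
      show "?p' s \<noteq> g s" using r' gh by simp
    qed blast
    have "q' = q" "proj (g q') = proj (f q)"
      using shock_atom_unique[OF q'(5,4) q(5,4)] by auto
    then show False using T(3)[of q] qT q r rt by simp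
  qed
qed

lemma GS_slice_eq:
  assumes "bottleneck s a" "s + M \<le> t"
  shows "GS_slice \<mu> \<theta> t = {proj (lo s a \<theta> t), proj (hi s a \<theta> t)}"
  using global_shock_at_lo_hi[OF assms] global_shock_lo_or_hi[OF assms] by (auto simp: GS_slice_def)

end

section \<open>Continuity in time\<close>

context environment
begin

lemma geodesic_short_time:
  assumes "s < t0" "e > 0"
  obtains d where "d > 0" "d < t0 - s"
    "\<And>f t t'. geodesic f s t' \<Longrightarrow> \<bar>f t' - f s\<bar> \<le> B \<Longrightarrow> \<bar>t - t0\<bar> < d \<Longrightarrow> \<bar>t' - t0\<bar> < d \<Longrightarrow> t < t' \<Longrightarrow> \<bar>f t' - f t\<bar> \<le> e"
proof -
  define h where "h = (t0 - s) / 2"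
  define C where "C = B\<^sup>2 / h + 4 * strip_mass s (t0 + h) + 1"
  have h: "h > 0" using assms by (simp add: h_def)
  have "B\<^sup>2 / h \<ge> 0" using h by simp
  then have C: "C > 0" using strip_mass_nonneg[of s "t0 + h"] unfolding C_def by linarith
  define d where "d = min h (e\<^sup>2 / (2 * C))"
  have d: "d > 0" "d \<le> h" "d \<le> e\<^sup>2 / (2 * C)" using h C assms by (auto simp: d_def)
  show ?thesis
  proof (rule that[OF d(1)])
    show "d < t0 - s" using d(2) h by (simp add: h_def)
    fix f t t' assume g: "geodesic f s t'" "\<bar>f t' - f s\<bar> \<le> B" and t: "\<bar>t - t0\<bar> < d" "\<bar>t' - t0\<bar> < d" "t < t'"
    have st: "s < t" "h \<le> t' - s" "t' \<le> t0 + h" using t d h by (auto simp: h_def abs_less_iff field_simps)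
    have "(f t' - f t)\<^sup>2 \<le> 2 * (t' - t) * ((f t' - f s)\<^sup>2 / (2 * (t' - s)) + 2 * strip_mass s t')"
      by (rule geodesic_oscillation[OF g(1) st(1) t(3)])
    also have "\<dots> = (t' - t) * ((f t' - f s)\<^sup>2 / (t' - s) + 4 * strip_mass s t')"
    proof -
      have "2 * u * (x / (2 * v) + 2 * y) = u * (x / v + 4 * y)" for u v x y :: real
        by (simp add: algebra_simps)
      then show ?thesis .
    qed
    also have "\<dots> \<le> (t' - t) * C"
    proof (rule mult_left_mono)
      have "(f t' - f s)\<^sup>2 \<le> B\<^sup>2" using g(2) by (simp add: abs_le_square_iff[symmetric])
      then have "(f t' - f s)\<^sup>2 / (t' - s) \<le> B\<^sup>2 / h" using st h by (intro frac_le) auto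
      moreover have "strip_mass s t' \<le> strip_mass s (t0 + h)" using st by (intro strip_mass_mono) auto
      ultimately show "(f t' - f s)\<^sup>2 / (t' - s) + 4 * strip_mass s t' \<le> C" unfolding C_def by linarith
    qed (use t in simp)
    also have "\<dots> \<le> (2 * d) * C" using t C by (intro mult_right_mono) auto
    also have "\<dots> \<le> e\<^sup>2" using d(3) C by (simp add: pos_le_divide_eq algebra_simps)
    finally have "\<bar>f t' - f t\<bar> \<le> \<bar>e\<bar>" by (simp add: abs_le_square_iff)
    then show "\<bar>f t' - f t\<bar> \<le> e" using assms by simp
  qed
qed

text \<open>By the maximum principle, moving in time is dominated by moving in space by the distance that a
  geodesic can travel.\<close>

lemma turn_cost_compare:
  assumes "s < t0" "0 < e" "e \<le> 1"
  obtains d where "d > 0" "d < t0 - s"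
    "\<And>t z. \<bar>t - t0\<bar> < d \<Longrightarrow> \<bar>z - p\<bar> \<le> 1 \<Longrightarrow>
      turn_cost s a t (z - e) \<le> turn_cost s a t0 z \<and> turn_cost s a t0 z \<le> turn_cost s a t (z + e)"
proof -
  define B where "B = \<bar>p\<bar> + \<bar>a\<bar> + 3"
  obtain d where d: "d > 0" "d < t0 - s"
    "\<And>f t t'. geodesic f s t' \<Longrightarrow> \<bar>f t' - f s\<bar> \<le> B \<Longrightarrow> \<bar>t - t0\<bar> < d \<Longrightarrow> \<bar>t' - t0\<bar> < d \<Longrightarrow> t < t' \<Longrightarrow> \<bar>f t' - f t\<bar> \<le> e"
    using geodesic_short_time[OF assms(1,2)] by metis
  have step: "turn_cost s a t (z - e) \<le> turn_cost s a t' z \<and> turn_cost s a t' z \<le> turn_cost s a t (z + e)"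
    if *: "\<bar>z - p\<bar> \<le> 2" "\<bar>t - t0\<bar> < d" "\<bar>t' - t0\<bar> < d" "t < t'" for t t' z
  proof -
    have st: "s < t" "s < t'" using * d(2) by auto
    interpret monotone_onto "turn_cost s a t" by (rule monotone_onto_turn_cost[OF st(1)])
    obtain f where f: "geodesic f s t'" "f s = a" "f t' = z" using geodesic_exists[OF st(2)] by blast
    have "\<bar>f t' - f t\<bar> \<le> e" using * f by (intro d(3)) (auto simp: B_def)
    then have "f t \<le> z + e" using f by linarith
    then have up: "turn_cost s a t' z \<le> turn_cost s a t (z + e)"
      using turn_cost_le_along[OF f(1) st(1) *(4)] mono[of "f t" "z + e"] f by simp
    obtain g where g: "geodesic g s t'" "g s = a" "g t' = z + 1" using geodesic_exists[OF st(2)] by blast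
    have "\<bar>g t' - g t\<bar> \<le> e" using * g by (intro d(3)) (auto simp: B_def)
    then have "z - e \<le> g t - 1" using g by linarith
    then have "turn_cost s a t (z - e) \<le> turn_cost s a t' z"
      using turn_cost_ge_along[OF g(1) st(1) *(4)] mono[of "z - e" "g t - 1"] g by simp
    then show ?thesis using up by blast
  qed
  show ?thesis
  proof (rule that[OF d(1,2)])
    fix t z assume *: "\<bar>t - t0\<bar> < d" "\<bar>z - p\<bar> \<le> 1"
    interpret monotone_onto "turn_cost s a t0" by (rule monotone_onto_turn_cost[OF assms(1)])
    have near: "\<bar>z - p\<bar> \<le> 2" "\<bar>z - e - p\<bar> \<le> 2" "\<bar>z + e - p\<bar> \<le> 2" using * assms by auto
    consider "t = t0" | "t < t0" | "t0 < t" by linarith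
    then show "turn_cost s a t (z - e) \<le> turn_cost s a t0 z \<and> turn_cost s a t0 z \<le> turn_cost s a t (z + e)"
    proof cases
      case 1
      then show ?thesis using mono[of "z - e" z] mono[of z "z + e"] assms by simp
    next
      case 2
      then show ?thesis using step[OF near(1), of t t0] * d(1) by simp
    next
      case 3
      then show ?thesis using step[OF near(2), of t0 t] step[OF near(3), of t0 t] * d(1) by simp
    qed
  qed
qed

lemma isCont_lo:
  assumes "s < t0" shows "isCont (lo s a \<theta>) t0"
  unfolding continuous_at_eps_delta
proof (intro allI impI)
  fix e' :: real assume "e' > 0"
  define e where "e = min (e' / 3) 1"
  define p where "p = lo s a \<theta> t0"
  have e: "0 < e" "e \<le> 1" "2 * e < e'" using \<open>e' > 0\<close> by (auto simp: e_def min_def)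
  obtain d where d: "d > 0" "d < t0 - s"
    "\<And>t z. \<bar>t - t0\<bar> < d \<Longrightarrow> \<bar>z - p\<bar> \<le> 1 \<Longrightarrow>
      turn_cost s a t (z - e) \<le> turn_cost s a t0 z \<and> turn_cost s a t0 z \<le> turn_cost s a t (z + e)"
    using turn_cost_compare[OF assms e(1,2)] by metis
  have at0: "\<theta> \<le> turn_cost s a t0 p" "turn_cost s a t0 (p - e) < \<theta>"
    using lo_le_iff[OF assms, of a \<theta> p] lo_le_iff[OF assms, of a \<theta> "p - e"] e by (auto simp: p_def)
  have "dist (lo s a \<theta> t) p < e'" if t: "dist t t0 < d" for t
  proof -
    have st: "s < t" using t d(2) by (auto simp: dist_real_def)
    have "turn_cost s a t0 p \<le> turn_cost s a t (p + e)" "turn_cost s a t (p - e - e) \<le> turn_cost s a t0 (p - e)"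
      using d(3)[of t p] d(3)[of t "p - e"] t e by (auto simp: dist_real_def)
    then have "lo s a \<theta> t \<le> p + e" "\<not> lo s a \<theta> t \<le> p - e - e"
      unfolding lo_le_iff[OF st] using at0 by auto
    then show ?thesis using e by (auto simp: dist_real_def)
  qed
  then show "\<exists>d>0. \<forall>t. dist t t0 < d \<longrightarrow> dist (lo s a \<theta> t) (lo s a \<theta> t0) < e'"
    using d(1) unfolding p_def by blast
qed

lemma isCont_hi:
  assumes "s < t0" shows "isCont (hi s a \<theta>) t0"
  unfolding continuous_at_eps_delta
proof (intro allI impI)
  fix e' :: real assume "e' > 0"
  define e where "e = min (e' / 3) 1"
  define p where "p = hi s a \<theta> t0"
  have e: "0 < e" "e \<le> 1" "2 * e < e'" using \<open>e' > 0\<close> by (auto simp: e_def min_def)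
  obtain d where d: "d > 0" "d < t0 - s"
    "\<And>t z. \<bar>t - t0\<bar> < d \<Longrightarrow> \<bar>z - p\<bar> \<le> 1 \<Longrightarrow>
      turn_cost s a t (z - e) \<le> turn_cost s a t0 z \<and> turn_cost s a t0 z \<le> turn_cost s a t (z + e)"
    using turn_cost_compare[OF assms e(1,2)] by metis
  have at0: "turn_cost s a t0 p \<le> \<theta>" "\<theta> < turn_cost s a t0 (p + e)"
    using le_hi_iff[OF assms, of p a \<theta>] le_hi_iff[OF assms, of "p + e" a \<theta>] e by (auto simp: p_def)
  have "dist (hi s a \<theta> t) p < e'" if t: "dist t t0 < d" for t
  proof -
    have st: "s < t" using t d(2) by (auto simp: dist_real_def)
    have "turn_cost s a t (p - e) \<le> turn_cost s a t0 p" "turn_cost s a t0 (p + e) \<le> turn_cost s a t (p + e + e)"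
      using d(3)[of t p] d(3)[of t "p + e"] t e by (auto simp: dist_real_def)
    then have "p - e \<le> hi s a \<theta> t" "\<not> p + e + e \<le> hi s a \<theta> t"
      unfolding le_hi_iff[OF st] using at0 by auto
    then show ?thesis using e by (auto simp: dist_real_def)
  qed
  then show "\<exists>d>0. \<forall>t. dist t t0 < d \<longrightarrow> dist (hi s a \<theta> t) (hi s a \<theta> t0) < e'"
    using d(1) unfolding p_def by blast
qed

end

section \<open>The two global shocks\<close>

context simple_bottlenecks
begin

text \<open>With equal costs of a turn at \<open>z < z'\<close>, winding number 0 is optimal for \<open>z\<close> and -1 for \<open>z'\<close>. The
  corresponding minimizers are in opposite order at the two ends, so they meet, for the first time
  at an atom on the shock set.\<close>

lemma flat_crossing:
  assumes b: "bottleneck s a" "s + M \<le> t" and z: "lo s a \<theta> t \<le> z" "z < z'" "z' \<le> hi s a \<theta> t"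
  obtains h g r where "half_min \<theta> h t" "h s = a" "h t = z" "half_min \<theta> g t" "g s = a - 1" "g t = z'"
    "s < r" "r < t" "g r = h r" "mass r (h r) > 0" "(\<theta>, r, proj (h r)) \<in> shocks \<mu>" "turn_cost s a r (h r) = \<theta>"
proof -
  have st: "s < t" using b M_pos by simp
  obtain h where h: "half_min \<theta> h t" "h s = a + of_int 0" "h t = z"
    using half_min_with_winding_exists[OF b, of \<theta> z 0] z by auto
  obtain g where g: "half_min \<theta> g t" "g s = a + of_int (-1)" "g t = z'"
    using half_min_with_winding_exists[OF b, of \<theta> z' "-1"] z by auto
  obtain r0 where r0: "s < r0" "r0 \<le> t" "g r0 = h r0"
    using first_meeting[of s t g h] half_min_continuous[OF g(1)] half_min_continuous[OF h(1)] st g h z(2)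
    by (metis add.right_neutral add_less_cancel_left less_imp_le neg_less_0_iff_less of_int_0 of_int_less_0_iff zero_less_one)
  have r0t: "r0 < t" using r0 g h z by (cases "r0 = t") auto
  have "g s < h s" using g h by simp
  then obtain r where r: "s < r" "r \<le> r0" "g r = h r" "mass r (g r) > 0" "(\<theta>, r, proj (g r)) \<in> shocks \<mu>"
    using meeting_atom[OF g(1) h(1) st _ r0(3) _ r0t] r0 by (metis less_imp_le)
  have "r \<le> t" using r r0 by simp
  then have "lo s a \<theta> r \<le> h r" "h r \<le> hi s a \<theta> r"
    using half_min_winding[OF h(1,2) r(1)] half_min_winding[OF g(1,2) r(1)] r(3) by auto
  then have "turn_cost s a r (h r) = \<theta>" using between_lo_hi_iff[OF r(1), of a \<theta> "h r"] by simp
  then show ?thesis using that[of h g r] h g r r0 r0t by simp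
qed

text \<open>If the interval were longer than a turn, a minimizer with winding number -2 would cross one with
  winding number 0 as well as its shift by a turn. Both crossings lead to the only atom on the
  shock set, but at different lifts of it.\<close>

lemma width_le_1:
  assumes b: "bottleneck s a" "s + M \<le> t"
  shows "hi s a \<theta> t \<le> lo s a \<theta> t + 1"
proof (rule ccontr)
  assume "\<not> ?thesis"
  then have w: "lo s a \<theta> t < hi s a \<theta> t - 1" by simp
  have st: "s < t" using b M_pos by simp
  obtain h where h: "half_min \<theta> h t" "h s = a + of_int 0" "h t = lo s a \<theta> t"
    using half_min_with_winding_exists[OF b, of \<theta> "lo s a \<theta> t" 0] w by auto
  obtain g where g: "half_min \<theta> g t" "g s = a + of_int (-2)" "g t = hi s a \<theta> t - 1"
    using half_min_with_winding_exists[OF b, of \<theta> "hi s a \<theta> t - 1" "-2"] w by auto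
  have h1: "half_min \<theta> (\<lambda>x. h x - 1) t" using half_min_shift[of \<theta> h "-1" t] h(1) by simp
  have cross: "\<exists>q. g q = p q \<and> mass q (g q) > 0 \<and> (\<theta>, q, proj (g q)) \<in> shocks \<mu>"
    if p: "half_min \<theta> p t" "g s < p s" "p t < g t" for p
  proof -
    obtain r where r: "s < r" "r \<le> t" "g r = p r"
      using first_meeting[of s t g p] half_min_continuous[OF g(1)] half_min_continuous[OF p(1)] st p by (metis less_imp_le)
    have rt: "r < t" using r p by (cases "r = t") auto
    show ?thesis
      using meeting_atom[OF g(1) p(1) st p(2) r(3) less_imp_le[OF r(1)] rt] by metis
  qed
  obtain q where q: "g q = h q" "mass q (g q) > 0" "(\<theta>, q, proj (g q)) \<in> shocks \<mu>"
    using cross[OF h(1)] g h w by auto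
  obtain q' where q': "g q' = h q' - 1" "mass q' (g q') > 0" "(\<theta>, q', proj (g q')) \<in> shocks \<mu>"
    using cross[OF h1] g h w by auto
  have "q = q'" using shock_atom_unique(1)[OF q(3,2) q'(3,2)] .
  then show False using q(1) q'(1) by simp
qed

lemma proj_lo_hi_eq_iff:
  assumes b: "bottleneck s a" "s + M \<le> t"
  shows "proj (lo s a \<theta> t) = proj (hi s a \<theta> t) \<longleftrightarrow> hi s a \<theta> t - lo s a \<theta> t \<in> {0, 1}"
proof
  assume "proj (lo s a \<theta> t) = proj (hi s a \<theta> t)"
  then obtain k :: int where k: "hi s a \<theta> t = lo s a \<theta> t + of_int k" using proj_eqE by metis
  have "s < t" using b M_pos by simp
  then have "k \<in> {0..1}" using lo_le_hi[of s t a \<theta>] width_le_1[OF b, of \<theta>] k by auto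
  then have "k = 0 \<or> k = 1" by auto
  then show "hi s a \<theta> t - lo s a \<theta> t \<in> {0, 1}" using k by auto
next
  assume "hi s a \<theta> t - lo s a \<theta> t \<in> {0, 1}"
  then have "hi s a \<theta> t = lo s a \<theta> t \<or> hi s a \<theta> t = lo s a \<theta> t + 1" by auto
  then show "proj (lo s a \<theta> t) = proj (hi s a \<theta> t)" by auto
qed

text \<open>If the two shocks separated again after having merged at time \<open>t\<close>, the crossing minimizers would be
  together at time \<open>t\<close> in the global shock. There one can arrive along different extremal paths
  without bending, so there would be a second atom on the shock set.\<close>

lemma width_0_persists:
  assumes b: "bottleneck s a" "s + M \<le> t" "t < t'" and eq: "lo s a \<theta> t = hi s a \<theta> t"
    and atom: "(\<theta>, r0, proj x0) \<in> shocks \<mu>" "mass r0 x0 > 0" "r0 < t"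
  shows "lo s a \<theta> t' = hi s a \<theta> t'"
proof (rule ccontr)
  assume ne: "lo s a \<theta> t' \<noteq> hi s a \<theta> t'"
  have st: "s < t" "s < t'" "s + M \<le> t'" using b M_pos by auto
  have "lo s a \<theta> t' < hi s a \<theta> t'" using ne lo_le_hi[OF st(2), of a \<theta>] by simp
  then obtain h g r where h: "half_min \<theta> h t'" "h s = a" and g: "half_min \<theta> g t'" "g s = a - 1"
    and r: "s < r" "r < t'" "g r = h r" "mass r (h r) > 0" "(\<theta>, r, proj (h r)) \<in> shocks \<mu>"
    using flat_crossing[OF b(1) st(3) order_refl _ order_refl] by blast
  have r0: "r = r0" using shock_atom_unique(1)[OF r(5,4) atom(1,2)] .
  let ?p = "\<lambda>x. if x \<le> r then g x else h x"
  have p: "half_min \<theta> ?p t'" using half_min_restrict[OF g(1), of r] r by (intro half_min_glue[OF h(1)]) auto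
  have "lo s a \<theta> t \<le> h t" using half_min_winding(1)[OF h(1), of s a 0 t] h(2) st b by simp
  moreover have "h t \<le> hi s a \<theta> t"
    using half_min_winding(2)[OF p, of s a "-1" t] g(2) st b r atom(3) r0 by simp
  ultimately have ht: "h t = lo s a \<theta> t" using eq by simp
  then have gs: "(\<theta>, t, proj (h t)) \<in> shocks \<mu>"
    using global_shock_at_lo_hi[OF b(1,2), of "h t"] by (simp add: GS_def)
  obtain L where L: "leftmost \<theta> L t" "L t = h t" using extremal_exist by blast
  obtain R where R: "rightmost \<theta> R t" "R t = h t" using extremal_exist by blast
  have hL: "half_min \<theta> L t" and hR: "half_min \<theta> R t" using L R by (auto simp: leftmost_def rightmost_def)
  let ?q = "\<lambda>x. if x \<le> t then L x else h x"
  have q: "half_min \<theta> ?q t'" using b(3) L(2) by (intro half_min_glue[OF h(1) hL]) auto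
  have near: "\<exists>x. t - d \<le> x \<and> x \<le> t \<and> ?q x \<noteq> R x" if "d > 0" for d
  proof -
    have "(\<theta>, t, proj (L t)) \<in> shocks \<mu>" using gs L by simp
    then have "\<exists>x. t - d \<le> x \<and> x \<le> t \<and> L x \<noteq> R x" using shock_iff(1)[OF L(1) R(1)] L R that by auto
    then show ?thesis by auto
  qed
  have "mass t (?q t) > 0" "(\<theta>, t, proj (?q t)) \<in> shocks \<mu>"
    using merge_at_atom[OF q hR b(3) _ near] L R by auto
  then have "t = r0" using shock_atom_unique(1)[OF _ _ atom(1,2)] by blast
  then show False using atom(3) by simp
qed

text \<open>At width 1 every point at time \<open>t\<close> is reached with two winding numbers, hence so is every point at
  a later time.\<close>

lemma width_1_persists:
  assumes b: "bottleneck s a" "s + M \<le> t" "t < t'" and ge: "lo s a \<theta> t + 1 \<le> hi s a \<theta> t"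
  shows "lo s a \<theta> t' + 1 \<le> hi s a \<theta> t'"
proof (rule ccontr)
  assume "\<not> ?thesis"
  then have lt: "hi s a \<theta> t' < lo s a \<theta> t' + 1" by simp
  \<comment> \<open>a point in the gap between \<open>hi\<close> and the next lift of \<open>lo\<close>\<close>
  define z where "z = (hi s a \<theta> t' + lo s a \<theta> t' + 1) / 2"
  have z: "hi s a \<theta> t' < z" "z < lo s a \<theta> t' + 1" using lt by (auto simp: z_def)
  obtain f where "leftmost \<theta> f t'" "f t' = z" using extremal_exist by blast
  then have f: "half_min \<theta> f t'" "f t' = z" by (auto simp: leftmost_def)
  define k where "k = \<lfloor>f t - lo s a \<theta> t\<rfloor>"
  have k: "lo s a \<theta> t \<le> f t - of_int k" "f t - of_int k < lo s a \<theta> t + 1" unfolding k_def by linarith+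
  have st: "s < t" "s < t'" using b M_pos by auto
  obtain p where p: "half_min \<theta> p t" "p s = a + of_int k" "p t = f t"
    using half_min_with_winding_exists[OF b(1,2), of \<theta> "f t" k] k ge by auto
  obtain q where q: "half_min \<theta> q t" "q s = a + of_int (k - 1)" "q t = f t"
    using half_min_with_winding_exists[OF b(1,2), of \<theta> "f t" "k - 1"] k ge by auto
  have glue: "half_min \<theta> (\<lambda>x. if x \<le> t then h x else f x) t'" if "half_min \<theta> h t" "h t = f t" for h
    using that b(3) by (intro half_min_glue[OF f(1)]) auto
  have "lo s a \<theta> t' \<le> z - of_int k"
    using half_min_winding(1)[OF glue[OF p(1,3)], of s a k t'] p(2) st b f(2) by simp
  moreover have "z - of_int k \<le> hi s a \<theta> t'"
    using half_min_winding(2)[OF glue[OF q(1,3)], of s a "k - 1" t'] q(2) st b f(2) by simp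
  ultimately have "of_int k < (1::real)" "(0::real) < of_int k" using z by linarith+
  then show False by simp
qed

text \<open>Just after the atom all minimizers near its position come from the atom, for both winding numbers,
  and at the atom one more turn costs \<open>\<theta>\<close>.\<close>

lemma fan_opens:
  assumes b: "bottleneck s a" "s + M \<le> r" and gs: "(\<theta>, r, proj x) \<in> GS \<mu>" "mass r x > 0"
  obtains d where "d > 0" "\<And>t. r < t \<Longrightarrow> t < r + d \<Longrightarrow> lo s a \<theta> t < hi s a \<theta> t"
proof -
  have sr: "s < r" using b M_pos by simp
  obtain \<rho> where \<rho>: "\<rho> = lo s a \<theta> r \<or> \<rho> = hi s a \<theta> r" "proj \<rho> = proj x"
    using global_shock_lo_or_hi[OF b gs(1)] by metis
  have m: "mass r \<rho> > 0" using gs(2) \<rho>(2) by (simp add: mass_def)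
  have turn_cost\<rho>: "turn_cost s a r \<rho> = \<theta>"
    using between_lo_hi_iff[OF sr, of a \<theta> \<rho>] lo_le_hi[OF sr, of a \<theta>] \<rho>(1) by auto
  obtain d0 where d0: "d0 > 0" "\<And>t v. r < t \<Longrightarrow> t < r + d0 \<Longrightarrow> least_cost s a r v + least_cost r v t \<rho> \<le> least_cost s a t \<rho> \<Longrightarrow> v = \<rho>"
    using geodesics_after_atom[OF sr m, of a] by blast
  obtain d1 where d1: "d1 > 0" "\<And>t v. r < t \<Longrightarrow> t < r + d1 \<Longrightarrow> least_cost s (a - 1) r v + least_cost r v t \<rho> \<le> least_cost s (a - 1) t \<rho> \<Longrightarrow> v = \<rho>"
    using geodesics_after_atom[OF sr m, of "a - 1"] by blast
  have sh: "least_cost s (a - 1) t' y = least_cost s a t' (y + 1)" for t' y using least_cost_shift[of s "a - 1" 1 t' y] by simp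
  show ?thesis
  proof (rule that[of "min d0 d1"])
    fix t assume t: "r < t" "t < r + min d0 d1"
    then have st: "s < t" using sr by simp
    obtain e0 where e0: "e0 > 0" "\<And>z'. \<bar>z' - \<rho>\<bar> < e0 \<Longrightarrow> least_cost s a t z' = least_cost s a r \<rho> + least_cost r \<rho> t z'"
      using geodesics_through_atom_stable[OF sr t(1) m, of a \<rho>] d0(2)[of t] t by auto
    obtain e1 where e1: "e1 > 0" "\<And>z'. \<bar>z' - \<rho>\<bar> < e1 \<Longrightarrow> least_cost s (a - 1) t z' = least_cost s (a - 1) r \<rho> + least_cost r \<rho> t z'"
      using geodesics_through_atom_stable[OF sr t(1) m, of "a - 1" \<rho>] d1(2)[of t] t by auto
    define e where "e = min e0 e1 / 2"
    have e: "e > 0" "e < e0" "e < e1" using e0(1) e1(1) by (auto simp: e_def)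
    have turn_cost: "turn_cost s a t z' = \<theta>" if "\<bar>z' - \<rho>\<bar> \<le> e" for z'
    proof -
      have "least_cost s a t z' = least_cost s a r \<rho> + least_cost r \<rho> t z'" using that e by (intro e0(2)) auto
      moreover have "least_cost s (a - 1) t z' = least_cost s (a - 1) r \<rho> + least_cost r \<rho> t z'" using that e by (intro e1(2)) auto
      ultimately show ?thesis using turn_cost\<rho> by (simp add: turn_cost_def sh)
    qed
    have "lo s a \<theta> t \<le> \<rho>" "\<rho> + e \<le> hi s a \<theta> t"
      using between_lo_hi_iff[OF st, of a \<theta> \<rho>] between_lo_hi_iff[OF st, of a \<theta> "\<rho> + e"] turn_cost e by auto
    then show "lo s a \<theta> t < hi s a \<theta> t" using e(1) by linarith
  qed (use d0 d1 in simp)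
qed

text \<open>Such a drift is the cost of one turn at one of the atoms, and on a bounded set of drifts only
  finitely many lifts of the atoms come into play.\<close>

lemma finite_flat_drifts:
  assumes b: "bottleneck s a" "s + M \<le> t"
  shows "finite {\<theta> \<in> {c..d}. lo s a \<theta> t \<noteq> hi s a \<theta> t}"
proof -
  have st: "s < t" using b M_pos by simp
  let ?F = "\<Union>r\<in>(atom_times \<inter> {s..t}) - {s}. turn_cost s a r ` {\<rho> \<in> {lo s a c r..hi s a d r}. mass r \<rho> > 0}"
  have "{\<theta> \<in> {c..d}. lo s a \<theta> t \<noteq> hi s a \<theta> t} \<subseteq> ?F"
  proof
    fix \<theta> assume \<theta>: "\<theta> \<in> {\<theta> \<in> {c..d}. lo s a \<theta> t \<noteq> hi s a \<theta> t}"
    then have "lo s a \<theta> t < hi s a \<theta> t" using lo_le_hi[OF st, of a \<theta>] by auto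
    then obtain h r where r: "s < r" "r < t" "mass r (h r) > 0" "turn_cost s a r (h r) = \<theta>"
      using flat_crossing[OF b, of \<theta> "lo s a \<theta> t" "hi s a \<theta> t"] by (metis order_refl)
    have "r \<in> atom_times" using r(3) mass_0[of r "h r"] by auto
    moreover have "h r \<in> {lo s a c r..hi s a d r}"
      using lo_le_iff[OF r(1), of a c "h r"] le_hi_iff[OF r(1), of "h r" a d] r(4) \<theta> by auto
    ultimately show "\<theta> \<in> ?F" using r by (intro UN_I[of r] image_eqI[of _ _ "h r"]) auto
  qed
  moreover have "finite ?F"
    by (intro finite_UN_I finite_Diff finite_atom_times finite_imageI finite_mass_pos)
  ultimately show ?thesis by (rule finite_subset)
qed

text \<open>The part of \<^const>\<open>global_shock_functions\<close> that concerns a single time.\<close>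

definition shock_pair :: "real \<Rightarrow> (real \<Rightarrow> torus) \<Rightarrow> (real \<Rightarrow> torus) \<Rightarrow> bool"
  where "shock_pair t u v \<longleftrightarrow> (\<forall>\<theta>. GS_slice \<mu> \<theta> t = {u \<theta>, v \<theta>}) \<and>
    piecewise_continuous u \<and> piecewise_continuous v \<and> no_accumulation {\<theta>. u \<theta> \<noteq> v \<theta>} \<and>
    (\<forall>\<theta>. \<forall>w\<in>{u, v}. (w \<longlongrightarrow> u \<theta>) (at_left \<theta>) \<and> (w \<longlongrightarrow> v \<theta>) (at_right \<theta>))"

lemma global_shock_functions_iff:
  "global_shock_functions \<mu> sL sR \<longleftrightarrow> (\<forall>t. shock_pair t (\<lambda>\<theta>. sL \<theta> t) (\<lambda>\<theta>. sR \<theta> t))"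
  unfolding global_shock_functions_def shock_pair_def by auto

lemma shock_pair_lo_hi:
  assumes b: "bottleneck s a" "s + M \<le> t"
  shows "shock_pair t (\<lambda>\<theta>. proj (lo s a \<theta> t)) (\<lambda>\<theta>. proj (hi s a \<theta> t))" (is "shock_pair t ?u ?v")
proof -
  have st: "s < t" using b M_pos by simp
  interpret monotone_onto "turn_cost s a t" by (rule monotone_onto_turn_cost[OF st])
  have cp: "isCont proj z" for z using continuous_on_proj[of UNIV] by (simp add: continuous_on_eq_continuous_at)
  have lim: "(?u \<longlongrightarrow> ?u \<theta>) (at_left \<theta>)" "(?v \<longlongrightarrow> ?u \<theta>) (at_left \<theta>)"
    "(?u \<longlongrightarrow> ?v \<theta>) (at_right \<theta>)" "(?v \<longlongrightarrow> ?v \<theta>) (at_right \<theta>)" for \<theta>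
    by (intro isCont_tendsto_compose[OF cp] inverses_tendsto_left inverses_tendsto_right)+
  have na: "no_accumulation {\<theta>. ?u \<theta> \<noteq> ?v \<theta>}"
    unfolding no_accumulation_def
  proof (intro allI notI)
    fix p assume "p islimpt {\<theta>. ?u \<theta> \<noteq> ?v \<theta>}"
    then have "infinite ({\<theta>. ?u \<theta> \<noteq> ?v \<theta>} \<inter> ball p 1)" by (simp add: islimpt_eq_infinite_ball)
    moreover have "{\<theta>. ?u \<theta> \<noteq> ?v \<theta>} \<inter> ball p 1 \<subseteq> {\<theta> \<in> {p - 1..p + 1}. lo s a \<theta> t \<noteq> hi s a \<theta> t}"
      by (auto simp: dist_real_def)
    ultimately show False using finite_flat_drifts[OF b, of "p - 1" "p + 1"] finite_subset by blast
  qed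
  have "piecewise_continuous w" if "w \<in> {?u, ?v}" for w
    unfolding piecewise_continuous_def
  proof (intro conjI exI[of _ "{\<theta>. ?u \<theta> \<noteq> ?v \<theta>}"] na allI impI)
    fix \<theta> assume "\<theta> \<notin> {\<theta>. ?u \<theta> \<noteq> ?v \<theta>}"
    then show "isCont w \<theta>" using that lim[of \<theta>] by (auto simp: isCont_def filterlim_at_split)
  next
    fix \<theta>
    show "\<exists>l. (w \<longlongrightarrow> l) (at_left \<theta>)" "\<exists>l. (w \<longlongrightarrow> l) (at_right \<theta>)" using that lim[of \<theta>] by blast+
  qed
  then show ?thesis
    unfolding shock_pair_def using GS_slice_eq[OF b] na lim by auto
qed

text \<open>Off a set without accumulation points both pairs consist of twice the only element of the slice;
  one-sided limits determine the rest. In particular the pair obtained from a bottleneck does not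
  depend on the bottleneck.\<close>

lemma shock_pair_unique:
  assumes 1: "shock_pair t u v" and 2: "shock_pair t u' v'"
  shows "u = u'" "v = v'"
proof -
  have ev: "\<forall>\<^sub>F y in at \<theta>. u y = u' y \<and> v y = v' y" for \<theta>
  proof -
    have "\<forall>\<^sub>F y in at \<theta>. y \<notin> {y. u y \<noteq> v y}" "\<forall>\<^sub>F y in at \<theta>. y \<notin> {y. u' y \<noteq> v' y}"
      using 1 2 unfolding shock_pair_def no_accumulation_def islimpt_iff_eventually by blast+
    then show ?thesis
    proof eventually_elim
      case (elim y)
      have "{u y, v y} = {u' y, v' y}" using 1 2 unfolding shock_pair_def by metis
      then show ?case using elim by auto
    qed
  qed
  have l: "\<forall>\<^sub>F y in at_left \<theta>. u y = u' y" and r: "\<forall>\<^sub>F y in at_right \<theta>. v y = v' y" for \<theta>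
    using ev[of \<theta>] by (auto simp: eventually_at_split elim: eventually_mono)
  have "u \<theta> = u' \<theta>" for \<theta>
  proof -
    have "(u \<longlongrightarrow> u \<theta>) (at_left \<theta>)" "(u' \<longlongrightarrow> u' \<theta>) (at_left \<theta>)" using 1 2 by (auto simp: shock_pair_def)
    then have "(u' \<longlongrightarrow> u \<theta>) (at_left \<theta>)" using tendsto_cong[OF l] by blast
    then show ?thesis using \<open>(u' \<longlongrightarrow> u' \<theta>) (at_left \<theta>)\<close> tendsto_unique trivial_limit_at_left_real by blast
  qed
  then show "u = u'" by blast
  have "v \<theta> = v' \<theta>" for \<theta>
  proof -
    have "(v \<longlongrightarrow> v \<theta>) (at_right \<theta>)" "(v' \<longlongrightarrow> v' \<theta>) (at_right \<theta>)" using 1 2 by (auto simp: shock_pair_def)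
    then have "(v' \<longlongrightarrow> v \<theta>) (at_right \<theta>)" using tendsto_cong[OF r] by blast
    then show ?thesis using \<open>(v' \<longlongrightarrow> v' \<theta>) (at_right \<theta>)\<close> tendsto_unique trivial_limit_at_right_real by blast
  qed
  then show "v = v'" by blast
qed

lemma no_split_before_atom:
  assumes b: "bottleneck s a" "s + M \<le> t" and atom: "(\<theta>, r0, proj x0) \<in> shocks \<mu>" "mass r0 x0 > 0"
    and out: "t \<le> r0 \<or> r0 \<le> s"
  shows "lo s a \<theta> t = hi s a \<theta> t"
proof (rule ccontr)
  assume "lo s a \<theta> t \<noteq> hi s a \<theta> t"
  moreover have "s < t" using b M_pos by simp
  ultimately have "lo s a \<theta> t < hi s a \<theta> t" using lo_le_hi[of s t a \<theta>] by simp
  then obtain h r where r: "s < r" "r < t" "mass r (h r) > 0" "(\<theta>, r, proj (h r)) \<in> shocks \<mu>"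
    using flat_crossing[OF b, of \<theta> "lo s a \<theta> t" "hi s a \<theta> t"] by (metis order_refl)
  then show False using shock_atom_unique(1)[OF r(4,3) atom] out by simp
qed

text \<open>The width \<open>hi - lo\<close> is continuous in time with values in \<open>[0, 1]\<close>, and the two shocks agree on the torus
  when it is 0 or 1. It is 0 up to the atom, positive right after it, and both 0 and 1 are absorbing
  after the atom. One of them is reached because the shocks agree once a later bottleneck, which hides
  the atom, has been passed.\<close>

lemma splitting_interval:
  assumes gs: "(\<theta>, r0, proj x0) \<in> GS \<mu>" "mass r0 x0 > 0"
    and pairs: "\<And>s a t. bottleneck s a \<Longrightarrow> s + M \<le> t \<Longrightarrow> u t = proj (lo s a \<theta> t) \<and> v t = proj (hi s a \<theta> t)"
  shows "\<exists>w>r0. {t. u t \<noteq> v t} = {r0<..<w}"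
proof -
  have sh: "(\<theta>, r0, proj x0) \<in> shocks \<mu>" using gs by (simp add: GS_def)
  have before: "u t = v t" if "t \<le> r0" for t
  proof -
    obtain s a where b: "s + M \<le> t" "bottleneck s a" using bottleneck_below by blast
    then show ?thesis using pairs[OF b(2,1)] no_split_before_atom[OF b(2,1) sh gs(2)] that by simp
  qed
  obtain s a where b: "s + M \<le> r0" "bottleneck s a" using bottleneck_below by blast
  have sr: "s < r0" using b M_pos by simp
  define q where "q t = hi s a \<theta> t - lo s a \<theta> t" for t
  have q01: "0 \<le> q t" "q t \<le> 1" if "r0 \<le> t" for t
    using lo_le_hi[of s t a \<theta>] width_le_1[OF b(2), of t \<theta>] that b M_pos by (auto simp: q_def)
  have uv: "u t = v t \<longleftrightarrow> q t \<in> {0, 1}" if "r0 \<le> t" for t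
    using pairs[OF b(2), of t] proj_lo_hi_eq_iff[OF b(2), of t \<theta>] that b(1) by (simp add: q_def)
  have qc: "isCont q t" if "r0 \<le> t" for t
    unfolding q_def using that sr by (intro continuous_intros isCont_lo isCont_hi) auto
  have qr0: "q r0 = 0" using no_split_before_atom[OF b(2,1) sh gs(2)] by (simp add: q_def)
  have near: "\<exists>e>0. \<forall>y. \<bar>y - t\<bar> < e \<longrightarrow> q y < c" if t: "r0 \<le> t" "q t < c" for t c
  proof -
    obtain e where "e > 0" "\<And>y. dist y t < e \<Longrightarrow> dist (q y) (q t) < c - q t"
      using qc[OF t(1)] t(2) unfolding continuous_at_eps_delta by (metis diff_gt_0_iff_gt)
    then show ?thesis by (intro exI[of _ e]) (force simp: dist_real_def)
  qed
  have near': "\<exists>e>0. \<forall>y. \<bar>y - t\<bar> < e \<longrightarrow> c < q y" if t: "r0 \<le> t" "c < q t" for t c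
  proof -
    obtain e where "e > 0" "\<And>y. dist y t < e \<Longrightarrow> dist (q y) (q t) < q t - c"
      using qc[OF t(1)] t(2) unfolding continuous_at_eps_delta by (metis diff_gt_0_iff_gt)
    then show ?thesis by (intro exI[of _ e]) (force simp: dist_real_def)
  qed
  have persist: "q t' \<in> {0, 1}" if "r0 < t" "t < t'" "q t \<in> {0, 1}" for t t'
  proof -
    have st: "s + M \<le> t" "s + M \<le> t'" using that b by auto
    from that(3) consider "lo s a \<theta> t = hi s a \<theta> t" | "lo s a \<theta> t + 1 \<le> hi s a \<theta> t"
      by (auto simp: q_def)
    then show ?thesis
    proof cases
      case 1
      then show ?thesis using width_0_persists[OF b(2) st(1) that(2) 1 sh gs(2) that(1)] by (simp add: q_def)
    next
      case 2
      then show ?thesis using width_1_persists[OF b(2) st(1) that(2) 2] width_le_1[OF b(2) st(2), of \<theta>] by (simp add: q_def)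
    qed
  qed
  define A where "A = {t. r0 < t \<and> q t \<in> {0, 1}}"
  define w where "w = Inf A"
  have "A \<noteq> {}"
  proof -
    obtain s1 a1 where b1: "r0 \<le> s1" "bottleneck s1 a1" using bottleneck_above by blast
    let ?t = "s1 + M"
    have "u ?t = v ?t" using pairs[OF b1(2) order_refl] no_split_before_atom[OF b1(2) order_refl sh gs(2)] b1(1) by simp
    then have "?t \<in> A" using uv[of ?t] b1(1) M_pos by (simp add: A_def)
    then show ?thesis by blast
  qed
  have bdd: "bdd_below A" by (rule bdd_belowI[of _ r0]) (simp add: A_def)
  obtain d1 where d1: "d1 > 0" "\<And>t. r0 < t \<Longrightarrow> t < r0 + d1 \<Longrightarrow> lo s a \<theta> t < hi s a \<theta> t"
    using fan_opens[OF b(2,1) gs] by blast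
  obtain d2 where d2: "d2 > 0" "\<And>y. \<bar>y - r0\<bar> < d2 \<Longrightarrow> q y < 1"
    using near[of r0 1] qr0 by auto
  have "r0 + min d1 d2 \<le> w" unfolding w_def
  proof (rule cInf_greatest[OF \<open>A \<noteq> {}\<close>])
    fix t assume t: "t \<in> A"
    show "r0 + min d1 d2 \<le> t"
    proof (rule ccontr)
      assume "\<not> r0 + min d1 d2 \<le> t"
      then have "q t > 0" "q t < 1" using t d1(2)[of t] d2(2)[of t] by (auto simp: A_def q_def)
      then show False using t by (auto simp: A_def)
    qed
  qed
  then have rw: "r0 < w" using d1(1) d2(1) by auto
  have wA: "q w \<in> {0, 1}"
  proof (rule ccontr)
    assume "q w \<notin> {0, 1}"
    then have "0 < q w" "q w < 1" using q01[of w] rw by auto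
    then obtain e1 e2 where e: "e1 > 0" "\<And>y. \<bar>y - w\<bar> < e1 \<Longrightarrow> q y < 1" "e2 > 0" "\<And>y. \<bar>y - w\<bar> < e2 \<Longrightarrow> 0 < q y"
      using near[of w 1] near'[of w 0] rw by (metis less_imp_le)
    obtain t where t: "t \<in> A" "t < w + min e1 e2"
      using cInf_lessD[OF \<open>A \<noteq> {}\<close>, of "w + min e1 e2"] e(1,3) unfolding w_def by auto
    have "w \<le> t" unfolding w_def using t(1) bdd by (rule cInf_lower)
    moreover have "t < w + e1" "t < w + e2" using t(2) by auto
    ultimately have "\<bar>t - w\<bar> < e1" "\<bar>t - w\<bar> < e2" by linarith+
    then show False using t(1) e(2)[of t] e(4)[of t] by (auto simp: A_def)
  qed
  have "u t \<noteq> v t \<longleftrightarrow> r0 < t \<and> t < w" for t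
  proof (cases "r0 < t")
    case False
    then show ?thesis using before by auto
  next
    case True
    have "q t \<in> {0, 1} \<longleftrightarrow> w \<le> t"
    proof
      assume "q t \<in> {0, 1}"
      then have "t \<in> A" using True by (simp add: A_def)
      then show "w \<le> t" unfolding w_def using bdd by (rule cInf_lower)
    next
      assume "w \<le> t"
      then show "q t \<in> {0, 1}" using persist[OF rw _ wA] wA by (cases "w = t") auto
    qed
    then show ?thesis using uv[of t] True by auto
  qed
  then have "{t. u t \<noteq> v t} = {r0<..<w}"
    by (intro set_eqI) (simp only: mem_Collect_eq greaterThanLessThan_iff)
  then show ?thesis using rw by blast
qed

theorem global_shocks_exist:
  obtains sL sR where "global_shock_functions \<mu> sL sR"
    "\<And>sL' sR'. global_shock_functions \<mu> sL' sR' \<Longrightarrow> sL' = sL \<and> sR' = sR"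
    "\<And>\<theta>. continuous_on UNIV (sL \<theta>)" "\<And>\<theta>. continuous_on UNIV (sR \<theta>)"
    "\<And>\<theta> t. sL \<theta> t \<noteq> sR \<theta> t \<Longrightarrow> \<exists>r x. (\<theta>, r, proj x) \<in> GS \<mu> \<and> mass r x > 0"
    "\<And>\<theta> r x. (\<theta>, r, proj x) \<in> GS \<mu> \<Longrightarrow> mass r x > 0 \<Longrightarrow> \<exists>w>r. {t. sL \<theta> t \<noteq> sR \<theta> t} = {r<..<w}"
proof -
  have "\<forall>t. \<exists>s a. bottleneck s a \<and> s + M \<le> t" using bottleneck_below by metis
  then obtain bs ba where bs: "\<And>t. bottleneck (bs t) (ba t)" "\<And>t. bs t + M \<le> t" by metis
  define sL where "sL \<theta> t = proj (lo (bs t) (ba t) \<theta> t)" for \<theta> t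
  define sR where "sR \<theta> t = proj (hi (bs t) (ba t) \<theta> t)" for \<theta> t
  have ok: "shock_pair t (\<lambda>\<theta>. sL \<theta> t) (\<lambda>\<theta>. sR \<theta> t)" for t
    unfolding sL_def sR_def by (rule shock_pair_lo_hi[OF bs])
  have indep: "sL \<theta> t = proj (lo s a \<theta> t) \<and> sR \<theta> t = proj (hi s a \<theta> t)" if "bottleneck s a" "s + M \<le> t" for s a t \<theta>
    using shock_pair_unique[OF ok shock_pair_lo_hi[OF that]] by metis
  have cp: "isCont proj z" for z using continuous_on_proj[of UNIV] by (simp add: continuous_on_eq_continuous_at)
  have cont: "isCont (sL \<theta>) t0 \<and> isCont (sR \<theta>) t0" for \<theta> t0
  proof -
    obtain s a where b: "s + M \<le> t0 - 1" "bottleneck s a" using bottleneck_below by blast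
    have st: "s < t0" using b M_pos by simp
    have "\<forall>\<^sub>F t in nhds t0. t0 - 1 < t" using eventually_nhds_in_open[of "{t0 - 1<..}" t0] by simp
    then have ev: "\<forall>\<^sub>F t in nhds t0. sL \<theta> t = proj (lo s a \<theta> t) \<and> sR \<theta> t = proj (hi s a \<theta> t)"
      by eventually_elim (use indep[OF b(2)] b(1) in auto)
    have c: "isCont (\<lambda>t. proj (lo s a \<theta> t)) t0" "isCont (\<lambda>t. proj (hi s a \<theta> t)) t0"
      by (intro isCont_o2[OF _ cp] isCont_lo isCont_hi st)+
    have e: "\<forall>\<^sub>F t in nhds t0. sL \<theta> t = proj (lo s a \<theta> t)" "\<forall>\<^sub>F t in nhds t0. sR \<theta> t = proj (hi s a \<theta> t)"
      using ev by (rule eventually_mono, simp)+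
    show ?thesis using isCont_cong[OF e(1)] isCont_cong[OF e(2)] c by simp
  qed
  show ?thesis
  proof (rule that)
    show "global_shock_functions \<mu> sL sR" using ok by (simp add: global_shock_functions_iff)
    show "sL' = sL \<and> sR' = sR" if "global_shock_functions \<mu> sL' sR'" for sL' sR'
    proof -
      have "shock_pair t (\<lambda>\<theta>. sL' \<theta> t) (\<lambda>\<theta>. sR' \<theta> t)" for t using that by (simp add: global_shock_functions_iff)
      from shock_pair_unique[OF this ok] show ?thesis by (auto simp: fun_eq_iff)
    qed
    show "continuous_on UNIV (sL \<theta>)" "continuous_on UNIV (sR \<theta>)" for \<theta>
      using cont by (auto simp: continuous_on_eq_continuous_at)
    show "\<exists>r x. (\<theta>, r, proj x) \<in> GS \<mu> \<and> mass r x > 0" if "sL \<theta> t \<noteq> sR \<theta> t" for \<theta> t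
    proof -
      have st: "bs t < t" using bs(2)[of t] M_pos by simp
      have "lo (bs t) (ba t) \<theta> t < hi (bs t) (ba t) \<theta> t"
        using that lo_le_hi[OF st, of "ba t" \<theta>] by (auto simp: sL_def sR_def less_le)
      from flat_crossing[OF bs(1,2) order_refl this order_refl]
      obtain h r where "mass r (h r) > 0" "(\<theta>, r, proj (h r)) \<in> shocks \<mu>" by metis
      then show ?thesis using shock_atoms by blast
    qed
    show "\<exists>w>r. {t. sL \<theta> t \<noteq> sR \<theta> t} = {r<..<w}" if "(\<theta>, r, proj x) \<in> GS \<mu>" "mass r x > 0" for \<theta> r x
      using splitting_interval[OF that, of "sL \<theta>" "sR \<theta>"] indep by blast
  qed
qed

end

theorem theorem1p8:
  fixes \<mu> :: "(real \<times> torus) measure"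
  assumes "\<mu> \<in> Omega_tilde"
  shows "\<exists>sL sR :: real \<Rightarrow> real \<Rightarrow> torus.
    global_shock_functions \<mu> sL sR \<and>
    (\<forall>sL' sR'. global_shock_functions \<mu> sL' sR' \<longrightarrow> sL' = sL \<and> sR' = sR) \<and>
    (\<forall>\<theta>. \<forall>s\<in>{sL, sR}. continuous_on UNIV (\<lambda>t. s \<theta> t)) \<and>
    (\<forall>\<theta>. \<theta> \<notin> Theta_otimes \<mu> \<longrightarrow> (\<forall>t. sL \<theta> t = sR \<theta> t)) \<and>
    (\<forall>\<theta>. \<theta> \<in> Theta_otimes \<mu> \<longrightarrow>
      (\<exists>w > s_otimes \<mu> \<theta>. {t. sL \<theta> t \<noteq> sR \<theta> t} = {s_otimes \<mu> \<theta><..<w}))"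
proof -
  have "\<mu> \<in> Omega1" using assms by (simp add: Omega_tilde_def)
  then obtain M base where base: "\<mu> \<in> Omega" "M > 0" "\<And>t. base t \<le> t - M"
    "\<And>t. \<exists>y. msupp \<mu> \<inter> ({base t - M..base t + M} \<times> UNIV) = {(base t, y)} \<and> measure \<mu> {(base t, y)} > 1 / (4 * M)"
    "filterlim base at_top at_top"
    unfolding Omega1_def by blast
  interpret bottlenecks \<mu> M base by unfold_locales (rule base)+
  have card1: "finite (GS_at \<mu> \<theta> \<inter> msupp \<mu>)" "card (GS_at \<mu> \<theta> \<inter> msupp \<mu>) \<le> 1"
    and sh: "shocks_at \<mu> \<theta> \<inter> msupp \<mu> \<subseteq> GS_at \<mu> \<theta>" for \<theta>
    using assms by (auto simp: Omega_tilde_def)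
  have inI: "(r, proj x) \<in> GS_at \<mu> \<theta> \<inter> msupp \<mu>" if "(\<theta>, r, proj x) \<in> GS \<mu>" "mass r x > 0" for \<theta> r x
    using that by (simp add: GS_at_def mass_pos_iff)
  interpret simple_bottlenecks \<mu> M base
  proof
    fix \<theta> r x q y
    show "(\<theta>, r, proj x) \<in> GS \<mu>" if "(\<theta>, r, proj x) \<in> shocks \<mu>" "mass r x > 0"
      using sh[of \<theta>] that by (auto simp: shocks_at_def GS_at_def mass_pos_iff)
    show "r = q \<and> proj x = proj y" if "(\<theta>, r, proj x) \<in> GS \<mu>" "mass r x > 0" "(\<theta>, q, proj y) \<in> GS \<mu>" "mass q y > 0"
    proof -
      have "\<forall>p\<in>GS_at \<mu> \<theta> \<inter> msupp \<mu>. \<forall>p'\<in>GS_at \<mu> \<theta> \<inter> msupp \<mu>. p = p'"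
        using card1[of \<theta>] by (simp add: card_le_Suc0_iff_eq)
      then have "(r, proj x) = (q, proj y)" using inI[OF that(1,2)] inI[OF that(3,4)] by blast
      then show ?thesis by simp
    qed
  qed
  obtain sL sR where S: "global_shock_functions \<mu> sL sR"
    "\<And>sL' sR'. global_shock_functions \<mu> sL' sR' \<Longrightarrow> sL' = sL \<and> sR' = sR"
    "\<And>\<theta>. continuous_on UNIV (sL \<theta>)" "\<And>\<theta>. continuous_on UNIV (sR \<theta>)"
    "\<And>\<theta> t. sL \<theta> t \<noteq> sR \<theta> t \<Longrightarrow> \<exists>r x. (\<theta>, r, proj x) \<in> GS \<mu> \<and> mass r x > 0"
    "\<And>\<theta> r x. (\<theta>, r, proj x) \<in> GS \<mu> \<Longrightarrow> mass r x > 0 \<Longrightarrow> \<exists>w>r. {t. sL \<theta> t \<noteq> sR \<theta> t} = {r<..<w}"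
    using global_shocks_exist by blast
  have off: "sL \<theta> t = sR \<theta> t" if no: "\<theta> \<notin> Theta_otimes \<mu>" for \<theta> t
  proof (rule ccontr)
    assume "sL \<theta> t \<noteq> sR \<theta> t"
    then obtain r x where "(\<theta>, r, proj x) \<in> GS \<mu>" "mass r x > 0" using S(5) by blast
    then have "GS_at \<mu> \<theta> \<inter> msupp \<mu> \<noteq> {}" using inI by blast
    then have "card (GS_at \<mu> \<theta> \<inter> msupp \<mu>) \<noteq> 0" using card1(1)[of \<theta>] by simp
    then have "card (GS_at \<mu> \<theta> \<inter> msupp \<mu>) = 1" using card1(2)[of \<theta>] by linarith
    then show False using no by (simp add: Theta_otimes_def)
  qed
  have on: "\<exists>w>s_otimes \<mu> \<theta>. {t. sL \<theta> t \<noteq> sR \<theta> t} = {s_otimes \<mu> \<theta><..<w}" if \<theta>: "\<theta> \<in> Theta_otimes \<mu>" for \<theta>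
  proof -
    obtain p where p: "GS_at \<mu> \<theta> \<inter> msupp \<mu> = {p}"
      using \<theta> by (auto simp: Theta_otimes_def card_1_singleton_iff)
    obtain x where x: "snd p = proj x" using proj_surj by blast
    have "s_otimes \<mu> \<theta> = fst p" by (simp add: s_otimes_def p)
    moreover have "p \<in> GS_at \<mu> \<theta>" "p \<in> msupp \<mu>" using p by auto
    then have "(\<theta>, fst p, proj x) \<in> GS \<mu>" "mass (fst p) x > 0"
      by (auto simp: GS_at_def mass_pos_iff x[symmetric])
    then have "\<exists>w>fst p. {t. sL \<theta> t \<noteq> sR \<theta> t} = {fst p<..<w}" by (rule S(6))
    ultimately show ?thesis by simp
  qed
  show ?thesis
  proof (rule exI[of _ sL], rule exI[of _ sR], intro conjI)
    show "\<forall>\<theta>. \<forall>s\<in>{sL, sR}. continuous_on UNIV (\<lambda>t. s \<theta> t)" using S(3,4) by simp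
  qed (use S(1,2) off on in blast)+
qed

end
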